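(* Let $\mathfrak S=(R_x,{}_yA_x)$ be a species, let $S$ be a common central subring of each $R_x$ that acts centrally on each ${}_yA_x$ (that is, $sa=as$ for all $s\in S$, $a\in{}_yA_x$, $(y,x)\in\mathsf C^2$), and let $M=({}_xM,{}_y\alpha_x)$ be a representation of $\mathfrak S$. If each ${}_xM$ is artinian as an $S$-module, then $M$ is a direct sum of strongly indecomposable representations of $\mathfrak S$.
   Context: $\mathsf C$ is a fixed set of arbitrary cardinality; rings are associative and unital. A species $\mathfrak S=(R_x,{}_yA_x)$ consists of a ring $R_x$ for each $x\in\mathsf C$ and an $R_y$-$R_x$-bimodule ${}_yA_x$ for each $(y,x)\in\mathsf C^2$. An $\mathfrak S$-representation $({}_xM,{}_y\alpha_x)$ consists of a left $R_x$-module ${}_xM$ for each $x\in\mathsf C$ and a left $R_y$-linear map ${}_y\alpha_x\colon {}_yA_x\otimes_{R_x}{}_xM\to{}_yM$ for each $(y,x)\in\mathsf C^2$. A morphism $({}_xf)\colon({}_xM,{}_y\alpha_x)\to({}_xN,{}_y\beta_x)$ consists of $R_x$-linear maps ${}_xf\colon{}_xM\to{}_xN$ such that ${}_y\beta_x\circ(1_{{}_yA_x}\otimes{}_xf)={}_yf\circ{}_y\alpha_x$ for all $(y,x)$. $\mathrm{Rep}(\mathfrak S)$ is the category of $\mathfrak S$-representations. A representation is strongly indecomposable if its endomorphism ring in $\mathrm{Rep}(\mathfrak S)$ is local. *)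

theory Defs
  imports "HOL-Algebra.Algebra"
begin

section \<open>Modules and bimodules over noncommutative rings\<close>

text \<open>The locale \<^locale>\<open>module\<close> demands a commutative ring of scalars; the following has the
  same axioms for left modules over an arbitrary unital ring.\<close>

locale left_module = R?: ring R + M?: abelian_group M
  for R :: "('r, 'x) ring_scheme" (structure) and M :: "('r, 'm, 'y) module_scheme" (structure) +
  assumes smult_closed:
      "\<lbrakk>a \<in> carrier R; x \<in> carrier M\<rbrakk> \<Longrightarrow> a \<odot>\<^bsub>M\<^esub> x \<in> carrier M"
    and smult_l_distr:
      "\<lbrakk>a \<in> carrier R; b \<in> carrier R; x \<in> carrier M\<rbrakk> \<Longrightarrow>
       (a \<oplus> b) \<odot>\<^bsub>M\<^esub> x = a \<odot>\<^bsub>M\<^esub> x \<oplus>\<^bsub>M\<^esub> b \<odot>\<^bsub>M\<^esub> x"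
    and smult_r_distr:
      "\<lbrakk>a \<in> carrier R; x \<in> carrier M; y \<in> carrier M\<rbrakk> \<Longrightarrow>
       a \<odot>\<^bsub>M\<^esub> (x \<oplus>\<^bsub>M\<^esub> y) = a \<odot>\<^bsub>M\<^esub> x \<oplus>\<^bsub>M\<^esub> a \<odot>\<^bsub>M\<^esub> y"
    and smult_assoc:
      "\<lbrakk>a \<in> carrier R; b \<in> carrier R; x \<in> carrier M\<rbrakk> \<Longrightarrow>
       (a \<otimes> b) \<odot>\<^bsub>M\<^esub> x = a \<odot>\<^bsub>M\<^esub> (b \<odot>\<^bsub>M\<^esub> x)"
    and smult_one: "x \<in> carrier M \<Longrightarrow> \<one> \<odot>\<^bsub>M\<^esub> x = x"

text \<open>As for modules, the ring fields \<open>mult\<close> and \<open>one\<close> of the record carry no meaning.\<close>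

record ('l, 'r, 'a) bimodule = "('l, 'a) module" +
  rsmult :: "'a \<Rightarrow> 'r \<Rightarrow> 'a"

locale bimodule = L?: left_module L A + R?: ring R
  for L :: "('l, 'x) ring_scheme" (structure) and R :: "('r, 'y) ring_scheme" (structure)
    and A :: "('l, 'r, 'a, 'z) bimodule_scheme" (structure) +
  assumes rsmult_closed:
      "\<lbrakk>a \<in> carrier A; r \<in> carrier R\<rbrakk> \<Longrightarrow> rsmult A a r \<in> carrier A"
    and rsmult_r_distr:
      "\<lbrakk>a \<in> carrier A; r \<in> carrier R; s \<in> carrier R\<rbrakk> \<Longrightarrow>
       rsmult A a (r \<oplus>\<^bsub>R\<^esub> s) = rsmult A a r \<oplus>\<^bsub>A\<^esub> rsmult A a s"
    and rsmult_l_distr: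
      "\<lbrakk>a \<in> carrier A; b \<in> carrier A; r \<in> carrier R\<rbrakk> \<Longrightarrow>
       rsmult A (a \<oplus>\<^bsub>A\<^esub> b) r = rsmult A a r \<oplus>\<^bsub>A\<^esub> rsmult A b r"
    and rsmult_assoc:
      "\<lbrakk>a \<in> carrier A; r \<in> carrier R; s \<in> carrier R\<rbrakk> \<Longrightarrow>
       rsmult A a (r \<otimes>\<^bsub>R\<^esub> s) = rsmult A (rsmult A a r) s"
    and rsmult_one: "a \<in> carrier A \<Longrightarrow> rsmult A a \<one>\<^bsub>R\<^esub> = a"
    and smult_rsmult:
      "\<lbrakk>l \<in> carrier L; a \<in> carrier A; r \<in> carrier R\<rbrakk> \<Longrightarrow>
       rsmult A (l \<odot>\<^bsub>A\<^esub> a) r = l \<odot>\<^bsub>A\<^esub> rsmult A a r"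

definition left_linear ::
  "('r, 'x) ring_scheme \<Rightarrow> ('r, 'm, 'y) module_scheme \<Rightarrow> ('r, 'n, 'z) module_scheme \<Rightarrow> ('m \<Rightarrow> 'n) set"
  where "left_linear R M N =
    {f \<in> carrier M \<rightarrow> carrier N.
      (\<forall>m\<in>carrier M. \<forall>m'\<in>carrier M. f (m \<oplus>\<^bsub>M\<^esub> m') = f m \<oplus>\<^bsub>N\<^esub> f m') \<and>
      (\<forall>r\<in>carrier R. \<forall>m\<in>carrier M. f (r \<odot>\<^bsub>M\<^esub> m) = r \<odot>\<^bsub>N\<^esub> f m)}"

definition artinian_module ::
  "('r, 'x) ring_scheme \<Rightarrow> ('r, 'm, 'y) module_scheme \<Rightarrow> bool"
  where "artinian_module R M \<longleftrightarrow> left_module R M \<and>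
    (\<forall>N :: nat \<Rightarrow> 'm set.
      (\<forall>n. submodule (N n) R M) \<and> (\<forall>n. N (Suc n) \<subseteq> N n) \<longrightarrow> (\<exists>k. \<forall>n\<ge>k. N n = N k))"

definition restrict_scalars ::
  "('s \<Rightarrow> 'r) \<Rightarrow> ('r, 'm, 'x) module_scheme \<Rightarrow> ('s, 'm) module"
  where "restrict_scalars \<iota> M =
    \<lparr>carrier = carrier M, monoid.mult = monoid.mult M, one = one M,
     ring.zero = ring.zero M, ring.add = ring.add M,
     smult = (\<lambda>s m. \<iota> s \<odot>\<^bsub>M\<^esub> m)\<rparr>"

definition module_direct_sum ::
  "'i set \<Rightarrow> ('i \<Rightarrow> ('r, 'm, 'x) module_scheme) \<Rightarrow> ('r, 'i \<Rightarrow> 'm) module"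
  where "module_direct_sum I M =
    (let G = sum_group I (\<lambda>i. add_monoid (M i)) in
     \<lparr>carrier = carrier G, monoid.mult = undefined, one = undefined, ring.zero = one G, ring.add = monoid.mult G,
      smult = (\<lambda>r m. \<lambda>i\<in>I. r \<odot>\<^bsub>M i\<^esub> m i)\<rparr>)"


section \<open>Tensor products\<close>

text \<open>The tensor product of a bimodule \<open>A\<close> with a left module \<open>M\<close> over \<open>R\<close> is the free abelian
  group on pairs \<open>(a, m)\<close> modulo the subgroup generated by the biadditivity and \<open>R\<close>-balancedness
  relations. Its elements are cosets.\<close>

abbreviation tensor_free ::
  "('l, 'r, 'a, 'x) bimodule_scheme \<Rightarrow> ('r, 'm, 'y) module_scheme \<Rightarrow> ('a \<times> 'm \<Rightarrow>\<^sub>0 int) monoid"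
  where "tensor_free A M \<equiv> free_Abelian_group (carrier A \<times> carrier M)"

definition tensor_relations ::
  "('r, 'z) ring_scheme \<Rightarrow> ('l, 'r, 'a, 'x) bimodule_scheme \<Rightarrow> ('r, 'm, 'y) module_scheme
    \<Rightarrow> ('a \<times> 'm \<Rightarrow>\<^sub>0 int) set"
  where "tensor_relations R A M =
    {frag_of (a \<oplus>\<^bsub>A\<^esub> b, m) - (frag_of (a, m) + frag_of (b, m)) | a b m.
      a \<in> carrier A \<and> b \<in> carrier A \<and> m \<in> carrier M} \<union>
    {frag_of (a, m \<oplus>\<^bsub>M\<^esub> n) - (frag_of (a, m) + frag_of (a, n)) | a m n.
      a \<in> carrier A \<and> m \<in> carrier M \<and> n \<in> carrier M} \<union>
    {frag_of (rsmult A a r, m) - frag_of (a, r \<odot>\<^bsub>M\<^esub> m) | a r m.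
      a \<in> carrier A \<and> r \<in> carrier R \<and> m \<in> carrier M}"

definition tensor_kernel ::
  "('r, 'z) ring_scheme \<Rightarrow> ('l, 'r, 'a, 'x) bimodule_scheme \<Rightarrow> ('r, 'm, 'y) module_scheme
    \<Rightarrow> ('a \<times> 'm \<Rightarrow>\<^sub>0 int) set"
  where "tensor_kernel R A M = generate (tensor_free A M) (tensor_relations R A M)"

text \<open>\<open>tensor_map R A N g f\<close> is the map \<open>g \<otimes> f\<close> from \<open>A \<otimes> M\<close> to \<open>A \<otimes> N\<close>, where \<open>f\<close> maps \<open>M\<close>
  to \<open>N\<close> and \<open>g\<close> maps \<open>A\<close> to \<open>A\<close>: it sends the coset of \<open>(a, m)\<close> to the coset of \<open>(g a, f m)\<close>.
  The union is over all representatives of the argument; for linear \<open>g\<close> and \<open>f\<close> all of them give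
  the same coset.\<close>

definition tensor_map ::
  "('r, 'z) ring_scheme \<Rightarrow> ('l, 'r, 'a, 'x) bimodule_scheme \<Rightarrow> ('r, 'n, 'y) module_scheme
    \<Rightarrow> ('a \<Rightarrow> 'a) \<Rightarrow> ('m \<Rightarrow> 'n) \<Rightarrow> ('a \<times> 'm \<Rightarrow>\<^sub>0 int) set \<Rightarrow> ('a \<times> 'n \<Rightarrow>\<^sub>0 int) set"
  where "tensor_map R A N g f t =
    (\<Union>p\<in>t. tensor_kernel R A N #>\<^bsub>tensor_free A N\<^esub>
        frag_extend (\<lambda>(a, m). frag_of (g a, f m)) p)"

definition tensor ::
  "('r, 'z) ring_scheme \<Rightarrow> ('l, 'r, 'a, 'x) bimodule_scheme \<Rightarrow> ('r, 'm, 'y) module_scheme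
    \<Rightarrow> ('l, ('a \<times> 'm \<Rightarrow>\<^sub>0 int) set) module"
  where "tensor R A M =
    (let T = tensor_free A M Mod tensor_kernel R A M in
     \<lparr>carrier = carrier T, monoid.mult = undefined, one = undefined, ring.zero = one T, ring.add = monoid.mult T,
      smult = (\<lambda>l. tensor_map R A M (\<lambda>a. l \<odot>\<^bsub>A\<^esub> a) (\<lambda>m. m))\<rparr>)"


section \<open>Species and their representations\<close>

text \<open>\<open>arrow S y x\<close> is the bimodule from \<open>x\<close> to \<open>y\<close>, with \<open>ring_at S y\<close> acting on the left and
  \<open>ring_at S x\<close> on the right.\<close>

record ('c, 'r, 'a) species =
  vertices :: "'c set"
  ring_at :: "'c \<Rightarrow> 'r ring"
  arrow :: "'c \<Rightarrow> 'c \<Rightarrow> ('r, 'r, 'a) bimodule"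

definition is_species :: "('c, 'r, 'a) species \<Rightarrow> bool"
  where "is_species \<SS> \<longleftrightarrow>
    (\<forall>x\<in>vertices \<SS>. ring (ring_at \<SS> x)) \<and>
    (\<forall>y\<in>vertices \<SS>. \<forall>x\<in>vertices \<SS>. bimodule (ring_at \<SS> y) (ring_at \<SS> x) (arrow \<SS> y x))"

text \<open>A common subring of rings with unrelated carriers is a ring \<open>S\<close> together with an embedding
  \<open>\<iota> x\<close> into each of them; if \<open>S\<close> is literally contained in all of them, \<open>\<iota> x\<close> is the
  inclusion. An element \<open>s\<close> of \<open>S\<close> acts on a bimodule from the left and from the right through
  the respective embeddings.\<close>

definition common_central_subring ::
  "('c, 'r, 'a) species \<Rightarrow> 's ring \<Rightarrow> ('c \<Rightarrow> 's \<Rightarrow> 'r) \<Rightarrow> bool"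
  where "common_central_subring \<SS> S \<iota> \<longleftrightarrow>
    ring S \<and>
    (\<forall>x\<in>vertices \<SS>. \<iota> x \<in> ring_hom S (ring_at \<SS> x) \<and> inj_on (\<iota> x) (carrier S)) \<and>
    (\<forall>x\<in>vertices \<SS>. \<forall>s\<in>carrier S. \<forall>r\<in>carrier (ring_at \<SS> x).
      \<iota> x s \<otimes>\<^bsub>ring_at \<SS> x\<^esub> r = r \<otimes>\<^bsub>ring_at \<SS> x\<^esub> \<iota> x s)"

definition acts_centrally ::
  "('c, 'r, 'a) species \<Rightarrow> 's ring \<Rightarrow> ('c \<Rightarrow> 's \<Rightarrow> 'r) \<Rightarrow> bool"
  where "acts_centrally \<SS> S \<iota> \<longleftrightarrow>
    (\<forall>y\<in>vertices \<SS>. \<forall>x\<in>vertices \<SS>. \<forall>s\<in>carrier S. \<forall>a\<in>carrier (arrow \<SS> y x).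
      \<iota> y s \<odot>\<^bsub>arrow \<SS> y x\<^esub> a = rsmult (arrow \<SS> y x) a (\<iota> x s))"

record ('c, 'r, 'a, 'm) rep =
  module_at :: "'c \<Rightarrow> ('r, 'm) module"
  structure_map :: "'c \<Rightarrow> 'c \<Rightarrow> ('a \<times> 'm \<Rightarrow>\<^sub>0 int) set \<Rightarrow> 'm"

abbreviation rep_tensor ::
  "('c, 'r, 'a) species \<Rightarrow> ('c, 'r, 'a, 'm) rep \<Rightarrow> 'c \<Rightarrow> 'c
    \<Rightarrow> ('r, ('a \<times> 'm \<Rightarrow>\<^sub>0 int) set) module"
  where "rep_tensor \<SS> M y x \<equiv> tensor (ring_at \<SS> x) (arrow \<SS> y x) (module_at M x)"

definition is_representation :: "('c, 'r, 'a) species \<Rightarrow> ('c, 'r, 'a, 'm) rep \<Rightarrow> bool"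
  where "is_representation \<SS> M \<longleftrightarrow>
    (\<forall>x\<in>vertices \<SS>. left_module (ring_at \<SS> x) (module_at M x)) \<and>
    (\<forall>y\<in>vertices \<SS>. \<forall>x\<in>vertices \<SS>.
      structure_map M y x \<in> left_linear (ring_at \<SS> y) (rep_tensor \<SS> M y x) (module_at M y))"

text \<open>Morphisms are extensional functions, so that equality of morphisms is equality in HOL.\<close>

definition rep_hom ::
  "('c, 'r, 'a) species \<Rightarrow> ('c, 'r, 'a, 'm) rep \<Rightarrow> ('c, 'r, 'a, 'n) rep \<Rightarrow> ('c \<Rightarrow> 'm \<Rightarrow> 'n) set"
  where "rep_hom \<SS> M N =
    {f \<in> (\<Pi>\<^sub>E x\<in>vertices \<SS>. left_linear (ring_at \<SS> x) (module_at M x) (module_at N x)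
                          \<inter> extensional (carrier (module_at M x))).
      \<forall>y\<in>vertices \<SS>. \<forall>x\<in>vertices \<SS>. \<forall>t\<in>carrier (rep_tensor \<SS> M y x).
        structure_map N y x
          (tensor_map (ring_at \<SS> x) (arrow \<SS> y x) (module_at N x) (\<lambda>a. a) (f x) t)
        = f y (structure_map M y x t)}"

definition rep_id :: "('c, 'r, 'a) species \<Rightarrow> ('c, 'r, 'a, 'm) rep \<Rightarrow> 'c \<Rightarrow> 'm \<Rightarrow> 'm"
  where "rep_id \<SS> M = (\<lambda>x\<in>vertices \<SS>. \<lambda>m\<in>carrier (module_at M x). m)"

definition rep_comp ::
  "('c, 'r, 'a) species \<Rightarrow> ('c, 'r, 'a, 'm) rep \<Rightarrow> ('c \<Rightarrow> 'n \<Rightarrow> 'k) \<Rightarrow> ('c \<Rightarrow> 'm \<Rightarrow> 'n)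
    \<Rightarrow> 'c \<Rightarrow> 'm \<Rightarrow> 'k"
  where "rep_comp \<SS> M g f = (\<lambda>x\<in>vertices \<SS>. compose (carrier (module_at M x)) (g x) (f x))"

definition rep_isomorphic ::
  "('c, 'r, 'a) species \<Rightarrow> ('c, 'r, 'a, 'm) rep \<Rightarrow> ('c, 'r, 'a, 'n) rep \<Rightarrow> bool"
  where "rep_isomorphic \<SS> M N \<longleftrightarrow>
    (\<exists>f\<in>rep_hom \<SS> M N. \<exists>g\<in>rep_hom \<SS> N M.
      rep_comp \<SS> M g f = rep_id \<SS> M \<and> rep_comp \<SS> N f g = rep_id \<SS> N)"

definition rep_End ::
  "('c, 'r, 'a) species \<Rightarrow> ('c, 'r, 'a, 'm) rep \<Rightarrow> ('c \<Rightarrow> 'm \<Rightarrow> 'm) ring"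
  where "rep_End \<SS> M =
    \<lparr>carrier = rep_hom \<SS> M M, monoid.mult = rep_comp \<SS> M, one = rep_id \<SS> M,
     ring.zero = (\<lambda>x\<in>vertices \<SS>. \<lambda>m\<in>carrier (module_at M x). \<zero>\<^bsub>module_at M x\<^esub>),
     ring.add = (\<lambda>f g. \<lambda>x\<in>vertices \<SS>. \<lambda>m\<in>carrier (module_at M x). f x m \<oplus>\<^bsub>module_at M x\<^esub> g x m)\<rparr>"

text \<open>A (noncommutative) ring is local if its non-units form a two-sided ideal. This excludes the
  zero ring, in which the set of non-units is empty.\<close>

definition local_ring :: "('r, 'x) ring_scheme \<Rightarrow> bool"
  where "local_ring R \<longleftrightarrow> ring R \<and> ideal (carrier R - Units R) R"

definition strongly_indecomposable ::
  "('c, 'r, 'a) species \<Rightarrow> ('c, 'r, 'a, 'm) rep \<Rightarrow> bool"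
  where "strongly_indecomposable \<SS> M \<longleftrightarrow> local_ring (rep_End \<SS> M)"

text \<open>The structure maps of the direct sum are determined by
  \<open>(a \<otimes> m)\<^sub>i \<mapsto> \<alpha>\<^sub>i (a \<otimes> m\<^sub>i)\<close>, that is, the \<open>i\<close>-th component is the structure map of
  the \<open>i\<close>-th summand after \<open>1 \<otimes> \<pi>\<^sub>i\<close>.\<close>

definition rep_direct_sum ::
  "('c, 'r, 'a) species \<Rightarrow> 'i set \<Rightarrow> ('i \<Rightarrow> ('c, 'r, 'a, 'm) rep) \<Rightarrow> ('c, 'r, 'a, 'i \<Rightarrow> 'm) rep"
  where "rep_direct_sum \<SS> I N =
    \<lparr>module_at = (\<lambda>x. module_direct_sum I (\<lambda>i. module_at (N i) x)),
     structure_map = (\<lambda>y x t. \<lambda>i\<in>I. structure_map (N i) y x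
       (tensor_map (ring_at \<SS> x) (arrow \<SS> y x) (module_at (N i) x) (\<lambda>a. a) (\<lambda>m. m i) t))\<rparr>"

end

theory Submission
  imports Defs
begin

text \<open>
  Take a maximal set \<open>B\<close> of pairwise commuting idempotents of the endomorphism ring of \<open>M\<close>. For an
  idempotent \<open>e\<close> the images \<open>e\<^sub>x M\<^sub>x\<close> are \<open>S\<close>-submodules, so by the descending chain condition every
  element of \<open>B\<close> that is nonzero at a vertex \<open>x\<close> lies above an atom of \<open>B\<close> that is nonzero at \<open>x\<close>;
  at each \<open>x\<close> only finitely many atoms are nonzero, and they sum to the identity. Hence \<open>M\<close> is the
  direct sum of the images of the atoms, and by maximality these images have no idempotent
  endomorphisms besides \<open>0\<close> and \<open>1\<close>.

  It remains to see that an artinian \<open>N\<close> with only trivial idempotents has a local endomorphism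
  ring. Fitting's lemma is not available, as the \<open>N\<^sub>x\<close> need not be noetherian. Instead, for an
  endomorphism \<open>\<phi>\<close> let \<open>T\<close> be a commutative ring of endomorphisms containing \<open>\<phi>\<close> and the scalars
  from \<open>S\<close>. For \<open>m\<close> in \<open>N\<^sub>x\<close> the chain of the \<open>\<phi>\<^sup>n T m\<close> stabilises, which splits \<open>m\<close> into a part killed by
  a power of \<open>\<phi>\<close> and a part fixed by \<open>t \<phi>\<close> for some \<open>t\<close> in \<open>T\<close>. These parts form complementary
  subrepresentations, so one of them is \<open>N\<close>, and \<open>1 - \<phi>\<close> or \<open>\<phi>\<close> is invertible.
\<close>

section \<open>Tensor products\<close>

text \<open>Only the single modules \<open>M\<^sub>x\<close> are artinian. With infinitely many
  vertices the representation as a whole need not satisfy any chain condition, so neither a minimal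
  idempotent nor repeated splitting is available globally. Minimal choices are made at one vertex at
  a time and depend on the vertex; they fit together into one endomorphism because all competing
  idempotents commute, and maximality brings the glued idempotent back into \<open>B\<close>.

  The usual stable image and union of kernels cannot serve in Fitting's lemma: multiplication by p
  on the Pruefer p-group is surjective and also locally nilpotent, so both would be the whole group.
  Working with the orbit T m of a single element avoids this, since an equation \<phi>^k m = t
  \<phi>^(k+1) m with t in T exhibits \<phi>^k m as a fixed point of t \<phi>. T consists of
  endomorphisms of the entire representation and not of operators at one vertex, so that parts
  defined vertex by vertex are compatible with the structure maps.\<close>

locale balanced_pair =
  fixes R :: "('r, 'z) ring_scheme" and A :: "('l, 'r, 'a, 'x) bimodule_scheme"
    and M :: "('r, 'm, 'y) module_scheme"
  assumes left_add_closed: "\<lbrakk>a \<in> carrier A; b \<in> carrier A\<rbrakk> \<Longrightarrow> a \<oplus>\<^bsub>A\<^esub> b \<in> carrier A"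
    and right_add_closed: "\<lbrakk>m \<in> carrier M; n \<in> carrier M\<rbrakk> \<Longrightarrow> m \<oplus>\<^bsub>M\<^esub> n \<in> carrier M"
    and left_act_closed: "\<lbrakk>a \<in> carrier A; r \<in> carrier R\<rbrakk> \<Longrightarrow> rsmult A a r \<in> carrier A"
    and right_act_closed: "\<lbrakk>r \<in> carrier R; m \<in> carrier M\<rbrakk> \<Longrightarrow> r \<odot>\<^bsub>M\<^esub> m \<in> carrier M"

abbreviation tensor_class ::
  "('r, 'z) ring_scheme \<Rightarrow> ('l, 'r, 'a, 'x) bimodule_scheme \<Rightarrow> ('r, 'm, 'y) module_scheme
    \<Rightarrow> ('a \<times> 'm \<Rightarrow>\<^sub>0 int) \<Rightarrow> ('a \<times> 'm \<Rightarrow>\<^sub>0 int) set"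
  where "tensor_class R A M p \<equiv> tensor_kernel R A M #>\<^bsub>tensor_free A M\<^esub> p"

abbreviation frag_map :: "('a \<Rightarrow> 'b) \<Rightarrow> ('m \<Rightarrow> 'n) \<Rightarrow> ('a \<times> 'm \<Rightarrow>\<^sub>0 int) \<Rightarrow> ('b \<times> 'n \<Rightarrow>\<^sub>0 int)"
  where "frag_map g f \<equiv> frag_extend (\<lambda>(a, m). frag_of (g a, f m))"

lemma keys_frag_map:
  assumes "Poly_Mapping.keys p \<subseteq> A \<times> M" "\<And>a. a \<in> A \<Longrightarrow> g a \<in> B" "\<And>m. m \<in> M \<Longrightarrow> f m \<in> N"
  shows "Poly_Mapping.keys (frag_map g f p) \<subseteq> B \<times> N"
  using keys_frag_extend[of "\<lambda>(a, m). frag_of (g a, f m)" p] assms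
  by (fastforce simp: keys_frag_of split: prod.splits)

context balanced_pair
begin

lemma tensor_relations_closed: "tensor_relations R A M \<subseteq> carrier (tensor_free A M)"
proof -
  have diff: "frag_of p - q \<in> carrier (free_Abelian_group Y)"
    if "p \<in> Y" "q \<in> carrier (free_Abelian_group Y)" for p :: "'a \<times> 'm" and q Y
    using keys_diff[of "frag_of p" q] that by (auto simp: keys_frag_of)
  have add: "frag_of p + frag_of q \<in> carrier (free_Abelian_group Y)"
    if "p \<in> Y" "q \<in> Y" for p q :: "'a \<times> 'm" and Y
    using keys_add[of "frag_of p" "frag_of q"] that by (auto simp: keys_frag_of)
  show ?thesis
    unfolding tensor_relations_def
    by (intro Un_least subsetI; elim CollectE exE conjE; hypsubst; intro diff add)
      (auto simp: left_add_closed right_add_closed left_act_closed right_act_closed)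
qed

lemma normal_tensor_kernel: "tensor_kernel R A M \<lhd> tensor_free A M"
proof -
  interpret comm_group "tensor_free A M" by (rule abelian_free_Abelian_group)
  show ?thesis
    unfolding tensor_kernel_def
    by (intro subgroup_imp_normal generate_is_subgroup tensor_relations_closed)
qed

lemma tensor_kernel_closed:
  "k \<in> tensor_kernel R A M \<Longrightarrow> Poly_Mapping.keys k \<subseteq> carrier A \<times> carrier M"
  using normal.axioms(1)[OF normal_tensor_kernel] subgroup.subset by force

lemma tensor_kernel_zero: "0 \<in> tensor_kernel R A M"
  using subgroup.one_closed[OF normal.axioms(1)[OF normal_tensor_kernel]] by simp

lemma tensor_kernel_add:
  "\<lbrakk>k \<in> tensor_kernel R A M; l \<in> tensor_kernel R A M\<rbrakk> \<Longrightarrow> k + l \<in> tensor_kernel R A M"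
  using subgroup.m_closed[OF normal.axioms(1)[OF normal_tensor_kernel], of k l] by simp

lemma tensor_kernel_minus: "k \<in> tensor_kernel R A M \<Longrightarrow> - k \<in> tensor_kernel R A M"
  using subgroup.m_inv_closed[OF normal.axioms(1)[OF normal_tensor_kernel], of k]
    tensor_kernel_closed[of k] by simp

lemma tensor_class_eqI:
  assumes "p - q \<in> tensor_kernel R A M"
  shows "tensor_class R A M p = tensor_class R A M q"
proof -
  have "\<exists>l\<in>tensor_kernel R A M. k + u = l + v"
    if "k \<in> tensor_kernel R A M" "u - v \<in> tensor_kernel R A M" for k u v
    using tensor_kernel_add[OF that] by (intro bexI) auto
  from this[OF _ assms] this[OF _, of _ q p] tensor_kernel_minus[OF assms] show ?thesis
    by (fastforce simp: r_coset_def)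
qed

lemma carrier_tensor:
  "carrier (tensor R A M)
    = tensor_class R A M ` {p. Poly_Mapping.keys p \<subseteq> carrier A \<times> carrier M}"
  by (auto simp: tensor_def Let_def FactGroup_def RCOSETS_def)

lemma tensor_add:
  assumes "Poly_Mapping.keys p \<subseteq> carrier A \<times> carrier M" "Poly_Mapping.keys q \<subseteq> carrier A \<times> carrier M"
  shows "tensor_class R A M p \<oplus>\<^bsub>tensor R A M\<^esub> tensor_class R A M q = tensor_class R A M (p + q)"
  using normal.rcos_sum[OF normal_tensor_kernel, of p q] assms
  by (auto simp: tensor_def Let_def FactGroup_def)

text \<open>Closure of the carriers is all that \<open>balanced_pair\<close> records, because this
  is what places the defining relations of the tensor product inside the free group. It passes to
  images under linear maps; in this way tensor products with a direct sum are handled through the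
  bijection from \<open>M\<close>, without checking module axioms for the direct sum.\<close>

lemma balanced_pair_image:
  assumes f: "f \<in> left_linear R M N" and surj: "f ` carrier M = carrier N"
  shows "balanced_pair R A N"
proof
  fix d e assume "d \<in> carrier N" "e \<in> carrier N"
  then obtain m n where mn: "m \<in> carrier M" "n \<in> carrier M" "d = f m" "e = f n" using surj by blast
  then have "d \<oplus>\<^bsub>N\<^esub> e = f (m \<oplus>\<^bsub>M\<^esub> n)" using f by (simp add: left_linear_def)
  then show "d \<oplus>\<^bsub>N\<^esub> e \<in> carrier N" using right_add_closed[OF mn(1,2)] surj by blast
next
  fix r d assume r: "r \<in> carrier R" and "d \<in> carrier N"
  then obtain m where m: "m \<in> carrier M" "d = f m" using surj by blast
  then have "r \<odot>\<^bsub>N\<^esub> d = f (r \<odot>\<^bsub>M\<^esub> m)" using f r by (simp add: left_linear_def)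
  then show "r \<odot>\<^bsub>N\<^esub> d \<in> carrier N" using right_act_closed[OF r m(1)] surj by blast
qed (fact left_add_closed left_act_closed)+

end

text \<open>Each of the three families of relations is mapped into the family of the same kind, with
  \<open>g a\<close> and \<open>f m\<close> in place of \<open>a\<close> and \<open>m\<close>; the
  rest is induction over the generated subgroup.\<close>

lemma frag_map_tensor_kernel:
  assumes M: "balanced_pair R A M"
    and f: "f \<in> left_linear R M N"
    and g: "\<And>a. a \<in> carrier A \<Longrightarrow> g a \<in> carrier A"
      "\<And>a b. \<lbrakk>a \<in> carrier A; b \<in> carrier A\<rbrakk> \<Longrightarrow> g (a \<oplus>\<^bsub>A\<^esub> b) = g a \<oplus>\<^bsub>A\<^esub> g b"
      "\<And>a r. \<lbrakk>a \<in> carrier A; r \<in> carrier R\<rbrakk> \<Longrightarrow> g (rsmult A a r) = rsmult A (g a) r"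
    and k: "k \<in> tensor_kernel R A M"
  shows "frag_map g f k \<in> tensor_kernel R A N"
proof -
  interpret balanced_pair R A M by (fact M)
  have cl: "f m \<in> carrier N" if "m \<in> carrier M" for m using f that by (auto simp: left_linear_def)
  have rel: "frag_map g f h \<in> tensor_relations R A N" if "h \<in> tensor_relations R A M" for h
    using that unfolding tensor_relations_def
  proof (elim UnE CollectE exE conjE, goal_cases)
    case (1 a b m)
    have "frag_map g f h = frag_of (g a \<oplus>\<^bsub>A\<^esub> g b, f m) - (frag_of (g a, f m) + frag_of (g b, f m))"
      using 1 by (simp add: frag_extend_diff frag_extend_add g)
    then show ?case using 1 g cl by blast
  next
    case (2 a m n)
    have "frag_map g f h = frag_of (g a, f m \<oplus>\<^bsub>N\<^esub> f n) - (frag_of (g a, f m) + frag_of (g a, f n))"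
      using 2 f by (simp add: frag_extend_diff frag_extend_add left_linear_def)
    then show ?case using 2 g cl by blast
  next
    case (3 a r m)
    have "frag_map g f h = frag_of (rsmult A (g a) r, f m) - frag_of (g a, r \<odot>\<^bsub>N\<^esub> f m)"
      using 3 f by (simp add: frag_extend_diff g left_linear_def)
    then show ?case using 3 g cl by blast
  qed
  from k show ?thesis unfolding tensor_kernel_def
  proof (induction rule: generate.induct)
    case one
    then show ?case using generate.one[of "tensor_free A N"] by simp
  next
    case (incl h)
    then show ?case by (intro generate.incl rel)
  next
    case (inv h)
    have keys: "Poly_Mapping.keys h \<subseteq> carrier A \<times> carrier M"
      using inv tensor_relations_closed by force
    from generate.inv[OF rel[OF inv], of "tensor_free A N"] keys_frag_map[OF keys g(1) cl] keys
    show ?case by (simp add: frag_extend_minus)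
  next
    case (eng h1 h2)
    then show ?case using generate.eng[OF eng.IH] by (simp add: frag_extend_add)
  qed
qed

text \<open>Changing the representative by an element of the kernel changes its image by an element
  of the kernel, so the union in \<open>tensor_map\<close> collapses to a single coset. Later
  computations in tensor products go through this formula.\<close>

lemma tensor_map_class:
  assumes M: "balanced_pair R A M"
    and f: "f \<in> left_linear R M N"
    and g: "\<And>a. a \<in> carrier A \<Longrightarrow> g a \<in> carrier A"
      "\<And>a b. \<lbrakk>a \<in> carrier A; b \<in> carrier A\<rbrakk> \<Longrightarrow> g (a \<oplus>\<^bsub>A\<^esub> b) = g a \<oplus>\<^bsub>A\<^esub> g b"
      "\<And>a r. \<lbrakk>a \<in> carrier A; r \<in> carrier R\<rbrakk> \<Longrightarrow> g (rsmult A a r) = rsmult A (g a) r"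
  shows "tensor_map R A N g f (tensor_class R A M p) = tensor_class R A N (frag_map g f p)"
proof -
  interpret balanced_pair R A M by (fact M)
  note ker = frag_map_tensor_kernel[OF M f g]
  have add: "k + l \<in> tensor_kernel R A N" if "k \<in> tensor_kernel R A N" "l \<in> tensor_kernel R A N" for k l
    using that generate.eng[of k "tensor_free A N" _ l] by (simp add: tensor_kernel_def)
  have zero: "0 \<in> tensor_kernel R A M" by (rule tensor_kernel_zero)
  have "tensor_map R A N g f (tensor_class R A M p)
      = {l + (frag_map g f k + frag_map g f p) | l k. l \<in> tensor_kernel R A N \<and> k \<in> tensor_kernel R A M}"
    by (auto simp: tensor_map_def r_coset_def frag_extend_add)
  also have "\<dots> = {l + frag_map g f p | l. l \<in> tensor_kernel R A N}"
  proof (intro equalityI subsetI; clarify)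
    fix l k assume "l \<in> tensor_kernel R A N" "k \<in> tensor_kernel R A M"
    then show "\<exists>l'. l + (frag_map g f k + frag_map g f p) = l' + frag_map g f p \<and> l' \<in> tensor_kernel R A N"
      using add[OF _ ker] by (intro exI[of _ "l + frag_map g f k"]) (simp add: add.assoc)
  next
    fix l assume "l \<in> tensor_kernel R A N"
    then show "\<exists>l' k. l + frag_map g f p = l' + (frag_map g f k + frag_map g f p) \<and>
        l' \<in> tensor_kernel R A N \<and> k \<in> tensor_kernel R A M"
      using zero by (intro exI[of _ l] exI[of _ 0]) simp
  qed
  finally show ?thesis by (auto simp: r_coset_def)
qed

lemma frag_map_compose: "frag_map g' f' (frag_map g f p) = frag_map (g' \<circ> g) (f' \<circ> f) p"
  using subset_UNIV
  by (induction p rule: frag_induction) (auto simp: frag_extend_diff split: prod.splits)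

lemma frag_map_cong:
  assumes "Poly_Mapping.keys p \<subseteq> A \<times> M"
    "\<And>a. a \<in> A \<Longrightarrow> g a = g' a" "\<And>m. m \<in> M \<Longrightarrow> f m = f' m"
  shows "frag_map g f p = frag_map g' f' p"
  using assms by (intro frag_extend_eq) auto

lemma frag_map_id: "frag_map (\<lambda>a. a) (\<lambda>m. m) p = p"
  using frag_expansion[of p] by (simp add: case_prod_unfold)

section \<open>Representations and subrepresentations\<close>

text \<open>The value of the structure map on a pure tensor. Pure tensors generate the tensor
  product, so morphisms and subrepresentations can be described by \<open>act\<close>, which keeps
  cosets out of most later arguments.\<close>

definition act :: "('c, 'r, 'a) species \<Rightarrow> ('c, 'r, 'a, 'm) rep \<Rightarrow> 'c \<Rightarrow> 'c \<Rightarrow> 'a \<Rightarrow> 'm \<Rightarrow> 'm"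
  where "act \<SS> M y x a m = structure_map M y x
    (tensor_class (ring_at \<SS> x) (arrow \<SS> y x) (module_at M x) (frag_of (a, m)))"

locale representation =
  fixes \<SS> :: "('c, 'r, 'a) species" and M :: "('c, 'r, 'a, 'm) rep"
  assumes species: "is_species \<SS>"
    and representation: "is_representation \<SS> M"
begin

abbreviation "C \<equiv> vertices \<SS>"
abbreviation "R x \<equiv> ring_at \<SS> x"
abbreviation "car x \<equiv> carrier (module_at M x)"
abbreviation "arr y x \<equiv> carrier (arrow \<SS> y x)"

lemma module: "x \<in> C \<Longrightarrow> left_module (R x) (module_at M x)"
  using representation by (simp add: is_representation_def)

lemma bimodule: "\<lbrakk>y \<in> C; x \<in> C\<rbrakk> \<Longrightarrow> bimodule (R y) (R x) (arrow \<SS> y x)"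
  using species by (simp add: is_species_def)

lemma abelian_group: "x \<in> C \<Longrightarrow> abelian_group (module_at M x)"
  using module by (rule left_module.axioms)

lemma ring: "x \<in> C \<Longrightarrow> ring (R x)"
  using species by (simp add: is_species_def)

lemma add_closed: "\<lbrakk>x \<in> C; m \<in> car x; n \<in> car x\<rbrakk> \<Longrightarrow> m \<oplus>\<^bsub>module_at M x\<^esub> n \<in> car x"
  using abelian_group by (simp add: abelian_group_def abelian_monoid.a_closed)

lemma smult_closed: "\<lbrakk>x \<in> C; r \<in> carrier (R x); m \<in> car x\<rbrakk> \<Longrightarrow> r \<odot>\<^bsub>module_at M x\<^esub> m \<in> car x"
  using left_module.smult_closed[OF module] .

lemma balanced_pair:
  "\<lbrakk>y \<in> C; x \<in> C\<rbrakk> \<Longrightarrow> balanced_pair (R x) (arrow \<SS> y x) (module_at M x)"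
  using bimodule.rsmult_closed[OF bimodule] add_closed smult_closed
    abelian_monoid.a_closed[OF abelian_group.axioms(1)[OF left_module.axioms(2)[OF bimodule.axioms(1)[OF bimodule]]]]
  by (intro balanced_pair.intro)

abbreviation "cls y x \<equiv> tensor_class (R x) (arrow \<SS> y x) (module_at M x)"

lemma structure_map: "\<lbrakk>y \<in> C; x \<in> C\<rbrakk> \<Longrightarrow>
    structure_map M y x \<in> left_linear (R y) (rep_tensor \<SS> M y x) (module_at M y)"
  using representation by (simp add: is_representation_def)

lemma cls_closed:
  "\<lbrakk>y \<in> C; x \<in> C; Poly_Mapping.keys p \<subseteq> arr y x \<times> car x\<rbrakk> \<Longrightarrow> cls y x p \<in> carrier (rep_tensor \<SS> M y x)"
  by (auto simp: balanced_pair.carrier_tensor[OF balanced_pair])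

lemma structure_map_closed:
  assumes "y \<in> C" "x \<in> C" "Poly_Mapping.keys p \<subseteq> arr y x \<times> car x"
  shows "structure_map M y x (cls y x p) \<in> car y"
  using structure_map[OF assms(1,2)] cls_closed[OF assms] by (auto simp: left_linear_def)

lemma structure_map_add:
  assumes "y \<in> C" "x \<in> C" "Poly_Mapping.keys p \<subseteq> arr y x \<times> car x" "Poly_Mapping.keys q \<subseteq> arr y x \<times> car x"
  shows "structure_map M y x (cls y x (p + q))
    = structure_map M y x (cls y x p) \<oplus>\<^bsub>module_at M y\<^esub> structure_map M y x (cls y x q)"
proof -
  have "structure_map M y x \<in> left_linear (R y) (rep_tensor \<SS> M y x) (module_at M y)"
    using representation assms by (simp add: is_representation_def)
  moreover have "cls y x p \<in> carrier (rep_tensor \<SS> M y x)" "cls y x q \<in> carrier (rep_tensor \<SS> M y x)"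
    using assms by (auto simp: balanced_pair.carrier_tensor[OF balanced_pair])
  ultimately show ?thesis
    using assms by (simp add: left_linear_def balanced_pair.tensor_add[OF balanced_pair, symmetric])
qed

lemma structure_map_diff:
  assumes "y \<in> C" "x \<in> C" "Poly_Mapping.keys p \<subseteq> arr y x \<times> car x" "Poly_Mapping.keys q \<subseteq> arr y x \<times> car x"
  shows "structure_map M y x (cls y x (p - q))
    = structure_map M y x (cls y x p) \<ominus>\<^bsub>module_at M y\<^esub> structure_map M y x (cls y x q)"
proof -
  interpret Y: abelian_group "module_at M y" using assms abelian_group by blast
  have d: "Poly_Mapping.keys (p - q) \<subseteq> arr y x \<times> car x"
    using keys_diff[of p q] assms by blast
  have "structure_map M y x (cls y x p)
      = structure_map M y x (cls y x (p - q)) \<oplus>\<^bsub>module_at M y\<^esub> structure_map M y x (cls y x q)"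
    using structure_map_add[OF assms(1,2) d assms(4)] by simp
  then show ?thesis
    using structure_map_closed[OF assms(1,2) d] structure_map_closed[OF assms(1,2,4)]
    by (simp add: a_minus_def Y.a_assoc Y.r_neg)
qed

lemma structure_map_zero:
  assumes "y \<in> C" "x \<in> C"
  shows "structure_map M y x (cls y x 0) = \<zero>\<^bsub>module_at M y\<^esub>"
  using structure_map_diff[OF assms, of 0 0] structure_map_closed[OF assms, of 0] abelian_group[of y] assms
  by (simp add: a_minus_def abelian_group.r_neg)

lemma tensor_map_smult:
  assumes "y \<in> C" "x \<in> C" "r \<in> carrier (R y)"
    and N: "balanced_pair (R x) (arrow \<SS> y x) N" 
    and f: "f \<in> left_linear (R x) N (module_at M x)"
  shows "tensor_map (R x) (arrow \<SS> y x) (module_at M x) (\<lambda>a. r \<odot>\<^bsub>arrow \<SS> y x\<^esub> a) f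
      (tensor_class (R x) (arrow \<SS> y x) N p)
    = cls y x (frag_map (\<lambda>a. r \<odot>\<^bsub>arrow \<SS> y x\<^esub> a) f p)"
proof -
  interpret B: bimodule "R y" "R x" "arrow \<SS> y x" by (rule bimodule) (use assms in auto)
  show ?thesis
    using assms by (intro tensor_map_class) (auto simp: B.smult_closed B.smult_r_distr B.smult_rsmult)
qed

lemma id_left_linear: "(\<lambda>m. m) \<in> left_linear (R x) (module_at M x) (module_at M x)"
  by (simp add: left_linear_def)

lemma structure_map_smult:
  assumes "y \<in> C" "x \<in> C" "r \<in> carrier (R y)" "Poly_Mapping.keys p \<subseteq> arr y x \<times> car x"
  shows "structure_map M y x (cls y x (frag_map (\<lambda>a. r \<odot>\<^bsub>arrow \<SS> y x\<^esub> a) (\<lambda>m. m) p))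
    = r \<odot>\<^bsub>module_at M y\<^esub> structure_map M y x (cls y x p)"
proof -
  have "structure_map M y x (r \<odot>\<^bsub>rep_tensor \<SS> M y x\<^esub> cls y x p)
      = r \<odot>\<^bsub>module_at M y\<^esub> structure_map M y x (cls y x p)"
    using structure_map[OF assms(1,2)] cls_closed[OF assms(1,2,4)] assms(3)
    unfolding left_linear_def by blast
  moreover have "r \<odot>\<^bsub>rep_tensor \<SS> M y x\<^esub> cls y x p
      = cls y x (frag_map (\<lambda>a. r \<odot>\<^bsub>arrow \<SS> y x\<^esub> a) (\<lambda>m. m) p)"
    using tensor_map_smult[OF assms(1-3) balanced_pair[OF assms(1,2)] id_left_linear, of p]
    by (simp add: tensor_def Let_def)
  ultimately show ?thesis by simp
qed

lemma act_closed: "\<lbrakk>y \<in> C; x \<in> C; a \<in> arr y x; m \<in> car x\<rbrakk> \<Longrightarrow> act \<SS> M y x a m \<in> car y"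
  unfolding act_def by (rule structure_map_closed) (auto simp: keys_frag_of)

lemma act_add:
  assumes "y \<in> C" "x \<in> C" "a \<in> arr y x" "m \<in> car x" "n \<in> car x"
  shows "act \<SS> M y x a (m \<oplus>\<^bsub>module_at M x\<^esub> n) = act \<SS> M y x a m \<oplus>\<^bsub>module_at M y\<^esub> act \<SS> M y x a n"
proof -
  interpret B: balanced_pair "R x" "arrow \<SS> y x" "module_at M x"
    by (rule balanced_pair) (use assms in auto)
  have "cls y x (frag_of (a, m \<oplus>\<^bsub>module_at M x\<^esub> n)) = cls y x (frag_of (a, m) + frag_of (a, n))"
    unfolding tensor_kernel_def
    by (intro B.tensor_class_eqI[unfolded tensor_kernel_def] generate.incl)
      (use assms in \<open>auto simp: tensor_relations_def\<close>)
  then show ?thesis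
    using assms by (simp add: act_def structure_map_add keys_frag_of)
qed

lemma act_balanced:
  assumes "y \<in> C" "x \<in> C" "a \<in> arr y x" "r \<in> carrier (R x)" "m \<in> car x"
  shows "act \<SS> M y x (rsmult (arrow \<SS> y x) a r) m = act \<SS> M y x a (r \<odot>\<^bsub>module_at M x\<^esub> m)"
proof -
  interpret B: balanced_pair "R x" "arrow \<SS> y x" "module_at M x"
    by (rule balanced_pair) (use assms in auto)
  have "cls y x (frag_of (rsmult (arrow \<SS> y x) a r, m)) = cls y x (frag_of (a, r \<odot>\<^bsub>module_at M x\<^esub> m))"
    unfolding tensor_kernel_def
    by (intro B.tensor_class_eqI[unfolded tensor_kernel_def] generate.incl)
      (use assms in \<open>auto simp: tensor_relations_def\<close>)
  then show ?thesis by (simp add: act_def)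
qed

lemma act_smult:
  assumes "y \<in> C" "x \<in> C" "a \<in> arr y x" "r \<in> carrier (R y)" "m \<in> car x"
  shows "act \<SS> M y x (r \<odot>\<^bsub>arrow \<SS> y x\<^esub> a) m = r \<odot>\<^bsub>module_at M y\<^esub> act \<SS> M y x a m"
  using structure_map_smult[of y x r "frag_of (a, m)"] assms by (simp add: act_def keys_frag_of)

lemma tensor_map_cls:
  assumes "y \<in> C" "x \<in> C" "f \<in> left_linear (R x) (module_at M x) N"
  shows "tensor_map (R x) (arrow \<SS> y x) N (\<lambda>a. a) f (cls y x p)
    = tensor_class (R x) (arrow \<SS> y x) N (frag_map (\<lambda>a. a) f p)"
  using assms by (intro tensor_map_class balanced_pair) auto

lemma rep_hom_act:
  assumes "f \<in> rep_hom \<SS> M N" "y \<in> C" "x \<in> C" "a \<in> arr y x" "m \<in> car x"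
  shows "f y (act \<SS> M y x a m) = act \<SS> N y x a (f x m)"
proof -
  have "f x \<in> left_linear (R x) (module_at M x) (module_at N x)"
    using assms by (auto simp: rep_hom_def)
  note tm = tensor_map_cls[OF assms(2,3) this, of "frag_of (a, m)"]
  have "cls y x (frag_of (a, m)) \<in> carrier (rep_tensor \<SS> M y x)"
    using assms by (auto simp: balanced_pair.carrier_tensor[OF balanced_pair] keys_frag_of)
  then have "structure_map N y x (tensor_map (R x) (arrow \<SS> y x) (module_at N x) (\<lambda>a. a) (f x)
      (cls y x (frag_of (a, m)))) = f y (structure_map M y x (cls y x (frag_of (a, m))))"
    using assms(1-3) by (auto simp: rep_hom_def)
  with tm show ?thesis by (simp add: act_def)
qed

end

text \<open>Both sides of the compatibility condition are additive in the tensor, and the tensor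
  product is generated by pure tensors; hence agreement of the actions on pure tensors
  suffices.\<close>

lemma rep_homI:
  assumes M: "representation \<SS> M" and N: "representation \<SS> N"
    and f: "f \<in> extensional (vertices \<SS>)" "\<And>x. x \<in> vertices \<SS> \<Longrightarrow> f x \<in> extensional (carrier (module_at M x))"
      "\<And>x. x \<in> vertices \<SS> \<Longrightarrow> f x \<in> left_linear (ring_at \<SS> x) (module_at M x) (module_at N x)"
    and act: "\<And>y x a m. \<lbrakk>y \<in> vertices \<SS>; x \<in> vertices \<SS>; a \<in> carrier (arrow \<SS> y x); m \<in> carrier (module_at M x)\<rbrakk>
      \<Longrightarrow> act \<SS> N y x a (f x m) = f y (act \<SS> M y x a m)"
  shows "f \<in> rep_hom \<SS> M N"
proof -
  interpret M: representation \<SS> M by fact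
  interpret N: representation \<SS> N by fact
  have "structure_map N y x (N.cls y x (frag_map (\<lambda>a. a) (f x) p)) = f y (structure_map M y x (M.cls y x p))"
    if C: "y \<in> vertices \<SS>" "x \<in> vertices \<SS>" and p: "Poly_Mapping.keys p \<subseteq> M.arr y x \<times> M.car x" for y x p
  proof -
    interpret Ny: abelian_group "module_at N y" by (rule N.abelian_group) (use C in auto)
    interpret My: abelian_group "module_at M y" by (rule M.abelian_group) (use C in auto)
    have cl: "\<And>m. m \<in> M.car x \<Longrightarrow> f x m \<in> N.car x" and cly: "\<And>m. m \<in> M.car y \<Longrightarrow> f y m \<in> N.car y"
      using f(3)[OF C(1)] f(3)[OF C(2)] by (auto simp: left_linear_def)
    interpret fy: abelian_group_hom "module_at M y" "module_at N y" "f y"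
      using f(3)[OF C(1)] by (intro abelian_group_homI Ny.abelian_group_axioms My.abelian_group_axioms group_hom.intro
        group_hom_axioms.intro homI Ny.a_group My.a_group) (auto simp: left_linear_def)
    \<comment> \<open>The difference case of the induction supplies nothing but the claim for the
      two parts, so the support condition is carried inside the claim.\<close>
    from p have "Poly_Mapping.keys p \<subseteq> M.arr y x \<times> M.car x \<and> ?thesis"
    proof (induction p rule: frag_induction)
      case zero
      then show ?case by (simp add: M.structure_map_zero N.structure_map_zero C)
    next
      case (one p)
      then show ?case using act[OF C] by (auto simp: act_def keys_frag_of)
    next
      case (diff p q)
      have keys: "Poly_Mapping.keys (frag_map (\<lambda>a. a) (f x) r) \<subseteq> M.arr y x \<times> N.car x"
        if "Poly_Mapping.keys r \<subseteq> M.arr y x \<times> M.car x" for r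
        by (rule keys_frag_map[OF that]) (auto intro: cl)
      have "Poly_Mapping.keys (p - q) \<subseteq> M.arr y x \<times> M.car x"
        using keys_diff[of p q] diff by blast
      then show ?case
        using diff keys C M.structure_map_closed[OF C, of p] M.structure_map_closed[OF C, of q]
        by (simp add: frag_extend_diff M.structure_map_diff N.structure_map_diff a_minus_def fy.hom_add fy.hom_a_inv)
    qed
    then show ?thesis by blast
  qed
  then have "structure_map N y x (tensor_map (ring_at \<SS> x) (arrow \<SS> y x) (module_at N x) (\<lambda>a. a) (f x) t)
      = f y (structure_map M y x t)"
    if "y \<in> vertices \<SS>" "x \<in> vertices \<SS>" "t \<in> carrier (rep_tensor \<SS> M y x)" for y x t
    using that f(3) by (auto simp: balanced_pair.carrier_tensor[OF M.balanced_pair] M.tensor_map_cls)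
  moreover have "f \<in> (\<Pi>\<^sub>E x\<in>vertices \<SS>. left_linear (ring_at \<SS> x) (module_at M x) (module_at N x)
      \<inter> extensional (carrier (module_at M x)))"
    using f by (intro PiE_I IntI) (auto intro: extensional_arb)
  ultimately show ?thesis
    unfolding rep_hom_def by blast
qed

lemma rep_hom_structure_map:
  assumes "f \<in> rep_hom \<SS> M N" "y \<in> vertices \<SS>" "x \<in> vertices \<SS>" "t \<in> carrier (rep_tensor \<SS> M y x)"
  shows "structure_map N y x (tensor_map (ring_at \<SS> x) (arrow \<SS> y x) (module_at N x) (\<lambda>a. a) (f x) t)
    = f y (structure_map M y x t)"
  using assms by (simp add: rep_hom_def)

text \<open>Sums, scalar multiples and closure in \<open>N\<close> are transported from
  \<open>M\<close> along the bijections \<open>f x\<close>. This lets a direct sum serve as the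
  target with no module axioms checked for it.\<close>

lemma rep_hom_inverse:
  assumes M: "representation \<SS> M" and f: "f \<in> rep_hom \<SS> M N"
    and bij: "\<And>x. x \<in> vertices \<SS> \<Longrightarrow> bij_betw (f x) (carrier (module_at M x)) (carrier (module_at N x))"
  obtains g where "g \<in> rep_hom \<SS> N M" "rep_comp \<SS> M g f = rep_id \<SS> M" "rep_comp \<SS> N f g = rep_id \<SS> N"
proof -
  interpret M: representation \<SS> M by fact
  let ?D = "\<lambda>x. carrier (module_at N x)"
  define g where "g = (\<lambda>x\<in>vertices \<SS>. \<lambda>d\<in>?D x. inv_into (M.car x) (f x) d)"
  have fg: "f x (g x d) = d" and g_closed: "g x d \<in> M.car x" if "x \<in> vertices \<SS>" "d \<in> ?D x" for x d
    using that bij[of x] by (auto simp: g_def bij_betw_def f_inv_into_f inv_into_into)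
  have gf: "g x (f x m) = m" and f_closed: "f x m \<in> ?D x" if "x \<in> vertices \<SS>" "m \<in> M.car x" for x m
    using that bij[of x] by (auto simp: g_def bij_betw_def)
  have lin: "f x \<in> left_linear (ring_at \<SS> x) (module_at M x) (module_at N x)" if "x \<in> vertices \<SS>" for x
    using f that by (auto simp: rep_hom_def)
  have f_add: "f x (m \<oplus>\<^bsub>module_at M x\<^esub> n) = f x m \<oplus>\<^bsub>module_at N x\<^esub> f x n"
    if "x \<in> vertices \<SS>" "m \<in> M.car x" "n \<in> M.car x" for x m n
    using lin[OF that(1)] that by (auto simp: left_linear_def)
  have f_smult: "f x (r \<odot>\<^bsub>module_at M x\<^esub> m) = r \<odot>\<^bsub>module_at N x\<^esub> f x m"
    if "x \<in> vertices \<SS>" "r \<in> carrier (ring_at \<SS> x)" "m \<in> M.car x" for x r m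
    using lin[OF that(1)] that by (auto simp: left_linear_def)
  have add: "d \<oplus>\<^bsub>module_at N x\<^esub> e = f x (g x d \<oplus>\<^bsub>module_at M x\<^esub> g x e)"
    if "x \<in> vertices \<SS>" "d \<in> ?D x" "e \<in> ?D x" for x d e
    using that by (simp add: f_add fg g_closed)
  have smult: "r \<odot>\<^bsub>module_at N x\<^esub> d = f x (r \<odot>\<^bsub>module_at M x\<^esub> g x d)"
    if "x \<in> vertices \<SS>" "r \<in> carrier (ring_at \<SS> x)" "d \<in> ?D x" for x r d
    using that by (simp add: f_smult fg g_closed)
  have bal: "balanced_pair (ring_at \<SS> x) (arrow \<SS> y x) (module_at N x)"
    if "x \<in> vertices \<SS>" "y \<in> vertices \<SS>" for x y
    using balanced_pair.balanced_pair_image[OF M.balanced_pair lin] bij that by (simp add: bij_betw_def)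
  have g_lin: "g x \<in> left_linear (ring_at \<SS> x) (module_at N x) (module_at M x)" if "x \<in> vertices \<SS>" for x
    using that by (auto simp: left_linear_def g_closed add smult gf M.add_closed M.smult_closed)
  have hom: "structure_map M y x (tensor_map (ring_at \<SS> x) (arrow \<SS> y x) (module_at M x) (\<lambda>a. a) (g x)
        (tensor_class (ring_at \<SS> x) (arrow \<SS> y x) (module_at N x) p))
      = g y (structure_map N y x (tensor_class (ring_at \<SS> x) (arrow \<SS> y x) (module_at N x) p))"
    if C: "y \<in> vertices \<SS>" "x \<in> vertices \<SS>" and p: "Poly_Mapping.keys p \<subseteq> M.arr y x \<times> ?D x" for y x p
  proof -
    \<comment> \<open>\<open>?q\<close> lifts \<open>p\<close> to \<open>M\<close>, and
      \<open>f\<close> maps its class back to the class of \<open>p\<close>. Compatibility of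
      \<open>f\<close> at the class of \<open>?q\<close> thus becomes compatibility of
      \<open>g\<close> once \<open>g y\<close> is applied to both sides.\<close>
    let ?q = "frag_map (\<lambda>a. a) (g x) p"
    have q: "Poly_Mapping.keys ?q \<subseteq> M.arr y x \<times> M.car x"
      using p by (rule keys_frag_map) (auto simp: g_closed C)
    have "frag_map (\<lambda>a. a) (f x) ?q = frag_map (\<lambda>a. a) (\<lambda>d. d) p"
      unfolding frag_map_compose by (rule frag_map_cong[OF p]) (auto simp: fg C)
    then have "tensor_map (ring_at \<SS> x) (arrow \<SS> y x) (module_at N x) (\<lambda>a. a) (f x) (M.cls y x ?q)
        = tensor_class (ring_at \<SS> x) (arrow \<SS> y x) (module_at N x) p"
      using M.tensor_map_cls[OF C lin] C by (simp add: frag_map_id)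
    then have "f y (structure_map M y x (M.cls y x ?q))
        = structure_map N y x (tensor_class (ring_at \<SS> x) (arrow \<SS> y x) (module_at N x) p)"
      using rep_hom_structure_map[OF f C M.cls_closed[OF C q]] by simp
    moreover have "tensor_map (ring_at \<SS> x) (arrow \<SS> y x) (module_at M x) (\<lambda>a. a) (g x)
        (tensor_class (ring_at \<SS> x) (arrow \<SS> y x) (module_at N x) p) = M.cls y x ?q"
      by (rule tensor_map_class[OF bal g_lin]) (use C in auto)
    ultimately show ?thesis
      using gf[OF C(1) M.structure_map_closed[OF C q]] by simp
  qed
  have "g \<in> rep_hom \<SS> N M"
    using g_lin hom by (auto simp: rep_hom_def balanced_pair.carrier_tensor[OF bal]) (auto simp: g_def)
  moreover have "rep_comp \<SS> M g f = rep_id \<SS> M"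
    by (auto simp: rep_comp_def rep_id_def compose_def gf cong: restrict_cong)
  moreover have "rep_comp \<SS> N f g = rep_id \<SS> N"
    by (auto simp: rep_comp_def rep_id_def compose_def fg cong: restrict_cong)
  ultimately show ?thesis by (rule that)
qed

text \<open>The tensor product with \<open>U x\<close> is a different quotient from the one with the
  whole module, and the map induced by the inclusion need not be injective. A tensor over
  \<open>U x\<close> is therefore carried to one over the whole module, where the structure map of
  \<open>M\<close> applies.\<close>

definition sub_rep ::
  "('c, 'r, 'a) species \<Rightarrow> ('c, 'r, 'a, 'm) rep \<Rightarrow> ('c \<Rightarrow> 'm set) \<Rightarrow> ('c, 'r, 'a, 'm) rep"
  where "sub_rep \<SS> M U =
    \<lparr>module_at = (\<lambda>x. (module_at M x)\<lparr>carrier := U x\<rparr>),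
     structure_map = (\<lambda>y x t. structure_map M y x
       (tensor_map (ring_at \<SS> x) (arrow \<SS> y x) (module_at M x) (\<lambda>a. a) (\<lambda>m. m) t))\<rparr>"

context representation
begin

abbreviation "E \<equiv> rep_End \<SS> M"

text \<open>Negation is the action of -1; this is why \<open>subrep\<close> can leave closure under
  negatives implicit.\<close>

lemma smult_minus_one:
  assumes "x \<in> C" "m \<in> car x"
  shows "(\<ominus>\<^bsub>R x\<^esub> \<one>\<^bsub>R x\<^esub>) \<odot>\<^bsub>module_at M x\<^esub> m = \<ominus>\<^bsub>module_at M x\<^esub> m"
proof -
  interpret left_module "R x" "module_at M x" by (rule module) fact
  have "(\<ominus>\<^bsub>R x\<^esub> \<one>\<^bsub>R x\<^esub>) \<odot>\<^bsub>module_at M x\<^esub> m \<oplus>\<^bsub>module_at M x\<^esub> m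
      = (\<ominus>\<^bsub>R x\<^esub> \<one>\<^bsub>R x\<^esub> \<oplus>\<^bsub>R x\<^esub> \<one>\<^bsub>R x\<^esub>) \<odot>\<^bsub>module_at M x\<^esub> m"
    using assms by (simp add: smult_l_distr smult_one)
  also have "\<dots> = \<zero>\<^bsub>R x\<^esub> \<odot>\<^bsub>module_at M x\<^esub> m" by (simp add: R.l_neg)
  also have "\<dots> = \<zero>\<^bsub>module_at M x\<^esub>"
    using smult_l_distr[of "\<zero>\<^bsub>R x\<^esub>" "\<zero>\<^bsub>R x\<^esub>" m] assms smult_closed[of "\<zero>\<^bsub>R x\<^esub>" m]
    by (simp add: M.add.l_cancel_one)
  finally show ?thesis
    using assms by (intro M.minus_equality[symmetric]) (auto simp: smult_closed)
qed

definition subrep :: "('c \<Rightarrow> 'm set) \<Rightarrow> bool"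
  where "subrep U \<longleftrightarrow>
    (\<forall>x\<in>C. U x \<subseteq> car x \<and> \<zero>\<^bsub>module_at M x\<^esub> \<in> U x \<and>
      (\<forall>m\<in>U x. \<forall>n\<in>U x. m \<oplus>\<^bsub>module_at M x\<^esub> n \<in> U x) \<and>
      (\<forall>r\<in>carrier (R x). \<forall>m\<in>U x. r \<odot>\<^bsub>module_at M x\<^esub> m \<in> U x)) \<and>
    (\<forall>y\<in>C. \<forall>x\<in>C. \<forall>a\<in>arr y x. \<forall>m\<in>U x. act \<SS> M y x a m \<in> U y)"

lemma subrep_minus:
  assumes "subrep U" "x \<in> C" "m \<in> U x"
  shows "\<ominus>\<^bsub>module_at M x\<^esub> m \<in> U x"
proof -
  interpret left_module "R x" "module_at M x" by (rule module) fact
  have "m \<in> car x" using assms by (auto simp: subrep_def)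
  moreover have "(\<ominus>\<^bsub>R x\<^esub> \<one>\<^bsub>R x\<^esub>) \<odot>\<^bsub>module_at M x\<^esub> m \<in> U x"
    using assms by (simp add: subrep_def)
  ultimately show ?thesis using assms by (simp add: smult_minus_one)
qed

lemma module_at_sub_rep: "module_at (sub_rep \<SS> M U) x = (module_at M x)\<lparr>carrier := U x\<rparr>"
  by (simp add: sub_rep_def)

lemma sub_rep_left_module:
  assumes "subrep U" "x \<in> C"
  shows "left_module (R x) (module_at (sub_rep \<SS> M U) x)"
proof -
  interpret left_module "R x" "module_at M x" by (rule module) fact
  have U: "m \<in> carrier (module_at M x)" if "m \<in> U x" for m using that assms by (auto simp: subrep_def)
  have "abelian_group (module_at (sub_rep \<SS> M U) x)"
    using assms subrep_minus[OF assms] U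
    by (intro abelian_groupI)
      (auto simp: module_at_sub_rep subrep_def M.a_ac M.r_neg intro!: bexI[of _ "\<ominus>\<^bsub>module_at M x\<^esub> _"] M.l_neg)
  then show ?thesis
    using assms U
    by (intro left_module.intro left_module_axioms.intro R.ring_axioms)
      (auto simp: module_at_sub_rep subrep_def smult_l_distr smult_r_distr smult_assoc smult_one)
qed

lemma sub_rep_balanced_pair:
  assumes "subrep U" "y \<in> C" "x \<in> C"
  shows "balanced_pair (R x) (arrow \<SS> y x) (module_at (sub_rep \<SS> M U) x)"
  using balanced_pair[OF assms(2,3)] assms
  by (auto simp: balanced_pair_def module_at_sub_rep subrep_def)

lemma sub_rep_structure_map:
  assumes "subrep U" "y \<in> C" "x \<in> C"
  shows "structure_map (sub_rep \<SS> M U) y x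
      (tensor_class (R x) (arrow \<SS> y x) (module_at (sub_rep \<SS> M U) x) p) = structure_map M y x (cls y x p)"
proof -
  have "(\<lambda>m. m) \<in> left_linear (R x) (module_at (sub_rep \<SS> M U) x) (module_at M x)"
    using assms by (auto simp: left_linear_def module_at_sub_rep subrep_def)
  from tensor_map_class[OF sub_rep_balanced_pair[OF assms] this, of "\<lambda>a. a" p] show ?thesis
    by (simp add: frag_map_id sub_rep_def)
qed

lemma sub_rep_act:
  "\<lbrakk>subrep U; y \<in> C; x \<in> C\<rbrakk> \<Longrightarrow> act \<SS> (sub_rep \<SS> M U) y x a m = act \<SS> M y x a m"
  by (simp add: act_def sub_rep_structure_map)

lemma representation_sub_rep:
  assumes U: "subrep U"
  shows "representation \<SS> (sub_rep \<SS> M U)"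
proof -
  have "structure_map (sub_rep \<SS> M U) y x
      \<in> left_linear (R y) (rep_tensor \<SS> (sub_rep \<SS> M U) y x) (module_at (sub_rep \<SS> M U) y)"
    if C: "y \<in> C" "x \<in> C" for y x
  proof -
    interpret B: balanced_pair "R x" "arrow \<SS> y x" "module_at (sub_rep \<SS> M U) x"
      by (rule sub_rep_balanced_pair[OF U C])
    have Ux: "U x \<subseteq> car x" using U C by (auto simp: subrep_def)
    have keys: "Poly_Mapping.keys p \<subseteq> arr y x \<times> car x" if "Poly_Mapping.keys p \<subseteq> arr y x \<times> U x" for p
      using that Ux by blast
    have car: "carrier (module_at (sub_rep \<SS> M U) z) = U z" for z by (simp add: module_at_sub_rep)
    have id: "(\<lambda>m. m) \<in> left_linear (R x) (module_at (sub_rep \<SS> M U) x) (module_at (sub_rep \<SS> M U) x)"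
      by (simp add: left_linear_def)
    interpret A: bimodule "R y" "R x" "arrow \<SS> y x" by (rule bimodule[OF C])
    \<comment> \<open>\<open>subrep\<close> controls pure tensors; general elements are integral
      combinations of these, and \<open>U y\<close> is a subgroup.\<close>
    have closed: "structure_map M y x (cls y x p) \<in> U y" if "Poly_Mapping.keys p \<subseteq> arr y x \<times> U x" for p
    proof -
      from that have "Poly_Mapping.keys p \<subseteq> arr y x \<times> U x \<and> structure_map M y x (cls y x p) \<in> U y"
      proof (induction p rule: frag_induction)
        case zero
        then show ?case using U C by (simp add: structure_map_zero subrep_def)
      next
        case (one p)
        then show ?case using U C by (auto simp: subrep_def act_def keys_frag_of)
      next
        case (diff p q)
        have "Poly_Mapping.keys (p - q) \<subseteq> arr y x \<times> U x"
          using keys_diff[of p q] diff by blast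
        moreover have "structure_map M y x (cls y x (p - q)) \<in> U y"
          using diff U C subrep_minus[OF U C(1)]
          by (simp add: structure_map_diff keys a_minus_def subrep_def)
        ultimately show ?case by simp
      qed
      then show ?thesis by simp
    qed
    have smult: "r \<odot>\<^bsub>rep_tensor \<SS> (sub_rep \<SS> M U) y x\<^esub> tensor_class (R x) (arrow \<SS> y x) (module_at (sub_rep \<SS> M U) x) p
       = tensor_class (R x) (arrow \<SS> y x) (module_at (sub_rep \<SS> M U) x)
          (frag_map (\<lambda>a. r \<odot>\<^bsub>arrow \<SS> y x\<^esub> a) (\<lambda>m. m) p)"
      if "r \<in> carrier (R y)" for r p
      using tensor_map_class[OF B.balanced_pair_axioms id, of "\<lambda>a. r \<odot>\<^bsub>arrow \<SS> y x\<^esub> a" p] that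
      by (simp add: tensor_def Let_def A.smult_closed A.smult_r_distr A.smult_rsmult)
    note sm = sub_rep_structure_map[OF U C, unfolded car]
    show ?thesis
      unfolding left_linear_def
    proof (intro CollectI conjI ballI funcsetI, goal_cases)
      case (1 t)
      then show ?case
        using closed by (auto simp: B.carrier_tensor sm car)
    next
      case (2 t u)
      then show ?case
        by (auto simp: B.carrier_tensor B.tensor_add[unfolded car] sm car structure_map_add C keys)
          (simp add: module_at_sub_rep)
    next
      case (3 r t)
      then show ?case
        by (auto simp: B.carrier_tensor smult[unfolded car] sm car structure_map_smult C keys)
          (simp add: module_at_sub_rep)
    qed
  qed
  then show ?thesis
    using sub_rep_left_module[OF U] species by (auto intro!: representation.intro simp: is_representation_def)
qed

end

section \<open>Endomorphism rings\<close>

text \<open>The crux is that one-sided inverses are two-sided: from a b = 1 the element b a is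
  idempotent, and an idempotent unit is 1, while a unit 1 - b a forces b a = 0 and so 1 = a (b a) b
  = 0. Consequently a product is a unit only if both factors are, which makes the non-units absorb
  multiplication; and if a + b is a unit, dividing by it gives two elements with sum 1, one of which
  is a unit.\<close>

lemma (in ring) unit_or_complement_unit_local:
  assumes nontrivial: "\<one> \<noteq> \<zero>"
    and unit: "\<And>a. a \<in> carrier R \<Longrightarrow> a \<in> Units R \<or> \<one> \<ominus> a \<in> Units R"
  shows "local_ring R"
proof -
  have right_inv: "a \<in> Units R" if ab: "a \<in> carrier R" "b \<in> carrier R" "a \<otimes> b = \<one>" for a b
  proof -
    have idem: "(b \<otimes> a) \<otimes> (b \<otimes> a) = b \<otimes> a"
      using ab by (metis l_one m_assoc m_closed)
    from unit[of "b \<otimes> a"] ab consider "b \<otimes> a \<in> Units R" | "\<one> \<ominus> b \<otimes> a \<in> Units R" by auto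
    then show ?thesis
    proof cases
      case 1
      then have "b \<otimes> a = \<one>" using idem ab by (metis Units_closed Units_l_cancel one_closed r_one)
      then show ?thesis using ab by (auto simp: Units_def)
    next
      case 2
      have "(\<one> \<ominus> b \<otimes> a) \<otimes> (b \<otimes> a) = b \<otimes> a \<ominus> (b \<otimes> a) \<otimes> (b \<otimes> a)"
        using ab by (simp add: minus_eq l_distr l_minus)
      also have "\<dots> = (\<one> \<ominus> b \<otimes> a) \<otimes> \<zero>"
        using ab by (simp add: idem minus_eq r_neg)
      finally have "b \<otimes> a = \<zero>"
        using ab
        by (metis Units_l_cancel[OF 2] m_closed zero_closed)
      moreover have "\<one> = a \<otimes> (b \<otimes> a) \<otimes> b"
        using ab by (simp add: m_assoc)
      ultimately show ?thesis using ab nontrivial by simp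
    qed
  qed
  have left_inv: "b \<in> Units R" if ab: "a \<in> carrier R" "b \<in> carrier R" "a \<otimes> b = \<one>" for a b
  proof -
    have a: "a \<in> Units R" using right_inv ab by blast
    have "b = inv a \<otimes> a \<otimes> b" using a ab by simp
    also have "\<dots> = inv a" using a ab by (simp add: m_assoc del: Units_l_inv)
    finally have "b = inv a" .
    then show ?thesis using a by simp
  qed
  have factors: "a \<in> Units R \<and> b \<in> Units R"
    if ab: "a \<in> carrier R" "b \<in> carrier R" "a \<otimes> b \<in> Units R" for a b
  proof
    show "a \<in> Units R" by (rule right_inv[of _ "b \<otimes> inv (a \<otimes> b)"]) (use ab in \<open>simp_all flip: m_assoc\<close>)
    show "b \<in> Units R" by (rule left_inv[of "inv (a \<otimes> b) \<otimes> a"]) (use ab in \<open>simp_all add: m_assoc\<close>)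
  qed
  have zero: "\<zero> \<notin> Units R"
    using nontrivial by (auto simp: Units_def)
  have minus: "\<ominus> a \<notin> Units R" if a: "a \<in> carrier R" "a \<notin> Units R" for a
  proof
    assume "\<ominus> a \<in> Units R"
    then have "a \<otimes> \<ominus> \<one> \<in> Units R" using a by (simp add: r_minus)
    then show False using factors[of a "\<ominus> \<one>"] a by simp
  qed
  have add: "a \<oplus> b \<notin> Units R"
    if ab: "a \<in> carrier R" "b \<in> carrier R" "a \<notin> Units R" "b \<notin> Units R" for a b
  proof
    assume u: "a \<oplus> b \<in> Units R"
    let ?a = "inv (a \<oplus> b) \<otimes> a" and ?b = "inv (a \<oplus> b) \<otimes> b"
    have cl: "?a \<in> carrier R" "?b \<in> carrier R" using u ab by auto
    have "\<one> = ?a \<oplus> ?b" using u ab by (simp flip: r_distr)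
    then have "\<one> \<ominus> ?a = ?b \<oplus> ?a \<ominus> ?a" using cl by (simp add: a_comm)
    also have "\<dots> = ?b" using cl by (simp add: minus_eq a_assoc r_neg)
    finally have "\<one> \<ominus> ?a = ?b" .
    then have "?a \<in> Units R \<or> ?b \<in> Units R" using unit[OF cl(1)] by metis
    then show False using factors u ab by blast
  qed
  have "ideal (carrier R - Units R) R"
  proof (rule idealI)
    show "subgroup (carrier R - Units R) (add_monoid R)"
      using zero minus add by (intro subgroup.intro) (auto simp: a_inv_def[symmetric])
  qed (blast intro: ring_axioms m_closed dest: factors)+
  then show ?thesis by (simp add: local_ring_def ring_axioms)
qed

context representation
begin

lemma carrier_End: "carrier E = rep_hom \<SS> M M"
  by (simp add: rep_End_def)

lemma End_closed: "\<lbrakk>f \<in> carrier E; x \<in> C; m \<in> car x\<rbrakk> \<Longrightarrow> f x m \<in> car x"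
  by (auto simp: carrier_End rep_hom_def left_linear_def PiE_iff)

lemma End_additive: "\<lbrakk>f \<in> carrier E; x \<in> C; m \<in> car x; n \<in> car x\<rbrakk> \<Longrightarrow>
    f x (m \<oplus>\<^bsub>module_at M x\<^esub> n) = f x m \<oplus>\<^bsub>module_at M x\<^esub> f x n"
  by (auto simp: carrier_End rep_hom_def left_linear_def PiE_iff)

lemma End_linear: "\<lbrakk>f \<in> carrier E; x \<in> C; r \<in> carrier (R x); m \<in> car x\<rbrakk> \<Longrightarrow>
    f x (r \<odot>\<^bsub>module_at M x\<^esub> m) = r \<odot>\<^bsub>module_at M x\<^esub> f x m"
  by (auto simp: carrier_End rep_hom_def left_linear_def PiE_iff)

lemma End_act: "\<lbrakk>f \<in> carrier E; y \<in> C; x \<in> C; a \<in> arr y x; m \<in> car x\<rbrakk> \<Longrightarrow>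
    f y (act \<SS> M y x a m) = act \<SS> M y x a (f x m)"
  by (simp add: carrier_End rep_hom_act)

lemmas End_hom = End_closed End_additive End_linear End_act

lemma End_eqI:
  assumes "f \<in> carrier E" "g \<in> carrier E" "\<And>x m. \<lbrakk>x \<in> C; m \<in> car x\<rbrakk> \<Longrightarrow> f x m = g x m"
  shows "f = g"
proof (rule extensionalityI[of _ C])
  show "f x = g x" if "x \<in> C" for x
    using assms that by (intro extensionalityI[of _ "car x"]) (auto simp: carrier_End rep_hom_def PiE_iff)
qed (use assms in \<open>auto simp: carrier_End rep_hom_def PiE_iff\<close>)

text \<open>Endomorphisms are extensional in the vertex and on each carrier, so a pointwise formula
  has to be cut off outside these before it can be a member of \<open>E\<close>.\<close>

definition endo :: "('c \<Rightarrow> 'm \<Rightarrow> 'm) \<Rightarrow> 'c \<Rightarrow> 'm \<Rightarrow> 'm"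
  where "endo f = (\<lambda>x\<in>C. \<lambda>m\<in>car x. f x m)"

lemma endo_apply [simp]: "\<lbrakk>x \<in> C; m \<in> car x\<rbrakk> \<Longrightarrow> endo f x m = f x m"
  by (simp add: endo_def)

lemma endo_in_End:
  assumes "\<And>x m. \<lbrakk>x \<in> C; m \<in> car x\<rbrakk> \<Longrightarrow> f x m \<in> car x"
    and "\<And>x m n. \<lbrakk>x \<in> C; m \<in> car x; n \<in> car x\<rbrakk> \<Longrightarrow>
      f x (m \<oplus>\<^bsub>module_at M x\<^esub> n) = f x m \<oplus>\<^bsub>module_at M x\<^esub> f x n"
    and "\<And>x r m. \<lbrakk>x \<in> C; r \<in> carrier (R x); m \<in> car x\<rbrakk> \<Longrightarrow>
      f x (r \<odot>\<^bsub>module_at M x\<^esub> m) = r \<odot>\<^bsub>module_at M x\<^esub> f x m"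
    and "\<And>y x a m. \<lbrakk>y \<in> C; x \<in> C; a \<in> arr y x; m \<in> car x\<rbrakk> \<Longrightarrow>
      f y (act \<SS> M y x a m) = act \<SS> M y x a (f x m)"
  shows "endo f \<in> carrier E"
  unfolding carrier_End
proof (rule rep_homI)
  show "endo f x \<in> left_linear (R x) (module_at M x) (module_at M x)" if "x \<in> C" for x
    using assms that by (auto simp: left_linear_def add_closed smult_closed)
qed (use assms act_closed in \<open>auto simp: endo_def representation_axioms\<close>)

lemma End_mult: "\<lbrakk>x \<in> C; m \<in> car x\<rbrakk> \<Longrightarrow> (f \<otimes>\<^bsub>E\<^esub> g) x m = f x (g x m)"
  by (simp add: rep_End_def rep_comp_def compose_def)

lemma End_one: "\<lbrakk>x \<in> C; m \<in> car x\<rbrakk> \<Longrightarrow> \<one>\<^bsub>E\<^esub> x m = m"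
  by (simp add: rep_End_def rep_id_def)

lemma End_zero: "\<lbrakk>x \<in> C; m \<in> car x\<rbrakk> \<Longrightarrow> \<zero>\<^bsub>E\<^esub> x m = \<zero>\<^bsub>module_at M x\<^esub>"
  by (simp add: rep_End_def)

lemma End_add: "\<lbrakk>x \<in> C; m \<in> car x\<rbrakk> \<Longrightarrow> (f \<oplus>\<^bsub>E\<^esub> g) x m = f x m \<oplus>\<^bsub>module_at M x\<^esub> g x m"
  by (simp add: rep_End_def)

lemma abelian_monoid: "x \<in> C \<Longrightarrow> abelian_monoid (module_at M x)"
  by (rule abelian_group.axioms(1)[OF abelian_group])

lemma act_zero: 
  assumes "y \<in> C" "x \<in> C" "a \<in> arr y x"
  shows "act \<SS> M y x a \<zero>\<^bsub>module_at M x\<^esub> = \<zero>\<^bsub>module_at M y\<^esub>"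
proof -
  interpret Y: abelian_group "module_at M y" by (rule abelian_group) fact
  interpret X: abelian_group "module_at M x" by (rule abelian_group) fact
  show ?thesis
    using act_add[OF assms X.zero_closed X.zero_closed] act_closed[OF assms X.zero_closed]
    by (simp add: Y.add.l_cancel_one)
qed

lemma smult_zero:
  assumes "x \<in> C" "r \<in> carrier (R x)"
  shows "r \<odot>\<^bsub>module_at M x\<^esub> \<zero>\<^bsub>module_at M x\<^esub> = \<zero>\<^bsub>module_at M x\<^esub>"
proof -
  interpret left_module "R x" "module_at M x" by (rule module) fact
  show ?thesis
    using smult_r_distr[OF assms(2) M.zero_closed M.zero_closed] smult_closed[OF assms(2) M.zero_closed]
    by (simp add: M.add.l_cancel_one)
qed

lemma smult_add:
  "\<lbrakk>x \<in> C; r \<in> carrier (R x); m \<in> car x; n \<in> car x\<rbrakk> \<Longrightarrow>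
    r \<odot>\<^bsub>module_at M x\<^esub> (m \<oplus>\<^bsub>module_at M x\<^esub> n)
      = r \<odot>\<^bsub>module_at M x\<^esub> m \<oplus>\<^bsub>module_at M x\<^esub> r \<odot>\<^bsub>module_at M x\<^esub> n"
  using left_module.smult_r_distr[OF module] .

lemma End_mult_closed:
  assumes f: "f \<in> carrier E" and g: "g \<in> carrier E"
  shows "f \<otimes>\<^bsub>E\<^esub> g \<in> carrier E"
  using endo_in_End[of "\<lambda>x m. f x (g x m)"]
  by (simp add: End_hom[OF f] End_hom[OF g] rep_End_def rep_comp_def compose_def endo_def)

lemma End_add_closed:
  assumes f: "f \<in> carrier E" and g: "g \<in> carrier E"
  shows "f \<oplus>\<^bsub>E\<^esub> g \<in> carrier E"
  using endo_in_End[of "\<lambda>x m. f x m \<oplus>\<^bsub>module_at M x\<^esub> g x m"]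
  by (simp add: End_hom[OF f] End_hom[OF g] rep_End_def endo_def add_closed smult_add act_add
    abelian_monoid.a_ac[OF abelian_monoid])

lemma End_zero_closed: "\<zero>\<^bsub>E\<^esub> \<in> carrier E"
  using endo_in_End[of "\<lambda>x m. \<zero>\<^bsub>module_at M x\<^esub>"] abelian_monoid.zero_closed[OF abelian_monoid]
  by (simp add: rep_End_def endo_def act_zero smult_zero abelian_monoid.l_zero[OF abelian_monoid])

lemma End_one_closed: "\<one>\<^bsub>E\<^esub> \<in> carrier E"
  using endo_in_End[of "\<lambda>x m. m"] by (simp add: rep_End_def rep_id_def endo_def)

lemma End_uminus: 
  assumes f: "f \<in> carrier E"
  shows "\<exists>g\<in>carrier E. g \<oplus>\<^bsub>E\<^esub> f = \<zero>\<^bsub>E\<^esub>"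
proof -
  let ?g = "endo (\<lambda>x m. f x (\<ominus>\<^bsub>module_at M x\<^esub> m))"
  have minus: "\<ominus>\<^bsub>module_at M x\<^esub> m \<in> car x" if "x \<in> C" "m \<in> car x" for x m
    using abelian_group.a_inv_closed[OF abelian_group] that .
  have "?g \<in> carrier E"
  proof (rule endo_in_End, goal_cases)
    case (3 x r m)
    interpret left_module "R x" "module_at M x" by (rule module) fact
    have "r \<odot>\<^bsub>module_at M x\<^esub> (\<ominus>\<^bsub>module_at M x\<^esub> m) \<oplus>\<^bsub>module_at M x\<^esub> r \<odot>\<^bsub>module_at M x\<^esub> m = \<zero>\<^bsub>module_at M x\<^esub>"
      using 3 smult_zero by (simp add: smult_r_distr[symmetric] M.l_neg)
    then have "\<ominus>\<^bsub>module_at M x\<^esub> (r \<odot>\<^bsub>module_at M x\<^esub> m) = r \<odot>\<^bsub>module_at M x\<^esub> (\<ominus>\<^bsub>module_at M x\<^esub> m)"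
      using 3 by (intro M.minus_equality) (auto simp: smult_closed)
    then show ?case using 3 minus by (simp add: End_linear[OF f])
  next
    case (4 y x a m)
    interpret Y: abelian_group "module_at M y" by (rule abelian_group) fact
    interpret X: abelian_group "module_at M x" by (rule abelian_group) fact
    have "act \<SS> M y x a (\<ominus>\<^bsub>module_at M x\<^esub> m) \<oplus>\<^bsub>module_at M y\<^esub> act \<SS> M y x a m = \<zero>\<^bsub>module_at M y\<^esub>"
      using 4 by (simp add: act_add[symmetric] X.l_neg act_zero)
    then have "\<ominus>\<^bsub>module_at M y\<^esub> act \<SS> M y x a m = act \<SS> M y x a (\<ominus>\<^bsub>module_at M x\<^esub> m)"
      using 4 by (intro Y.minus_equality) (auto simp: act_closed)
    then show ?case using 4 minus by (simp add: End_act[OF f])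
  next
    case (2 x m n)
    then show ?case
      using minus by (simp add: abelian_group.minus_add[OF abelian_group] End_additive[OF f])
  qed (use minus in \<open>simp add: End_closed[OF f]\<close>)
  moreover from this have "?g \<oplus>\<^bsub>E\<^esub> f = \<zero>\<^bsub>E\<^esub>"
  proof (intro End_eqI End_add_closed f End_zero_closed)
    fix x m assume xm: "x \<in> C" "m \<in> car x"
    then have "f x (\<ominus>\<^bsub>module_at M x\<^esub> m) \<oplus>\<^bsub>module_at M x\<^esub> f x m = f x (\<zero>\<^bsub>module_at M x\<^esub>)"
      using minus by (simp add: End_additive[OF f, symmetric] abelian_group.l_neg[OF abelian_group])
    moreover have "f x (\<zero>\<^bsub>module_at M x\<^esub>) = \<zero>\<^bsub>module_at M x\<^esub>"
    proof -
      interpret X: abelian_group "module_at M x" by (rule abelian_group) fact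
      show ?thesis
        using End_additive[OF f xm(1) X.zero_closed X.zero_closed] End_closed[OF f xm(1) X.zero_closed]
        by (simp add: X.add.l_cancel_one)
    qed
    ultimately show "(?g \<oplus>\<^bsub>E\<^esub> f) x m = \<zero>\<^bsub>E\<^esub> x m"
      using xm by (simp add: End_add End_zero)
  qed
  ultimately show ?thesis by blast
qed

lemma ring_End: "ring E"
proof (intro ringI abelian_groupI monoidI)
  fix f g h assume fgh: "f \<in> carrier E" "g \<in> carrier E" "h \<in> carrier E"
  note closed = End_mult_closed End_add_closed fgh
  note simps = End_mult End_add fgh[THEN End_closed] fgh[THEN End_additive] add_closed
    abelian_monoid.a_ac[OF abelian_monoid]
  show "f \<oplus>\<^bsub>E\<^esub> g \<oplus>\<^bsub>E\<^esub> h = f \<oplus>\<^bsub>E\<^esub> (g \<oplus>\<^bsub>E\<^esub> h)" by (intro End_eqI closed) (simp add: simps)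
  show "f \<otimes>\<^bsub>E\<^esub> g \<otimes>\<^bsub>E\<^esub> h = f \<otimes>\<^bsub>E\<^esub> (g \<otimes>\<^bsub>E\<^esub> h)" by (intro End_eqI closed) (simp add: simps)
  show "(f \<oplus>\<^bsub>E\<^esub> g) \<otimes>\<^bsub>E\<^esub> h = f \<otimes>\<^bsub>E\<^esub> h \<oplus>\<^bsub>E\<^esub> g \<otimes>\<^bsub>E\<^esub> h" by (intro End_eqI closed) (simp add: simps)
  show "h \<otimes>\<^bsub>E\<^esub> (f \<oplus>\<^bsub>E\<^esub> g) = h \<otimes>\<^bsub>E\<^esub> f \<oplus>\<^bsub>E\<^esub> h \<otimes>\<^bsub>E\<^esub> g" by (intro End_eqI closed) (simp add: simps)
next
  fix f g assume fg: "f \<in> carrier E" "g \<in> carrier E"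
  show "f \<oplus>\<^bsub>E\<^esub> g = g \<oplus>\<^bsub>E\<^esub> f"
    by (intro End_eqI End_add_closed fg)
      (simp add: End_add fg[THEN End_closed] abelian_monoid.a_ac[OF abelian_monoid])
next
  fix f assume f: "f \<in> carrier E"
  note closed = f End_add_closed End_mult_closed End_zero_closed End_one_closed
  note simps = End_add End_mult End_zero End_one End_closed[OF f] abelian_monoid.l_zero[OF abelian_monoid]
  show "\<zero>\<^bsub>E\<^esub> \<oplus>\<^bsub>E\<^esub> f = f" by (intro End_eqI closed) (simp add: simps)
  show "\<one>\<^bsub>E\<^esub> \<otimes>\<^bsub>E\<^esub> f = f" by (intro End_eqI closed) (simp add: simps)
  show "f \<otimes>\<^bsub>E\<^esub> \<one>\<^bsub>E\<^esub> = f" by (intro End_eqI closed) (simp add: simps)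
qed (fact End_mult_closed End_add_closed End_zero_closed End_one_closed End_uminus)+

end

sublocale representation \<subseteq> End: ring "rep_End \<SS> M"
  by (rule ring_End)

context representation
begin

lemma End_of_zero: "\<lbrakk>f \<in> carrier E; x \<in> C\<rbrakk> \<Longrightarrow> f x \<zero>\<^bsub>module_at M x\<^esub> = \<zero>\<^bsub>module_at M x\<^esub>"
  using End_mult[of x "\<zero>\<^bsub>module_at M x\<^esub>" f "\<zero>\<^bsub>E\<^esub>"] End_zero abelian_monoid.zero_closed[OF abelian_monoid]
  by simp

lemma End_minus:
  assumes "f \<in> carrier E" "g \<in> carrier E" "x \<in> C" "m \<in> car x"
  shows "(f \<ominus>\<^bsub>E\<^esub> g) x m = f x m \<ominus>\<^bsub>module_at M x\<^esub> g x m"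
proof -
  interpret X: abelian_group "module_at M x" by (rule abelian_group) fact
  have "f = (f \<ominus>\<^bsub>E\<^esub> g) \<oplus>\<^bsub>E\<^esub> g"
    using assms by (simp add: a_minus_def End.a_assoc End.l_neg)
  then have "f x m = (f \<ominus>\<^bsub>E\<^esub> g) x m \<oplus>\<^bsub>module_at M x\<^esub> g x m"
    using End_add[OF assms(3,4), of "f \<ominus>\<^bsub>E\<^esub> g" g] by simp
  then show ?thesis
    using assms End.minus_closed[OF assms(1,2)] by (simp add: End_closed a_minus_def X.a_assoc X.r_neg)
qed

lemma End_Units:
  assumes f: "f \<in> carrier E" and bij: "\<And>x. x \<in> C \<Longrightarrow> bij_betw (f x) (car x) (car x)"
  shows "f \<in> Units E"
proof -
  obtain g where "g \<in> rep_hom \<SS> M M" "rep_comp \<SS> M g f = rep_id \<SS> M" "rep_comp \<SS> M f g = rep_id \<SS> M"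
    using rep_hom_inverse[OF representation_axioms f[unfolded carrier_End] bij] by blast
  then show ?thesis
    using f by (auto simp: Units_def rep_End_def)
qed

lemma subrep_image:
  assumes f: "f \<in> carrier E"
  shows "subrep (\<lambda>x. f x ` car x)"
  unfolding subrep_def
proof (intro conjI ballI, goal_cases)
  case (1 x)
  then show ?case by (auto simp: End_closed[OF f])
next
  case (2 x)
  then show ?case
    by (intro image_eqI[of _ _ "\<zero>\<^bsub>module_at M x\<^esub>"])
      (auto simp: End_of_zero[OF f] abelian_monoid.zero_closed[OF abelian_monoid])
next
  case (3 x m n)
  then show ?case by (auto simp: End_additive[OF f, symmetric] intro!: add_closed)
next
  case (4 x r m)
  then show ?case by (auto simp: End_linear[OF f, symmetric] intro!: smult_closed)
next
  case (5 y x a m)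
  then show ?case by (auto simp: End_act[OF f, symmetric] intro!: act_closed)
qed

lemma rep_hom_sub_rep:
  assumes f: "f \<in> carrier E" and U: "subrep U" and fU: "\<And>x m. \<lbrakk>x \<in> C; m \<in> car x\<rbrakk> \<Longrightarrow> f x m \<in> U x"
  shows "f \<in> rep_hom \<SS> M (sub_rep \<SS> M U)"
proof (rule rep_homI[OF representation_axioms representation_sub_rep[OF U]])
  show "f \<in> extensional C" and "\<And>x. x \<in> C \<Longrightarrow> f x \<in> extensional (car x)"
    using f by (auto simp: carrier_End rep_hom_def PiE_iff)
  show "f x \<in> left_linear (R x) (module_at M x) (module_at (sub_rep \<SS> M U) x)" if "x \<in> C" for x
    using that by (simp add: left_linear_def module_at_sub_rep fU End_hom[OF f])
  show "act \<SS> (sub_rep \<SS> M U) y x a (f x m) = f y (act \<SS> M y x a m)"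
    if "y \<in> C" "x \<in> C" "a \<in> arr y x" "m \<in> car x" for y x a m
    using that by (simp add: sub_rep_act[OF U] End_act[OF f])
qed

text \<open>For \<open>f\<close> a projection onto \<open>U\<close>, sending \<open>q\<close> to
  \<open>q\<close> after \<open>f\<close> identifies the endomorphism ring of \<open>U\<close> with
  the corner f E f. Idempotents of a summand thereby become idempotents of \<open>M\<close>.\<close>

lemma corner_in_End:
  assumes f: "f \<in> carrier E" and U: "subrep U" and fU: "\<And>x m. \<lbrakk>x \<in> C; m \<in> car x\<rbrakk> \<Longrightarrow> f x m \<in> U x"
    and q: "q \<in> carrier (rep_End \<SS> (sub_rep \<SS> M U))"
  shows "endo (\<lambda>x m. q x (f x m)) \<in> carrier E"
proof -
  interpret U: representation \<SS> "sub_rep \<SS> M U" by (rule representation_sub_rep[OF U])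
  have UM: "m \<in> car x" if "m \<in> U x" "x \<in> C" for x m using U that by (auto simp: subrep_def)
  show ?thesis
    using U.End_hom[OF q, unfolded module_at_sub_rep sub_rep_act[OF U], simplified] UM fU
    by (intro endo_in_End) (simp_all add: End_hom[OF f] sub_rep_act[OF U])
qed

end

section \<open>Indecomposable artinian representations\<close>

lemma (in abelian_group) minus_eq_zero_iff:
  assumes "a \<in> carrier G" "b \<in> carrier G"
  shows "a \<ominus> b = \<zero> \<longleftrightarrow> a = b"
proof
  assume "a \<ominus> b = \<zero>"
  then have "a \<ominus> b \<oplus> b = b" using assms by simp
  then show "a = b" using assms by (simp add: a_minus_def a_assoc l_neg)
qed (use assms in \<open>simp add: a_minus_def r_neg\<close>)

section \<open>Scalars from \<open>S\<close> and the descending chain condition at a vertex\<close>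

locale artinian_representation = representation \<SS> M
  for \<SS> :: "('c, 'r, 'a) species" and M :: "('c, 'r, 'a, 'm) rep" +
  fixes S :: "'s ring" and \<iota> :: "'c \<Rightarrow> 's \<Rightarrow> 'r"
  assumes subring: "common_central_subring \<SS> S \<iota>"
    and acts_centrally: "acts_centrally \<SS> S \<iota>"
    and artinian: "\<And>x. x \<in> vertices \<SS> \<Longrightarrow> artinian_module S (restrict_scalars (\<iota> x) (module_at M x))"
begin

lemma scalar_closed: "\<lbrakk>x \<in> C; s \<in> carrier S\<rbrakk> \<Longrightarrow> \<iota> x s \<in> carrier (R x)"
  using subring by (auto simp: common_central_subring_def ring_hom_def)

definition scalar :: "'s \<Rightarrow> 'c \<Rightarrow> 'm \<Rightarrow> 'm"
  where "scalar s = endo (\<lambda>x m. \<iota> x s \<odot>\<^bsub>module_at M x\<^esub> m)"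

lemma scalar_apply: "\<lbrakk>x \<in> C; m \<in> car x\<rbrakk> \<Longrightarrow> scalar s x m = \<iota> x s \<odot>\<^bsub>module_at M x\<^esub> m"
  by (simp add: scalar_def)

text \<open>Both centrality conditions enter here: s commutes with \<open>R x\<close>, so its action
  is linear, and s (a \<otimes> m) = (s a) \<otimes> m = (a s) \<otimes> m = a \<otimes> (s m) makes
  the actions at different vertices compatible.\<close>

lemma scalar_in_End:
  assumes s: "s \<in> carrier S"
  shows "scalar s \<in> carrier E"
  unfolding scalar_def
proof (rule endo_in_End, goal_cases)
  case (3 x r m)
  interpret left_module "R x" "module_at M x" by (rule module) (rule 3)
  have "\<iota> x s \<otimes>\<^bsub>R x\<^esub> r = r \<otimes>\<^bsub>R x\<^esub> \<iota> x s"
    using subring 3 s by (auto simp: common_central_subring_def)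
  then show ?case
    using smult_assoc[of "\<iota> x s" r m] smult_assoc[of r "\<iota> x s" m] 3 scalar_closed[OF 3(1) s] by simp
next
  case (4 y x a m)
  have "\<iota> y s \<odot>\<^bsub>arrow \<SS> y x\<^esub> a = rsmult (arrow \<SS> y x) a (\<iota> x s)"
    using acts_centrally 4 s by (simp add: acts_centrally_def)
  then show ?case
    using 4 s by (simp add: scalar_closed flip: act_smult act_balanced)
qed (use s in \<open>simp_all add: scalar_closed smult_closed smult_add\<close>)

lemma scalar_commute:
  assumes s: "s \<in> carrier S" and f: "f \<in> carrier E"
  shows "scalar s \<otimes>\<^bsub>E\<^esub> f = f \<otimes>\<^bsub>E\<^esub> scalar s"
  by (intro End_eqI End_mult_closed scalar_in_End s f)
    (simp add: End_mult scalar_apply End_hom[OF f] scalar_closed s)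

definition scalar_closed_subgroup :: "'c \<Rightarrow> 'm set \<Rightarrow> bool"
  where "scalar_closed_subgroup x N \<longleftrightarrow> N \<subseteq> car x \<and> \<zero>\<^bsub>module_at M x\<^esub> \<in> N \<and>
    (\<forall>m\<in>N. \<forall>n\<in>N. m \<oplus>\<^bsub>module_at M x\<^esub> n \<in> N) \<and>
    (\<forall>s\<in>carrier S. \<forall>m\<in>N. scalar s x m \<in> N)"

text \<open>Closure under negatives comes from the scalar -1 of \<open>S\<close>, which
  \<open>\<iota> x\<close> sends to -1 in \<open>R x\<close>.\<close>

lemma scalar_closed_subgroup_submodule:
  assumes x: "x \<in> C" and N: "scalar_closed_subgroup x N"
  shows "submodule N S (restrict_scalars (\<iota> x) (module_at M x))"
proof -
  interpret left_module "R x" "module_at M x" by (rule module) fact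
  interpret S: ring S using subring by (simp add: common_central_subring_def)
  interpret \<iota>: ring_hom_ring S "R x" "\<iota> x"
    using subring x by (intro ring_hom_ringI2 S.ring_axioms R.ring_axioms) (simp add: common_central_subring_def)
  have inv: "inv\<^bsub>add_monoid (restrict_scalars (\<iota> x) (module_at M x))\<^esub> m = \<ominus>\<^bsub>module_at M x\<^esub> m" for m
    by (simp add: restrict_scalars_def m_inv_def a_inv_def)
  have car: "m \<in> car x" if "m \<in> N" for m using that N by (auto simp: scalar_closed_subgroup_def)
  have smult: "\<iota> x s \<odot>\<^bsub>module_at M x\<^esub> m \<in> N" if "s \<in> carrier S" "m \<in> N" for s m
  proof -
    have "scalar s x m \<in> N" using that N by (simp add: scalar_closed_subgroup_def)
    then show ?thesis using x car[OF that(2)] by (simp add: scalar_apply)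
  qed
  have "\<ominus>\<^bsub>module_at M x\<^esub> m \<in> N" if "m \<in> N" for m
    using smult[of "\<ominus>\<^bsub>S\<^esub> \<one>\<^bsub>S\<^esub>" m] that smult_minus_one[OF x car[OF that]] by simp
  then show ?thesis
    unfolding submodule_def submodule_axioms_def
    using N smult
    by (auto simp: scalar_closed_subgroup_def inv intro!: subgroup.intro) (auto simp: restrict_scalars_def)
qed

lemma dcc:
  assumes x: "x \<in> C" and N: "\<And>n. scalar_closed_subgroup x (N n)" and dec: "\<And>n. N (Suc n) \<subseteq> N n"
  shows "\<exists>k. \<forall>n\<ge>k. N n = N k"
  using artinian[OF x] scalar_closed_subgroup_submodule[OF x N] dec
  unfolding artinian_module_def by blast

lemma dcc_minimal:
  assumes x: "x \<in> C" and F: "N0 \<in> F" "\<And>N. N \<in> F \<Longrightarrow> scalar_closed_subgroup x N"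
  shows "\<exists>N\<in>F. \<forall>N'\<in>F. N' \<subseteq> N \<longrightarrow> N' = N"
proof (rule ccontr)
  assume "\<not> ?thesis"
  then have step: "\<forall>N\<in>F. \<exists>N'\<in>F. N' \<subset> N" by blast
  then obtain d where d: "\<And>N. N \<in> F \<Longrightarrow> d N \<in> F \<and> d N \<subset> N" by metis
  have "(d ^^ n) N0 \<in> F" for n by (induction n) (use F d in auto)
  then have "\<And>n. scalar_closed_subgroup x ((d ^^ n) N0)" "\<And>n. (d ^^ Suc n) N0 \<subset> (d ^^ n) N0"
    using F d by auto
  then show False using dcc[OF x, of "\<lambda>n. (d ^^ n) N0"] by (metis le_SucI order_refl psubset_eq)
qed

end

section \<open>The projection belonging to two complementary subrepresentations\<close>

context representation
begin

text \<open>Two splittings of the same element differ by an element of both \<open>K x\<close> and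
  \<open>L x\<close>, so the component in \<open>K x\<close> is a function of the element; as
  \<open>K\<close> and \<open>L\<close> are stable under all operations, this function is an
  endomorphism.\<close>

lemma complement_idempotent:
  assumes K: "subrep K" and L: "subrep L"
    and disj: "\<And>x m. \<lbrakk>x \<in> C; m \<in> K x; m \<in> L x\<rbrakk> \<Longrightarrow> m = \<zero>\<^bsub>module_at M x\<^esub>"
    and sum: "\<And>x m. \<lbrakk>x \<in> C; m \<in> car x\<rbrakk> \<Longrightarrow> \<exists>k\<in>K x. \<exists>l\<in>L x. m = k \<oplus>\<^bsub>module_at M x\<^esub> l"
  obtains e where "e \<in> carrier E" "e \<otimes>\<^bsub>E\<^esub> e = e"
    "\<And>x k l. \<lbrakk>x \<in> C; k \<in> K x; l \<in> L x\<rbrakk> \<Longrightarrow> e x (k \<oplus>\<^bsub>module_at M x\<^esub> l) = k"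
proof
  have Kc: "k \<in> car x" if "x \<in> C" "k \<in> K x" for x k using K that by (auto simp: subrep_def)
  have Lc: "l \<in> car x" if "x \<in> C" "l \<in> L x" for x l using L that by (auto simp: subrep_def)
  have unique: "k = k'" if "x \<in> C" "k \<in> K x" "l \<in> L x" "k' \<in> K x" "l' \<in> L x"
    "k \<oplus>\<^bsub>module_at M x\<^esub> l = k' \<oplus>\<^bsub>module_at M x\<^esub> l'" for x k l k' l'
  proof -
    interpret X: abelian_group "module_at M x" by (rule abelian_group) fact
    note cl = Kc[OF that(1,2)] Lc[OF that(1,3)] Kc[OF that(1,4)] Lc[OF that(1,5)]
    have "k \<ominus>\<^bsub>module_at M x\<^esub> k' = \<ominus>\<^bsub>module_at M x\<^esub> k' \<oplus>\<^bsub>module_at M x\<^esub> (k \<oplus>\<^bsub>module_at M x\<^esub> l) \<ominus>\<^bsub>module_at M x\<^esub> l"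
      using cl by (simp add: a_minus_def X.a_assoc X.r_neg X.r_neg2 X.a_comm[of k])
    also have "\<dots> = l' \<ominus>\<^bsub>module_at M x\<^esub> l"
      unfolding that(6) using cl by (simp add: a_minus_def X.r_neg1)
    finally have eq: "k \<ominus>\<^bsub>module_at M x\<^esub> k' = l' \<ominus>\<^bsub>module_at M x\<^esub> l" .
    have "k \<ominus>\<^bsub>module_at M x\<^esub> k' \<in> K x"
      using K that subrep_minus[OF K that(1,4)] by (auto simp: subrep_def a_minus_def)
    moreover have "l' \<ominus>\<^bsub>module_at M x\<^esub> l \<in> L x"
      using L that subrep_minus[OF L that(1,3)] by (auto simp: subrep_def a_minus_def)
    ultimately have "k \<ominus>\<^bsub>module_at M x\<^esub> k' = \<zero>\<^bsub>module_at M x\<^esub>"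
      using disj[OF that(1)] eq by simp
    then show ?thesis using cl by (simp add: X.minus_eq_zero_iff)
  qed
  define e where "e = endo (\<lambda>x m. THE k. k \<in> K x \<and> (\<exists>l\<in>L x. m = k \<oplus>\<^bsub>module_at M x\<^esub> l))"
  have e: "e x (k \<oplus>\<^bsub>module_at M x\<^esub> l) = k" if "x \<in> C" "k \<in> K x" "l \<in> L x" for x k l
  proof -
    have "(THE k'. k' \<in> K x \<and> (\<exists>l'\<in>L x. k \<oplus>\<^bsub>module_at M x\<^esub> l = k' \<oplus>\<^bsub>module_at M x\<^esub> l')) = k"
      using that unique[OF that] by (intro the_equality) blast+
    then show ?thesis using that Kc Lc by (simp add: e_def add_closed)
  qed
  then show "e x (k \<oplus>\<^bsub>module_at M x\<^esub> l) = k" if "x \<in> C" "k \<in> K x" "l \<in> L x" for x k l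
    using that .
  have "endo e \<in> carrier E"
  proof (rule endo_in_End)
    fix x m assume x: "x \<in> C" and "m \<in> car x"
    then obtain k l where "k \<in> K x" "l \<in> L x" "m = k \<oplus>\<^bsub>module_at M x\<^esub> l" using sum by blast
    then show "e x m \<in> car x" using x e Kc by simp
  next
    fix x m n assume x: "x \<in> C" and "m \<in> car x" "n \<in> car x"
    then obtain k l k' l' where kl: "k \<in> K x" "l \<in> L x" "m = k \<oplus>\<^bsub>module_at M x\<^esub> l"
      "k' \<in> K x" "l' \<in> L x" "n = k' \<oplus>\<^bsub>module_at M x\<^esub> l'" using sum by metis
    interpret X: abelian_group "module_at M x" by (rule abelian_group) fact
    have "m \<oplus>\<^bsub>module_at M x\<^esub> n = (k \<oplus>\<^bsub>module_at M x\<^esub> k') \<oplus>\<^bsub>module_at M x\<^esub> (l \<oplus>\<^bsub>module_at M x\<^esub> l')"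
      using kl Kc Lc x by (simp add: X.a_ac)
    moreover have "k \<oplus>\<^bsub>module_at M x\<^esub> k' \<in> K x" "l \<oplus>\<^bsub>module_at M x\<^esub> l' \<in> L x"
      using K L kl x by (auto simp: subrep_def)
    ultimately show "e x (m \<oplus>\<^bsub>module_at M x\<^esub> n) = e x m \<oplus>\<^bsub>module_at M x\<^esub> e x n"
      using kl x e by simp
  next
    fix x r m assume x: "x \<in> C" and r: "r \<in> carrier (R x)" and "m \<in> car x"
    then obtain k l where kl: "k \<in> K x" "l \<in> L x" "m = k \<oplus>\<^bsub>module_at M x\<^esub> l" using sum by blast
    have "r \<odot>\<^bsub>module_at M x\<^esub> k \<in> K x" "r \<odot>\<^bsub>module_at M x\<^esub> l \<in> L x"
      using K L kl x r by (auto simp: subrep_def)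
    then show "e x (r \<odot>\<^bsub>module_at M x\<^esub> m) = r \<odot>\<^bsub>module_at M x\<^esub> e x m"
      using kl x r e Kc Lc by (simp add: smult_add)
  next
    fix y x a m assume C: "y \<in> C" "x \<in> C" and a: "a \<in> arr y x" and "m \<in> car x"
    then obtain k l where kl: "k \<in> K x" "l \<in> L x" "m = k \<oplus>\<^bsub>module_at M x\<^esub> l" using sum by blast
    have "act \<SS> M y x a k \<in> K y" "act \<SS> M y x a l \<in> L y"
      using K L kl C a by (auto simp: subrep_def)
    then show "e y (act \<SS> M y x a m) = act \<SS> M y x a (e x m)"
      using kl C a e Kc Lc by (simp add: act_add)
  qed
  then show eE: "e \<in> carrier E" by (simp add: e_def endo_def cong: restrict_cong)
  have "e x (e x m) = e x m" if x: "x \<in> C" "m \<in> car x" for x m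
  proof -
    interpret X: abelian_group "module_at M x" by (rule abelian_group) fact
    obtain k l where kl: "k \<in> K x" "l \<in> L x" "m = k \<oplus>\<^bsub>module_at M x\<^esub> l" using sum x by blast
    \<comment> \<open>The second application of \<open>e\<close> uses the splitting of
      \<open>k\<close> as \<open>k\<close> plus zero.\<close>
    then show ?thesis using e[OF x(1) kl(1,2)] e[OF x(1) kl(1), of "\<zero>\<^bsub>module_at M x\<^esub>"] L x Kc
      by (auto simp: subrep_def)
  qed
  then show "e \<otimes>\<^bsub>E\<^esub> e = e"
    by (intro End_eqI End_mult_closed eE) (simp add: End_mult)
qed

end

section \<open>Splitting a representation by a single endomorphism\<close>

context artinian_representation
begin

text \<open>The bicommutant is a commutative subring containing \<open>\<phi>\<close> and the scalars from \<open>S\<close>; it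
  plays the role of \<open>S[\<phi>]\<close>.\<close>

definition bicommutant :: "('c \<Rightarrow> 'm \<Rightarrow> 'm) \<Rightarrow> ('c \<Rightarrow> 'm \<Rightarrow> 'm) set"
  where "bicommutant \<phi> = {t \<in> carrier E. \<forall>u\<in>carrier E. u \<otimes>\<^bsub>E\<^esub> \<phi> = \<phi> \<otimes>\<^bsub>E\<^esub> u \<longrightarrow> t \<otimes>\<^bsub>E\<^esub> u = u \<otimes>\<^bsub>E\<^esub> t}"

context
  fixes \<phi> assumes \<phi>: "\<phi> \<in> carrier E"
begin

abbreviation "T \<equiv> bicommutant \<phi>"

lemma bicommutant_End: "t \<in> T \<Longrightarrow> t \<in> carrier E"
  by (simp add: bicommutant_def)

lemma bicommutant_self: "\<phi> \<in> T"
  using \<phi> by (simp add: bicommutant_def)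

lemma bicommutant_commute:
  assumes "t \<in> T" "u \<in> T"
  shows "t \<otimes>\<^bsub>E\<^esub> u = u \<otimes>\<^bsub>E\<^esub> t"
proof -
  have "u \<otimes>\<^bsub>E\<^esub> \<phi> = \<phi> \<otimes>\<^bsub>E\<^esub> u" using assms(2) \<phi> by (simp add: bicommutant_def)
  then show ?thesis using assms by (simp add: bicommutant_def)
qed

lemma bicommutant_one: "\<one>\<^bsub>E\<^esub> \<in> T"
  by (simp add: bicommutant_def)

lemma bicommutant_zero: "\<zero>\<^bsub>E\<^esub> \<in> T"
  by (simp add: bicommutant_def)

lemma bicommutant_scalar: "s \<in> carrier S \<Longrightarrow> scalar s \<in> T"
  by (simp add: bicommutant_def scalar_in_End scalar_commute)

lemma bicommutant_mult:
  assumes "t \<in> T" "u \<in> T"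
  shows "t \<otimes>\<^bsub>E\<^esub> u \<in> T"
proof -
  have tu: "t \<in> carrier E" "u \<in> carrier E" using assms by (auto simp: bicommutant_def)
  have "t \<otimes>\<^bsub>E\<^esub> u \<otimes>\<^bsub>E\<^esub> v = v \<otimes>\<^bsub>E\<^esub> (t \<otimes>\<^bsub>E\<^esub> u)"
    if v: "v \<in> carrier E" "v \<otimes>\<^bsub>E\<^esub> \<phi> = \<phi> \<otimes>\<^bsub>E\<^esub> v" for v
  proof -
    have "t \<otimes>\<^bsub>E\<^esub> v = v \<otimes>\<^bsub>E\<^esub> t" "u \<otimes>\<^bsub>E\<^esub> v = v \<otimes>\<^bsub>E\<^esub> u" using assms v by (auto simp: bicommutant_def)
    then show ?thesis using tu v by (metis End.m_assoc)
  qed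
  then show ?thesis using tu by (simp add: bicommutant_def)
qed

lemma bicommutant_add:
  assumes "t \<in> T" "u \<in> T"
  shows "t \<oplus>\<^bsub>E\<^esub> u \<in> T"
  using assms by (simp add: bicommutant_def End.l_distr End.r_distr)

lemma bicommutant_uminus: "t \<in> T \<Longrightarrow> \<ominus>\<^bsub>E\<^esub> t \<in> T"
  by (simp add: bicommutant_def End.l_minus End.r_minus)

lemma bicommutant_pow: "t \<in> T \<Longrightarrow> t [^]\<^bsub>E\<^esub> (n::nat) \<in> T"
  by (induction n) (simp_all add: bicommutant_one bicommutant_mult)

lemma bicommutant_apply_commute:
  assumes "t \<in> T" "u \<in> T" "x \<in> C" "m \<in> car x"
  shows "t x (u x m) = u x (t x m)"
  using bicommutant_commute[OF assms(1,2)] assms(3,4) End_mult[of x m] by metis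

text \<open>The exponent depends on m: ascending chains of kernels need not stop, so no single power
  of \<phi> can be fixed, even at one vertex.\<close>

definition nilpotent_part :: "'c \<Rightarrow> 'm set"
  where "nilpotent_part x = {m \<in> car x. \<exists>n::nat. (\<phi> [^]\<^bsub>E\<^esub> n) x m = \<zero>\<^bsub>module_at M x\<^esub>}"

text \<open>Here t depends on m as well. Taking it from \<open>T\<close>, and not just as some
  operator at the vertex x, is what makes these sets stable under addition, under the rings and
  under the structure maps.\<close>

definition invertible_part :: "'c \<Rightarrow> 'm set"
  where "invertible_part x = {m \<in> car x. \<exists>t\<in>T. t x (\<phi> x m) = m}"

lemma pow_End: "\<phi> [^]\<^bsub>E\<^esub> (n::nat) \<in> carrier E"
  using \<phi> by simp

lemma pow_add_apply:
  assumes "x \<in> C" "m \<in> car x"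
  shows "(\<phi> [^]\<^bsub>E\<^esub> (n + k :: nat)) x m = (\<phi> [^]\<^bsub>E\<^esub> n) x ((\<phi> [^]\<^bsub>E\<^esub> k) x m)"
  using \<phi> assms by (simp add: End.nat_pow_mult[symmetric] End_mult)

lemma pow_Suc_apply:
  assumes "x \<in> C" "m \<in> car x"
  shows "(\<phi> [^]\<^bsub>E\<^esub> Suc n) x m = \<phi> x ((\<phi> [^]\<^bsub>E\<^esub> n) x m)"
  using assms unfolding End.nat_pow_Suc2[OF \<phi>] by (rule End_mult)

lemma subrep_nilpotent_part: "subrep nilpotent_part"
  unfolding subrep_def
proof (intro conjI ballI, goal_cases)
  case (1 x)
  then show ?case by (auto simp: nilpotent_part_def)
next
  case (2 x)
  then show ?case
    by (auto simp: nilpotent_part_def End_of_zero[OF pow_End] abelian_monoid.zero_closed[OF abelian_monoid])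
next
  case (3 x m n)
  interpret X: abelian_group "module_at M x" by (rule abelian_group) fact
  from 3 obtain i j :: nat where ij: "(\<phi> [^]\<^bsub>E\<^esub> i) x m = \<zero>\<^bsub>module_at M x\<^esub>" "(\<phi> [^]\<^bsub>E\<^esub> j) x n = \<zero>\<^bsub>module_at M x\<^esub>"
    and mn: "m \<in> car x" "n \<in> car x"
    by (auto simp: nilpotent_part_def)
  have "(\<phi> [^]\<^bsub>E\<^esub> (i + j)) x m = \<zero>\<^bsub>module_at M x\<^esub>" "(\<phi> [^]\<^bsub>E\<^esub> (i + j)) x n = \<zero>\<^bsub>module_at M x\<^esub>"
    using pow_add_apply[OF 3(1) mn(1), of j i] pow_add_apply[OF 3(1) mn(2), of i j] ij 3(1)
    by (simp_all add: add.commute End_of_zero[OF pow_End])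
  then have "(\<phi> [^]\<^bsub>E\<^esub> (i + j)) x (m \<oplus>\<^bsub>module_at M x\<^esub> n) = \<zero>\<^bsub>module_at M x\<^esub>"
    using 3(1) mn by (simp add: End_additive[OF pow_End])
  then show ?case using mn unfolding nilpotent_part_def by blast
next
  case (4 x r m)
  then show ?case
    by (simp add: nilpotent_part_def End_linear[OF pow_End] smult_closed) (metis smult_zero)
next
  case (5 y x a m)
  then show ?case
    by (simp add: nilpotent_part_def End_act[OF pow_End] act_closed) (metis act_zero)
qed

lemma invertible_partD:
  assumes "m \<in> invertible_part x"
  obtains t where "t \<in> T" "t \<in> carrier E" "m \<in> car x" "t x (\<phi> x m) = m"
  using assms bicommutant_End by (auto simp: invertible_part_def)

text \<open>Scalars and structure maps keep the witness \<open>t\<close>, since it is an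
  endomorphism of the whole representation. Sums are the real issue: the two witnesses have to be
  merged into one that serves both summands, which relies on \<open>T\<close> being a commutative
  ring.\<close>

lemma subrep_invertible_part: "subrep invertible_part"
  unfolding subrep_def
proof (intro conjI ballI, goal_cases)
  case (1 x)
  then show ?case by (auto simp: invertible_part_def)
next
  case (2 x)
  then show ?case
    using End_of_zero[OF \<phi> 2]
    by (auto simp: invertible_part_def End_of_zero abelian_monoid.zero_closed[OF abelian_monoid] End_zero bicommutant_zero
        intro!: bexI[of _ "\<zero>\<^bsub>E\<^esub>"])
next
  case (3 x m n)
  interpret X: abelian_group "module_at M x" by (rule abelian_group) fact
  obtain t where t: "t \<in> T" "t \<in> carrier E" "m \<in> car x" "t x (\<phi> x m) = m" using 3 by (elim invertible_partD)
  obtain u where u: "u \<in> T" "u \<in> carrier E" "n \<in> car x" "u x (\<phi> x n) = n" using 3 by (elim invertible_partD)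
  \<comment> \<open>\<open>1 - v \<phi> = (1 - t \<phi>) (1 - u \<phi>)\<close> kills \<open>m\<close> and \<open>n\<close>\<close>
  define v where "v = t \<oplus>\<^bsub>E\<^esub> (u \<oplus>\<^bsub>E\<^esub> \<ominus>\<^bsub>E\<^esub> (t \<otimes>\<^bsub>E\<^esub> (u \<otimes>\<^bsub>E\<^esub> \<phi>)))"
  have v: "v \<in> T"
    unfolding v_def using t u by (intro bicommutant_add bicommutant_uminus bicommutant_mult bicommutant_self) auto
  have w: "t \<otimes>\<^bsub>E\<^esub> (u \<otimes>\<^bsub>E\<^esub> \<phi>) \<in> carrier E" using t u \<phi> by simp
  have v_apply: "v x p = t x p \<oplus>\<^bsub>module_at M x\<^esub> (u x p \<oplus>\<^bsub>module_at M x\<^esub> \<ominus>\<^bsub>module_at M x\<^esub> (t x (u x (\<phi> x p))))"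
    if "p \<in> car x" for p
  proof -
    have "(\<ominus>\<^bsub>E\<^esub> (t \<otimes>\<^bsub>E\<^esub> (u \<otimes>\<^bsub>E\<^esub> \<phi>))) x p = (\<zero>\<^bsub>E\<^esub> \<ominus>\<^bsub>E\<^esub> (t \<otimes>\<^bsub>E\<^esub> (u \<otimes>\<^bsub>E\<^esub> \<phi>))) x p"
      using w by (simp add: a_minus_def)
    also have "\<dots> = \<ominus>\<^bsub>module_at M x\<^esub> (t x (u x (\<phi> x p)))"
      using that 3(1) End_minus[OF End.zero_closed w 3(1) that] t u
      by (simp add: End_zero End_mult a_minus_def End_closed[OF t(2)] End_closed[OF u(2)] End_closed[OF \<phi>])
    finally show ?thesis using that 3(1) by (simp add: v_def End_add)
  qed
  note cl = End_closed[OF t(2) 3(1)] End_closed[OF u(2) 3(1)] End_closed[OF \<phi> 3(1)]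
  have "v x (\<phi> x m) = m"
  proof -
    have "t x (u x (\<phi> x (\<phi> x m))) = u x (\<phi> x m)"
    proof -
      have "t x (u x (\<phi> x (\<phi> x m))) = u x (\<phi> x (t x (\<phi> x m)))"
        using bicommutant_apply_commute t u bicommutant_self 3(1) cl by metis
      then show ?thesis using t by simp
    qed
    then show ?thesis using v_apply[of "\<phi> x m"] t cl by (simp add: X.r_neg)
  qed
  moreover have "v x (\<phi> x n) = n"
  proof -
    have "u x (\<phi> x (\<phi> x n)) = \<phi> x n"
    proof -
      have "u x (\<phi> x (\<phi> x n)) = \<phi> x (u x (\<phi> x n))"
        using bicommutant_apply_commute u bicommutant_self 3(1) cl by metis
      then show ?thesis using u by simp
    qed
    then show ?thesis using v_apply[of "\<phi> x n"] u cl by (simp add: X.a_ac X.r_neg X.r_neg1 X.r_neg2)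
  qed
  ultimately have "v x (\<phi> x (m \<oplus>\<^bsub>module_at M x\<^esub> n)) = m \<oplus>\<^bsub>module_at M x\<^esub> n"
    using t u 3(1) cl by (simp add: End_additive[OF \<phi>] End_additive[OF bicommutant_End[OF v]])
  then show ?case using v t u by (auto simp: invertible_part_def)
next
  case (4 x r m)
  obtain t where t: "t \<in> T" "t \<in> carrier E" "m \<in> car x" "t x (\<phi> x m) = m" using 4 by (elim invertible_partD)
  then have "t x (\<phi> x (r \<odot>\<^bsub>module_at M x\<^esub> m)) = r \<odot>\<^bsub>module_at M x\<^esub> m"
    using 4 by (simp add: End_linear[OF \<phi>] End_linear[OF t(2)] End_closed[OF \<phi>])
  then show ?case using 4 t by (auto simp: invertible_part_def smult_closed)
next
  case (5 y x a m)
  obtain t where t: "t \<in> T" "t \<in> carrier E" "m \<in> car x" "t x (\<phi> x m) = m" using 5 by (elim invertible_partD)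
  then have "t y (\<phi> y (act \<SS> M y x a m)) = act \<SS> M y x a m"
    using 5 by (simp add: End_act[OF \<phi>] End_act[OF t(2)] End_closed[OF \<phi>])
  then show ?case using 5 t by (auto simp: invertible_part_def act_closed)
qed

lemma invertible_part_bicommutant:
  assumes "x \<in> C" "u \<in> T" "m \<in> invertible_part x"
  shows "u x m \<in> invertible_part x"
proof -
  obtain t where t: "t \<in> T" "t \<in> carrier E" "m \<in> car x" "t x (\<phi> x m) = m" using assms by (elim invertible_partD)
  have "t x (\<phi> x (u x m)) = u x (t x (\<phi> x m))"
    using bicommutant_apply_commute t assms bicommutant_self End_closed[OF \<phi>] by metis
  then show ?thesis
    using t assms End_closed[OF bicommutant_End[OF assms(2)]] by (auto simp: invertible_part_def)
qed

text \<open>Since t and \<phi> commute, t^n \<phi>^n is the n-th power of t \<phi>, and t \<phi>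
  fixes m. So m can be recovered from \<phi>^n m, and it vanishes when \<phi>^n m does.\<close>

lemma fitting_pow:
  assumes "x \<in> C" "m \<in> car x" "t \<in> T" "t x (\<phi> x m) = m"
  shows "(t [^]\<^bsub>E\<^esub> (n::nat)) x ((\<phi> [^]\<^bsub>E\<^esub> n) x m) = m"
proof -
  have t: "t \<in> carrier E" using assms bicommutant_End by blast
  have "(t \<otimes>\<^bsub>E\<^esub> \<phi>) [^]\<^bsub>E\<^esub> n = t [^]\<^bsub>E\<^esub> n \<otimes>\<^bsub>E\<^esub> \<phi> [^]\<^bsub>E\<^esub> n"
    by (rule End.pow_mult_distrib) (use t \<phi> assms bicommutant_commute bicommutant_self in auto)
  moreover have "((t \<otimes>\<^bsub>E\<^esub> \<phi>) [^]\<^bsub>E\<^esub> n) x m = m"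
    by (induction n) (use assms in \<open>simp_all add: End_one End_mult\<close>)
  ultimately show ?thesis using assms by (simp add: End_mult)
qed

lemma nilpotent_invertible_disjoint:
  assumes "x \<in> C" "m \<in> nilpotent_part x" "m \<in> invertible_part x"
  shows "m = \<zero>\<^bsub>module_at M x\<^esub>"
proof -
  obtain n :: nat where "(\<phi> [^]\<^bsub>E\<^esub> n) x m = \<zero>\<^bsub>module_at M x\<^esub>" using assms by (auto simp: nilpotent_part_def)
  moreover obtain t where "t \<in> T" "t \<in> carrier E" "m \<in> car x" "t x (\<phi> x m) = m" using assms by (elim invertible_partD)
  ultimately show ?thesis
    using fitting_pow[of x m t n] assms End_of_zero[of "t [^]\<^bsub>E\<^esub> n"] by simp
qed

lemma fitting_sum:
  assumes x: "x \<in> C" and m: "m \<in> car x"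
  shows "\<exists>k\<in>nilpotent_part x. \<exists>l\<in>invertible_part x. m = k \<oplus>\<^bsub>module_at M x\<^esub> l"
proof -
  interpret X: abelian_group "module_at M x" by (rule abelian_group) fact
  let ?P = "\<lambda>n::nat. \<phi> [^]\<^bsub>E\<^esub> n"
  \<comment> \<open>The orbit of \<phi>^n m under \<open>T\<close>. It is an
    \<open>S\<close>-submodule because \<open>T\<close> is a ring containing the scalars, and it
    decreases with n because \<open>T\<close> contains \<phi>.\<close>
  define N where "N n = (\<lambda>t. t x (?P n x m)) ` T" for n
  note P_closed = End_closed[OF pow_End x m]
  have NI: "t x (?P n x m) \<in> N n" if "t \<in> T" for t n
    unfolding N_def using that by (rule imageI)
  have NE: thesis if "p \<in> N n" "\<And>t. \<lbrakk>t \<in> T; p = t x (?P n x m)\<rbrakk> \<Longrightarrow> thesis" for p n thesis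
    using that(1) unfolding N_def by (rule imageE) (rule that(2))
  have N: "scalar_closed_subgroup x (N n)" for n
    unfolding scalar_closed_subgroup_def
  proof (intro conjI ballI subsetI, goal_cases)
    case (1 p)
    then show ?case by (rule NE) (simp add: End_closed[OF bicommutant_End x P_closed])
  next
    case 2
    show ?case using NI[OF bicommutant_zero, of n] End_zero[OF x P_closed] by simp
  next
    case (3 p q)
    from 3(1) obtain t where t: "t \<in> T" "p = t x (?P n x m)" by (rule NE)
    from 3(2) obtain u where u: "u \<in> T" "q = u x (?P n x m)" by (rule NE)
    show ?case
      using NI[OF bicommutant_add[OF t(1) u(1)], of n] unfolding t(2) u(2) End_add[OF x P_closed] .
  next
    case (4 s p)
    from 4(2) obtain t where t: "t \<in> T" "p = t x (?P n x m)" by (rule NE)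
    show ?case
      using NI[OF bicommutant_mult[OF bicommutant_scalar[OF 4(1)] t(1)], of n]
      unfolding t(2) End_mult[OF x P_closed] .
  qed
  have dec: "N (Suc n) \<subseteq> N n" for n
  proof
    fix p assume "p \<in> N (Suc n)"
    then obtain t where t: "t \<in> T" "p = t x (\<phi> x (?P n x m))"
      unfolding pow_Suc_apply[OF x m, symmetric] by (rule NE)
    show "p \<in> N n"
      using NI[OF bicommutant_mult[OF t(1) bicommutant_self], of n] unfolding t(2) End_mult[OF x P_closed] .
  qed
  obtain k where k: "\<forall>n\<ge>k. N n = N k" using dcc[of x N, OF x N dec] ..
  define p where "p = ?P k x m"
  have p: "p \<in> car x" unfolding p_def by (rule P_closed)
  \<comment> \<open>At the stable index k the element p = \<phi>^k m also lies in the next orbit, so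
    it is fixed by t \<phi> for some t in \<open>T\<close>.\<close>
  have "p \<in> N k"
    using NI[OF bicommutant_one, of k] unfolding End_one[OF x P_closed] p_def .
  then have "p \<in> N (Suc k)" using k le_SucI[OF order_refl] by blast
  then obtain t where t: "t \<in> T" and tp': "p = t x (?P (Suc k) x m)" by (rule NE)
  have tp: "t x (\<phi> x p) = p" using tp'[symmetric] unfolding pow_Suc_apply[OF x m] p_def[symmetric] .
  note tk = bicommutant_pow[OF t, of k] bicommutant_pow[OF bicommutant_self, of k]
  \<comment> \<open>\<open>l\<close> undoes the k applications of \<phi>: both \<phi>^k l and
    \<phi>^k m are p, so \<phi>^k kills m - l. It lies in the invertible part because
    \<open>p\<close> does and that part is stable under \<open>T\<close>.\<close>
  define l where "l = (t [^]\<^bsub>E\<^esub> k) x p"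
  have "p \<in> invertible_part x" unfolding invertible_part_def using p t tp by blast
  from invertible_part_bicommutant[OF x tk(1) this] have l: "l \<in> invertible_part x" unfolding l_def .
  then have lc: "l \<in> car x" by (simp add: invertible_part_def)
  have "?P k x l = p"
    using fitting_pow[OF x p t tp] bicommutant_apply_commute[OF tk x p] by (simp add: l_def)
  then have "?P k x (m \<ominus>\<^bsub>module_at M x\<^esub> l) = \<zero>\<^bsub>module_at M x\<^esub>"
  proof -
    have "?P k x (m \<ominus>\<^bsub>module_at M x\<^esub> l) \<oplus>\<^bsub>module_at M x\<^esub> ?P k x l = ?P k x m"
      using End_additive[OF pow_End x, of "m \<ominus>\<^bsub>module_at M x\<^esub> l" l] m lc
      by (simp add: a_minus_def X.a_assoc X.l_neg)
    then show ?thesis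
      using \<open>?P k x l = p\<close> End_closed[OF pow_End x, of "m \<ominus>\<^bsub>module_at M x\<^esub> l" k] m lc p
      by (simp add: p_def[symmetric])
  qed
  then have "m \<ominus>\<^bsub>module_at M x\<^esub> l \<in> nilpotent_part x" using m lc by (auto simp: nilpotent_part_def)
  moreover have "m = (m \<ominus>\<^bsub>module_at M x\<^esub> l) \<oplus>\<^bsub>module_at M x\<^esub> l"
    using m lc by (simp add: a_minus_def X.a_assoc X.l_neg)
  ultimately show ?thesis using l by blast
qed

text \<open>Each element brings its own t, which commutes with \<phi> and so gives both halves: t
  (\<phi> d) = d for a difference d yields injectivity, and \<phi> (t m) = m yields surjectivity.
  The inverse morphism comes from bijectivity at all vertices and not from gluing the various
  t.\<close>

lemma invertible_imp_Unit:
  assumes "\<And>x m. \<lbrakk>x \<in> C; m \<in> car x\<rbrakk> \<Longrightarrow> m \<in> invertible_part x"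
  shows "\<phi> \<in> Units E"
proof (rule End_Units[OF \<phi>])
  fix x assume x: "x \<in> C"
  interpret X: abelian_group "module_at M x" by (rule abelian_group) fact
  have "m = n" if mn: "m \<in> car x" "n \<in> car x" "\<phi> x m = \<phi> x n" for m n
  proof -
    let ?d = "m \<ominus>\<^bsub>module_at M x\<^esub> n"
    have d: "?d \<in> car x" using mn by simp
    have "\<phi> x ?d \<oplus>\<^bsub>module_at M x\<^esub> \<phi> x n = \<phi> x n"
      using End_additive[OF \<phi> x d mn(2)] mn by (simp add: a_minus_def X.a_assoc X.l_neg)
    then have "\<phi> x ?d = \<zero>\<^bsub>module_at M x\<^esub>"
      using End_closed[OF \<phi> x d] End_closed[OF \<phi> x mn(2)] by simp
    moreover obtain t where "t \<in> T" "t \<in> carrier E" "t x (\<phi> x ?d) = ?d"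
      using assms[OF x d] by (elim invertible_partD)
    ultimately have "?d = \<zero>\<^bsub>module_at M x\<^esub>" using End_of_zero x by metis
    then show ?thesis using mn by (simp add: X.minus_eq_zero_iff)
  qed
  moreover have "m \<in> \<phi> x ` car x" if m: "m \<in> car x" for m
  proof -
    obtain t where t: "t \<in> T" "t \<in> carrier E" "t x (\<phi> x m) = m"
      using assms[OF x m] by (elim invertible_partD)
    have "\<phi> x (t x m) = m" using bicommutant_apply_commute[OF t(1) bicommutant_self x m] t by simp
    then show ?thesis using End_closed[OF t(2) x m] by (metis imageI)
  qed
  ultimately show "bij_betw (\<phi> x) (car x) (car x)"
    using End_closed[OF \<phi> x] by (auto simp: bij_betw_def inj_on_def)
qed

text \<open>Behind this is the geometric series 1 + \<phi> + \<phi>^2 + ..., finite on every element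
  but of unbounded length; hence the passage through bijectivity. A fixed point of \<phi> is fixed
  by all its powers and so vanishes, and surjectivity is by induction on the exponent that kills
  m.\<close>

lemma nilpotent_imp_Unit:
  assumes nil: "\<And>x m. \<lbrakk>x \<in> C; m \<in> car x\<rbrakk> \<Longrightarrow> m \<in> nilpotent_part x"
  shows "\<one>\<^bsub>E\<^esub> \<ominus>\<^bsub>E\<^esub> \<phi> \<in> Units E"
proof (rule End_Units)
  show \<psi>: "\<one>\<^bsub>E\<^esub> \<ominus>\<^bsub>E\<^esub> \<phi> \<in> carrier E" using \<phi> by simp
  fix x assume x: "x \<in> C"
  interpret X: abelian_group "module_at M x" by (rule abelian_group) fact
  define \<psi> where "\<psi> = (\<one>\<^bsub>E\<^esub> \<ominus>\<^bsub>E\<^esub> \<phi>) x"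
  have app: "\<psi> m = m \<ominus>\<^bsub>module_at M x\<^esub> \<phi> x m" if "m \<in> car x" for m
    using that x \<phi> by (simp add: \<psi>_def End_minus End_one)
  have add: "\<psi> (m \<oplus>\<^bsub>module_at M x\<^esub> n) = \<psi> m \<oplus>\<^bsub>module_at M x\<^esub> \<psi> n" if "m \<in> car x" "n \<in> car x" for m n
    unfolding \<psi>_def by (rule End_additive[OF \<psi> x that])
  have cl: "\<psi> m \<in> car x" if "m \<in> car x" for m
    unfolding \<psi>_def by (rule End_closed[OF \<psi> x that])
  have ker: "m = \<zero>\<^bsub>module_at M x\<^esub>" if m: "m \<in> car x" "\<psi> m = \<zero>\<^bsub>module_at M x\<^esub>" for m
  proof -
    have "\<phi> x m = m" using app[OF m(1)] m End_closed[OF \<phi> x m(1)] X.minus_eq_zero_iff[of m "\<phi> x m"] by simp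
    then have "(\<phi> [^]\<^bsub>E\<^esub> n) x m = m" for n :: nat
      by (induction n) (use x m in \<open>simp_all add: End_one End_mult\<close>)
    then show ?thesis using nil[OF x m(1)] by (simp add: nilpotent_part_def)
  qed
  have "m = n" if mn: "m \<in> car x" "n \<in> car x" "\<psi> m = \<psi> n" for m n
  proof -
    let ?d = "m \<ominus>\<^bsub>module_at M x\<^esub> n"
    have d: "?d \<in> car x" using mn by simp
    have "\<psi> ?d \<oplus>\<^bsub>module_at M x\<^esub> \<psi> n = \<psi> n"
      using add[OF d mn(2)] mn by (simp add: a_minus_def X.a_assoc X.l_neg)
    then have "?d = \<zero>\<^bsub>module_at M x\<^esub>" using cl[OF d] cl[OF mn(2)] ker[OF d] by simp
    then show ?thesis using mn by (simp add: X.minus_eq_zero_iff)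
  qed
  then have "inj_on \<psi> (car x)" by (rule inj_onI)
  moreover have surj: "m \<in> \<psi> ` car x" if "m \<in> car x" "(\<phi> [^]\<^bsub>E\<^esub> n) x m = \<zero>\<^bsub>module_at M x\<^esub>" for m and n :: nat
    using that
  proof (induction n arbitrary: m)
    case 0
    then have "m = \<zero>\<^bsub>module_at M x\<^esub>" using x by (simp add: End_one)
    moreover have "\<psi> \<zero>\<^bsub>module_at M x\<^esub> = \<zero>\<^bsub>module_at M x\<^esub>" unfolding \<psi>_def by (rule End_of_zero[OF \<psi> x])
    ultimately show ?case by (metis X.zero_closed imageI)
  next
    case (Suc n)
    have fm: "\<phi> x m \<in> car x" using Suc.prems End_closed[OF \<phi> x] by blast
    moreover have "(\<phi> [^]\<^bsub>E\<^esub> n) x (\<phi> x m) = \<zero>\<^bsub>module_at M x\<^esub>" using Suc.prems x by (simp add: End_mult)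
    ultimately obtain p where p: "p \<in> car x" "\<phi> x m = \<psi> p" using Suc.IH by blast
    \<comment> \<open>One step of the series: if \<phi> m = \<psi> p, then \<psi> (m + p) = m -
      \<phi> m + \<psi> p = m.\<close>
    have "\<psi> (m \<oplus>\<^bsub>module_at M x\<^esub> p) = m"
      using add[OF Suc.prems(1) p(1)] app[OF Suc.prems(1)] p(2)[symmetric] Suc.prems(1) fm
      by (simp add: a_minus_def X.a_assoc X.l_neg)
    then show ?case using Suc.prems(1) p(1) by (metis X.a_closed imageI)
  qed
  moreover have "\<psi> ` car x = car x"
  proof (intro equalityI subsetI)
    fix m assume m: "m \<in> car x"
    then obtain n :: nat where "(\<phi> [^]\<^bsub>E\<^esub> n) x m = \<zero>\<^bsub>module_at M x\<^esub>"
      using nil[OF x] by (auto simp: nilpotent_part_def)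
    with m show "m \<in> \<psi> ` car x" by (rule surj)
  qed (use cl in auto)
  ultimately show "bij_betw ((\<one>\<^bsub>E\<^esub> \<ominus>\<^bsub>E\<^esub> \<phi>) x) (car x) (car x)"
    by (simp add: bij_betw_def \<psi>_def)
qed

end

theorem local_ring_End:
  assumes nontrivial: "\<one>\<^bsub>E\<^esub> \<noteq> \<zero>\<^bsub>E\<^esub>"
    and idem: "\<And>e. \<lbrakk>e \<in> carrier E; e \<otimes>\<^bsub>E\<^esub> e = e\<rbrakk> \<Longrightarrow> e = \<zero>\<^bsub>E\<^esub> \<or> e = \<one>\<^bsub>E\<^esub>"
  shows "local_ring E"
proof (rule End.unit_or_complement_unit_local[OF nontrivial])
  fix \<phi> assume \<phi>: "\<phi> \<in> carrier E"
  let ?K = "nilpotent_part \<phi>" and ?L = "invertible_part \<phi>"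
  note K = subrep_nilpotent_part[OF \<phi>] and L = subrep_invertible_part[OF \<phi>]
  obtain e where e: "e \<in> carrier E" "e \<otimes>\<^bsub>E\<^esub> e = e"
    and split: "\<And>x k l. \<lbrakk>x \<in> C; k \<in> ?K x; l \<in> ?L x\<rbrakk> \<Longrightarrow> e x (k \<oplus>\<^bsub>module_at M x\<^esub> l) = k"
    using complement_idempotent[OF K L nilpotent_invertible_disjoint[OF \<phi>] fitting_sum[OF \<phi>]] by blast
  from idem[OF e] show "\<phi> \<in> Units E \<or> \<one>\<^bsub>E\<^esub> \<ominus>\<^bsub>E\<^esub> \<phi> \<in> Units E"
  proof
    assume e0: "e = \<zero>\<^bsub>E\<^esub>"
    have "m \<in> ?L x" if x: "x \<in> C" "m \<in> car x" for x m
    proof -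
      obtain k l where kl: "k \<in> ?K x" "l \<in> ?L x" "m = k \<oplus>\<^bsub>module_at M x\<^esub> l"
        using fitting_sum[OF \<phi> x] by blast
      then have "k = \<zero>\<^bsub>module_at M x\<^esub>" using split[OF x(1) kl(1,2)] x e0 by (simp add: End_zero)
      then show ?thesis using kl x abelian_monoid.l_zero[OF abelian_monoid] L by (auto simp: subrep_def)
    qed
    then show ?thesis using invertible_imp_Unit[OF \<phi>] by blast
  next
    assume e1: "e = \<one>\<^bsub>E\<^esub>"
    have "m \<in> ?K x" if x: "x \<in> C" "m \<in> car x" for x m
    proof -
      obtain k l where kl: "k \<in> ?K x" "l \<in> ?L x" "m = k \<oplus>\<^bsub>module_at M x\<^esub> l"
        using fitting_sum[OF \<phi> x] by blast
      then show ?thesis using split[OF x(1) kl(1,2)] x e1 by (simp add: End_one)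
    qed
    then show ?thesis using nilpotent_imp_Unit[OF \<phi>] by blast
  qed
qed

end

section \<open>Maximal sets of commuting idempotents\<close>

lemma left_module_restrict_scalars:
  assumes "left_module R M" "ring S" "\<iota> \<in> ring_hom S R"
  shows "left_module S (restrict_scalars \<iota> M)"
proof -
  interpret left_module R M by fact
  interpret S: ring S by fact
  have "abelian_group (restrict_scalars \<iota> M)"
    by (rule abelian_groupI)
      (auto simp: restrict_scalars_def M.a_ac M.r_neg intro!: bexI[of _ "\<ominus>\<^bsub>M\<^esub> _"])
  then show ?thesis
    using assms(3)
    by (intro left_module.intro left_module_axioms.intro S.ring_axioms)
      (auto simp: restrict_scalars_def ring_hom_def smult_closed smult_l_distr smult_r_distr smult_assoc smult_one Pi_iff)
qed

text \<open>Zorn's lemma applies because commutativity concerns two elements at a time, and these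
  lie in a common member of a chain. Maximality is phrased as a membership test, the form in which
  new idempotents are shown to be in \<open>B\<close>.\<close>

lemma (in ring) maximal_commuting_idempotents:
  shows "\<exists>B\<subseteq>carrier R. (\<forall>e\<in>B. e \<otimes> e = e) \<and> (\<forall>e\<in>B. \<forall>f\<in>B. e \<otimes> f = f \<otimes> e) \<and>
    (\<forall>p\<in>carrier R. p \<otimes> p = p \<longrightarrow> (\<forall>f\<in>B. p \<otimes> f = f \<otimes> p) \<longrightarrow> p \<in> B)"
proof -
  define \<A> where "\<A> = {B. B \<subseteq> carrier R \<and> (\<forall>e\<in>B. e \<otimes> e = e) \<and> (\<forall>e\<in>B. \<forall>f\<in>B. e \<otimes> f = f \<otimes> e)}"
  have "\<exists>B\<in>\<A>. \<forall>B'\<in>\<A>. B \<subseteq> B' \<longrightarrow> B' = B"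
  proof (rule subset_Zorn', goal_cases)
    case (1 \<C>)
    then have sub: "\<C> \<subseteq> \<A>" and chain: "\<And>A B. \<lbrakk>A \<in> \<C>; B \<in> \<C>\<rbrakk> \<Longrightarrow> A \<subseteq> B \<or> B \<subseteq> A"
      by (auto simp: subset_chain_def)
    have "e \<otimes> f = f \<otimes> e" if ef: "e \<in> \<Union>\<C>" "f \<in> \<Union>\<C>" for e f
    proof -
      obtain D where "D \<in> \<C>" "e \<in> D" "f \<in> D" using chain ef by blast
      then show ?thesis using sub by (auto simp: \<A>_def)
    qed
    moreover have "e \<in> carrier R \<and> e \<otimes> e = e" if "e \<in> \<Union>\<C>" for e
      using that sub by (auto simp: \<A>_def)
    ultimately show ?case unfolding \<A>_def by blast
  qed
  then obtain B where B: "B \<in> \<A>" and max: "\<And>B'. \<lbrakk>B' \<in> \<A>; B \<subseteq> B'\<rbrakk> \<Longrightarrow> B' = B" by blast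
  show ?thesis
  proof (intro exI[of _ B] conjI ballI impI)
    show "B \<subseteq> carrier R" using B by (simp add: \<A>_def)
  next
    fix e assume "e \<in> B"
    then show "e \<otimes> e = e" using B by (simp add: \<A>_def)
  next
    fix e f assume "e \<in> B" "f \<in> B"
    then show "e \<otimes> f = f \<otimes> e" using B unfolding \<A>_def by blast
  next
    fix p assume p: "p \<in> carrier R" "p \<otimes> p = p" "\<forall>f\<in>B. p \<otimes> f = f \<otimes> p"
    have "B \<subseteq> carrier R" and idem: "\<forall>e\<in>B. e \<otimes> e = e" and comm: "\<forall>e\<in>B. \<forall>f\<in>B. e \<otimes> f = f \<otimes> e"
      using B unfolding \<A>_def by blast+
    have "e \<otimes> f = f \<otimes> e" if "e \<in> insert p B" "f \<in> insert p B" for e f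
      using that p(3) comm by (metis insertE)
    moreover have "\<forall>e\<in>insert p B. e \<otimes> e = e" using p(2) idem by blast
    ultimately have "insert p B \<in> \<A>"
      using p(1) \<open>B \<subseteq> carrier R\<close> unfolding \<A>_def by blast
    then show "p \<in> B" using max[of "insert p B"] by blast
  qed
qed

section \<open>Inheritance of the chain condition by images and subrepresentations\<close>

context artinian_representation
begin

lemma scalar_closed_subgroup_subrep:
  assumes U: "subrep U" and x: "x \<in> C"
  shows "scalar_closed_subgroup x (U x)"
  using U x scalar_closed[OF x] by (auto simp: subrep_def scalar_closed_subgroup_def scalar_apply subset_iff)

lemma scalar_closed_subgroup_image:
  assumes f: "f \<in> carrier E" and x: "x \<in> C"
  shows "scalar_closed_subgroup x (f x ` car x)"
  using scalar_closed_subgroup_subrep[OF subrep_image[OF f] x] .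

text \<open>An \<open>S\<close>-submodule of \<open>U x\<close> is also one of the ambient module,
  so chains in a summand are chains in \<open>M\<close>. The locality criterion can thus be applied
  to a summand with the same \<open>S\<close>.\<close>

lemma artinian_sub_rep:
  assumes U: "subrep U"
  shows "artinian_representation \<SS> (sub_rep \<SS> M U) S \<iota>"
proof (intro artinian_representation.intro representation_sub_rep U artinian_representation_axioms.intro
    subring acts_centrally)
  fix x assume x: "x \<in> C"
  have S: "ring S" and \<iota>: "\<iota> x \<in> ring_hom S (R x)"
    using subring x by (auto simp: common_central_subring_def)
  let ?U = "restrict_scalars (\<iota> x) (module_at (sub_rep \<SS> M U) x)"
  have sub: "scalar_closed_subgroup x N" if "submodule N S ?U" for N
  proof -
    interpret submodule N S ?U by fact
    have "N \<subseteq> U x" using subset by (simp add: restrict_scalars_def module_at_sub_rep)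
    moreover have "U x \<subseteq> car x" using U x by (simp add: subrep_def)
    ultimately have "N \<subseteq> car x" by blast
    then show ?thesis
      using one_closed m_closed smult_closed x
      by (auto simp: scalar_closed_subgroup_def scalar_apply restrict_scalars_def module_at_sub_rep subset_iff)
  qed
  show "artinian_module S ?U"
    unfolding artinian_module_def
  proof (intro conjI allI impI)
    show "left_module S ?U"
      by (rule left_module_restrict_scalars[OF sub_rep_left_module[OF U x] S \<iota>])
    fix N assume "(\<forall>n. submodule (N n) S ?U) \<and> (\<forall>n. N (Suc n) \<subseteq> N n)"
    then show "\<exists>k. \<forall>n\<ge>k. N n = N k" using dcc[OF x, of N] sub by blast
  qed
qed

section \<open>The Boolean algebra of a maximal commuting family and its atoms\<close>

context
  fixes B
  assumes B_End: "B \<subseteq> carrier E"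
    and B_idem: "\<And>e. e \<in> B \<Longrightarrow> e \<otimes>\<^bsub>E\<^esub> e = e"
    and B_comm: "\<And>e f. \<lbrakk>e \<in> B; f \<in> B\<rbrakk> \<Longrightarrow> e \<otimes>\<^bsub>E\<^esub> f = f \<otimes>\<^bsub>E\<^esub> e"
    and B_max: "\<And>p. \<lbrakk>p \<in> carrier E; p \<otimes>\<^bsub>E\<^esub> p = p; \<And>f. f \<in> B \<Longrightarrow> p \<otimes>\<^bsub>E\<^esub> f = f \<otimes>\<^bsub>E\<^esub> p\<rbrakk> \<Longrightarrow> p \<in> B"
begin

lemma B_carrier: "e \<in> B \<Longrightarrow> e \<in> carrier E"
  using B_End by blast

lemma B_closed: "\<lbrakk>e \<in> B; x \<in> C; m \<in> car x\<rbrakk> \<Longrightarrow> e x m \<in> car x"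
  by (rule End_closed[OF B_carrier])

lemma B_one: "\<one>\<^bsub>E\<^esub> \<in> B"
  using B_carrier by (intro B_max) auto

text \<open>For commuting idempotents the product is the meet and \<open>1 - e\<close> the
  complement, so \<open>B\<close> is a Boolean algebra. Every closure property is an instance of the
  membership test \<open>B_max\<close>.\<close>

lemma B_mult:
  assumes "e \<in> B" "f \<in> B"
  shows "e \<otimes>\<^bsub>E\<^esub> f \<in> B"
proof (rule B_max)
  note cl = B_carrier[OF assms(1)] B_carrier[OF assms(2)]
  show "e \<otimes>\<^bsub>E\<^esub> f \<in> carrier E" using cl by simp
  have "e \<otimes>\<^bsub>E\<^esub> f \<otimes>\<^bsub>E\<^esub> (e \<otimes>\<^bsub>E\<^esub> f) = e \<otimes>\<^bsub>E\<^esub> (f \<otimes>\<^bsub>E\<^esub> e) \<otimes>\<^bsub>E\<^esub> f"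
    using cl by (simp add: End.m_assoc)
  also have "\<dots> = (e \<otimes>\<^bsub>E\<^esub> e) \<otimes>\<^bsub>E\<^esub> (f \<otimes>\<^bsub>E\<^esub> f)"
    unfolding B_comm[OF assms(2,1)] using cl by (simp add: End.m_assoc)
  finally show "e \<otimes>\<^bsub>E\<^esub> f \<otimes>\<^bsub>E\<^esub> (e \<otimes>\<^bsub>E\<^esub> f) = e \<otimes>\<^bsub>E\<^esub> f" using assms by (simp add: B_idem)
  fix g assume g: "g \<in> B"
  show "e \<otimes>\<^bsub>E\<^esub> f \<otimes>\<^bsub>E\<^esub> g = g \<otimes>\<^bsub>E\<^esub> (e \<otimes>\<^bsub>E\<^esub> f)"
    using cl B_carrier[OF g] B_comm[OF g assms(1)] B_comm[OF assms(2) g] by (metis End.m_assoc)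
qed

lemma B_complement:
  assumes "e \<in> B"
  shows "\<one>\<^bsub>E\<^esub> \<ominus>\<^bsub>E\<^esub> e \<in> B"
proof (rule B_max)
  note cl = B_carrier[OF assms]
  show "\<one>\<^bsub>E\<^esub> \<ominus>\<^bsub>E\<^esub> e \<in> carrier E" using cl by simp
  have "e \<otimes>\<^bsub>E\<^esub> (\<one>\<^bsub>E\<^esub> \<ominus>\<^bsub>E\<^esub> e) = \<zero>\<^bsub>E\<^esub>"
    using cl assms by (simp add: a_minus_def End.r_distr End.r_minus B_idem End.r_neg)
  then show "(\<one>\<^bsub>E\<^esub> \<ominus>\<^bsub>E\<^esub> e) \<otimes>\<^bsub>E\<^esub> (\<one>\<^bsub>E\<^esub> \<ominus>\<^bsub>E\<^esub> e) = \<one>\<^bsub>E\<^esub> \<ominus>\<^bsub>E\<^esub> e"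
    using cl by (simp add: a_minus_def End.l_distr End.l_minus)
  fix f assume f: "f \<in> B"
  show "(\<one>\<^bsub>E\<^esub> \<ominus>\<^bsub>E\<^esub> e) \<otimes>\<^bsub>E\<^esub> f = f \<otimes>\<^bsub>E\<^esub> (\<one>\<^bsub>E\<^esub> \<ominus>\<^bsub>E\<^esub> e)"
    using cl B_carrier[OF f] B_comm[OF assms f]
    by (simp add: a_minus_def End.l_distr End.r_distr End.l_minus End.r_minus)
qed

lemma B_idem_apply: "\<lbrakk>e \<in> B; x \<in> C; m \<in> car x\<rbrakk> \<Longrightarrow> e x (e x m) = e x m"
  using B_idem[of e] End_mult[of x m e e] by simp

lemma B_comm_apply: "\<lbrakk>e \<in> B; f \<in> B; x \<in> C; m \<in> car x\<rbrakk> \<Longrightarrow> e x (f x m) = f x (e x m)"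
  using B_comm[of e f] End_mult[of x m] by metis

lemma B_complement_apply:
  assumes "e \<in> B" "x \<in> C" "m \<in> car x"
  shows "(\<one>\<^bsub>E\<^esub> \<ominus>\<^bsub>E\<^esub> e) x m = m \<ominus>\<^bsub>module_at M x\<^esub> e x m"
  using assms B_carrier by (simp add: End_minus End_one)

lemma B_complement_fixed_iff:
  assumes "e \<in> B" "x \<in> C" "m \<in> car x"
  shows "(\<one>\<^bsub>E\<^esub> \<ominus>\<^bsub>E\<^esub> e) x m = m \<longleftrightarrow> e x m = \<zero>\<^bsub>module_at M x\<^esub>"
proof -
  interpret X: abelian_group "module_at M x" by (rule abelian_group) fact
  note cl = B_closed[OF assms]
  show ?thesis
  proof
    assume "(\<one>\<^bsub>E\<^esub> \<ominus>\<^bsub>E\<^esub> e) x m = m"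
    then have "m \<ominus>\<^bsub>module_at M x\<^esub> e x m \<oplus>\<^bsub>module_at M x\<^esub> e x m = m \<oplus>\<^bsub>module_at M x\<^esub> e x m"
      using assms by (simp add: B_complement_apply)
    then have "m \<oplus>\<^bsub>module_at M x\<^esub> e x m = m \<oplus>\<^bsub>module_at M x\<^esub> \<zero>\<^bsub>module_at M x\<^esub>"
      using cl assms(3) by (simp add: a_minus_def X.a_assoc X.l_neg)
    then show "e x m = \<zero>\<^bsub>module_at M x\<^esub>" using cl assms(3) by (metis X.add.l_cancel X.zero_closed)
  next
    assume "e x m = \<zero>\<^bsub>module_at M x\<^esub>"
    then show "(\<one>\<^bsub>E\<^esub> \<ominus>\<^bsub>E\<^esub> e) x m = m"
      using B_complement_apply[OF assms] assms(3) by (simp add: a_minus_def)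
  qed
qed

text \<open>The atoms of the Boolean algebra \<open>B\<close>. The product of \<open>f\<close> and
  \<open>a\<close> is their meet, and in place of an order the condition lists the two meets
  possible with a minimal nonzero element.\<close>

definition atom :: "('c \<Rightarrow> 'm \<Rightarrow> 'm) \<Rightarrow> bool"
  where "atom a \<longleftrightarrow> a \<in> B \<and> a \<noteq> \<zero>\<^bsub>E\<^esub> \<and> (\<forall>f\<in>B. f \<otimes>\<^bsub>E\<^esub> a = \<zero>\<^bsub>E\<^esub> \<or> f \<otimes>\<^bsub>E\<^esub> a = a)"

lemma atom_B: "atom a \<Longrightarrow> a \<in> B"
  by (simp add: atom_def)

text \<open>The product is a meet with either atom; were it nonzero, it would equal both of
  them.\<close>

lemma atom_orthogonal:
  assumes "atom a" "atom b" "a \<noteq> b"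
  shows "a \<otimes>\<^bsub>E\<^esub> b = \<zero>\<^bsub>E\<^esub>"
  using assms B_comm[of a b] unfolding atom_def by metis

lemma atom_orthogonal_apply:
  assumes "atom a" "atom b" "a \<noteq> b" "x \<in> C" "m \<in> car x"
  shows "a x (b x m) = \<zero>\<^bsub>module_at M x\<^esub>"
  using atom_orthogonal[OF assms(1-3)] End_mult[OF assms(4,5), of a b] End_zero[OF assms(4,5)] by simp

text \<open>Different vertices may use different idempotents \<open>G y\<close>, and in general such
  a diagonal family is no endomorphism. The hypothesis \<open>glue\<close> says that
  \<open>G z\<close> fixes the image of \<open>G y\<close> at y; for each pair of vertices it allows
  both values to be computed by one genuine endomorphism. Commutation with \<open>B\<close> is a
  condition at each vertex separately, and there the glued map agrees with a member of
  \<open>B\<close>.\<close>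

lemma glue_in_B:
  assumes G: "\<And>y. y \<in> C \<Longrightarrow> G y \<in> B"
    and glue: "\<And>y z m. \<lbrakk>y \<in> C; z \<in> C; m \<in> car y\<rbrakk> \<Longrightarrow> G z y (G y y m) = G y y m"
  shows "endo (\<lambda>y. G y y) \<in> B"
proof (rule B_max)
  show p: "endo (\<lambda>y. G y y) \<in> carrier E"
  proof (rule endo_in_End)
    fix y x a m assume C: "y \<in> C" "x \<in> C" and am: "a \<in> arr y x" "m \<in> car x"
    \<comment> \<open>By \<open>glue\<close> and commutativity this product acts at y as
      \<open>G y\<close> and at x as \<open>G x\<close>.\<close>
    let ?g = "G y \<otimes>\<^bsub>E\<^esub> G x"
    have g: "?g \<in> carrier E" using B_mult G C B_carrier by blast
    have am': "act \<SS> M y x a m \<in> car y" using C am by (simp add: act_closed)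
    have "G y y (act \<SS> M y x a m) = ?g y (act \<SS> M y x a m)"
      using glue[OF C am'] B_comm_apply[OF G[OF C(1)] G[OF C(2)] C(1) am'] End_mult[OF C(1) am'] by metis
    also have "\<dots> = act \<SS> M y x a (?g x m)" by (rule End_act[OF g C am])
    also have "?g x m = G x x m" using glue[OF C(2,1) am(2)] End_mult[OF C(2) am(2)] by metis
    finally show "G y y (act \<SS> M y x a m) = act \<SS> M y x a (G x x m)" .
  qed (use End_hom[OF B_carrier[OF G]] in auto)
  show "endo (\<lambda>y. G y y) \<otimes>\<^bsub>E\<^esub> endo (\<lambda>y. G y y) = endo (\<lambda>y. G y y)"
    by (intro End_eqI End_mult_closed p) (simp add: End_mult B_closed[OF G] glue)
  fix f assume f: "f \<in> B"
  show "endo (\<lambda>y. G y y) \<otimes>\<^bsub>E\<^esub> f = f \<otimes>\<^bsub>E\<^esub> endo (\<lambda>y. G y y)"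
    by (intro End_eqI End_mult_closed p B_carrier f)
      (simp add: End_mult B_closed[OF f] B_closed[OF G] B_comm_apply[OF G f])
qed

text \<open>Let \<open>f\<close> be an idempotent below \<open>e\<close> whose image at \<open>x\<close> is nonzero and minimal. The atom is
  the infimum \<open>p\<close> of the filter of all \<open>g\<close> in \<open>B\<close> fixing that image: at each vertex \<open>y\<close> the descending
  chain condition makes it agree with some member \<open>G y\<close> of the filter, and it lies in \<open>B\<close> by
  maximality.\<close>

lemma atom_below:
  assumes e: "e \<in> B" and x: "x \<in> C" and m0: "m0 \<in> car x" "e x m0 \<noteq> \<zero>\<^bsub>module_at M x\<^esub>"
  obtains a m where "atom a" "e \<otimes>\<^bsub>E\<^esub> a = a" "m \<in> car x" "a x m \<noteq> \<zero>\<^bsub>module_at M x\<^esub>"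
proof -
  let ?z = "\<zero>\<^bsub>module_at M x\<^esub>"
  \<comment> \<open>Images at x of the members of \<open>B\<close> below \<open>e\<close> that do
    not vanish there. Minimality is sought among images at this vertex, since that is what the chain
    condition provides.\<close>
  define \<F> where "\<F> = (\<lambda>f. f x ` car x) ` {f \<in> B. e \<otimes>\<^bsub>E\<^esub> f = f \<and> (\<exists>m\<in>car x. f x m \<noteq> ?z)}"
  have "e x ` car x \<in> \<F>"
    unfolding \<F>_def by (rule imageI) (use e m0 B_idem[OF e] in blast)
  moreover have "scalar_closed_subgroup x N" if "N \<in> \<F>" for N
    using that B_carrier scalar_closed_subgroup_image[OF _ x] by (auto simp: \<F>_def)
  ultimately have "\<exists>N\<in>\<F>. \<forall>N'\<in>\<F>. N' \<subseteq> N \<longrightarrow> N' = N"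
    by (rule dcc_minimal[OF x])
  then obtain N where N: "N \<in> \<F>" and N_min: "\<And>N'. \<lbrakk>N' \<in> \<F>; N' \<subseteq> N\<rbrakk> \<Longrightarrow> N' = N"
    by blast
  from N obtain f m1 where f: "f \<in> B" "e \<otimes>\<^bsub>E\<^esub> f = f" and Nf: "N = f x ` car x"
    and m1: "m1 \<in> car x" "f x m1 \<noteq> ?z"
    unfolding \<F>_def by blast
  define F where "F = {g \<in> B. \<forall>m\<in>car x. g x (f x m) = f x m}"
  have F_B: "g \<in> B" if "g \<in> F" for g using that by (simp add: F_def)
  have F_mult: "g \<otimes>\<^bsub>E\<^esub> h \<in> F" if "g \<in> F" "h \<in> F" for g h
    using that B_mult B_closed[OF f(1) x] x by (auto simp: F_def End_mult)
  \<comment> \<open>This makes the filter nonempty, and it also puts the infimum \<open>p\<close>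
    below \<open>e\<close> at the end.\<close>
  have eF: "e \<in> F"
  proof -
    have "e x (f x m) = f x m" if "m \<in> car x" for m
      using End_mult[OF x that, of e f] unfolding f(2) by (rule sym)
    then show ?thesis using e by (simp add: F_def)
  qed
  have "\<exists>g\<in>F. \<forall>h\<in>F. h y ` car y \<subseteq> g y ` car y \<longrightarrow> h y ` car y = g y ` car y" if y: "y \<in> C" for y
  proof -
    have "e y ` car y \<in> (\<lambda>g. g y ` car y) ` F" using eF by blast
    moreover have "scalar_closed_subgroup y N" if "N \<in> (\<lambda>g. g y ` car y) ` F" for N
      using that F_B B_carrier scalar_closed_subgroup_image[OF _ y] by auto
    ultimately have "\<exists>N\<in>(\<lambda>g. g y ` car y) ` F. \<forall>N'\<in>(\<lambda>g. g y ` car y) ` F. N' \<subseteq> N \<longrightarrow> N' = N"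
      by (rule dcc_minimal[OF y])
    then show ?thesis by simp
  qed
  then obtain G where G: "\<And>y. y \<in> C \<Longrightarrow> G y \<in> F"
    and G_min: "\<And>y h. \<lbrakk>y \<in> C; h \<in> F; h y ` car y \<subseteq> G y y ` car y\<rbrakk> \<Longrightarrow> h y ` car y = G y y ` car y"
    by metis
  note GB = F_B[OF G]
  \<comment> \<open>By minimality of the image of \<open>G y\<close> at y: the product of
    \<open>h\<close> and \<open>G y\<close> is in \<open>F\<close> with an image no larger, hence
    with the same image, and the idempotent \<open>h\<close> fixes everything in its own
    image.\<close>
  have key: "h y (G y y m) = G y y m" if h: "h \<in> F" and y: "y \<in> C" and m: "m \<in> car y" for h y m
  proof -
    have hB: "h \<in> B" by (rule F_B[OF h])
    have "(h \<otimes>\<^bsub>E\<^esub> G y) y ` car y \<subseteq> G y y ` car y"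
    proof
      fix n assume "n \<in> (h \<otimes>\<^bsub>E\<^esub> G y) y ` car y"
      then obtain k where k: "k \<in> car y" "n = (h \<otimes>\<^bsub>E\<^esub> G y) y k" by blast
      then have "n = G y y (h y k)" using y by (simp add: End_mult B_comm_apply[OF hB GB])
      then show "n \<in> G y y ` car y" using B_closed[OF hB y k(1)] by blast
    qed
    from G_min[OF y F_mult[OF h G[OF y]] this] have "G y y m \<in> (h \<otimes>\<^bsub>E\<^esub> G y) y ` car y" using m by blast
    then obtain k where k: "k \<in> car y" "G y y m = h y (G y y k)" using y by (auto simp: End_mult)
    then show ?thesis using B_idem_apply[OF hB y B_closed[OF GB[OF y] y k(1)]] by simp
  qed
  define p where "p = endo (\<lambda>y. G y y)"
  have pB: "p \<in> B" unfolding p_def by (rule glue_in_B) (auto intro: GB key G)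
  have absorb: "h \<otimes>\<^bsub>E\<^esub> p = p" if h: "h \<in> F" for h
    by (intro End_eqI End_mult_closed B_carrier[OF F_B[OF h]] B_carrier[OF pB])
      (simp add: End_mult p_def key[OF h])
  have px: "p x (f x m1) = f x m1" 
    using G[OF x] m1 B_closed[OF f(1) x m1(1)] x by (simp add: p_def F_def)
  \<comment> \<open>Dichotomy by minimality of \<open>N\<close>: if \<open>h\<close> does not
    annihilate \<open>N\<close>, it fixes \<open>N\<close>, so it belongs to the filter and fixes
    \<open>p\<close>; otherwise \<open>1 - h\<close> belongs to the filter, and \<open>h\<close>
    annihilates \<open>p\<close>.\<close>
  have "h \<otimes>\<^bsub>E\<^esub> p = \<zero>\<^bsub>E\<^esub> \<or> h \<otimes>\<^bsub>E\<^esub> p = p" if h: "h \<in> B" for h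
  proof (cases "\<exists>m\<in>car x. (h \<otimes>\<^bsub>E\<^esub> f) x m \<noteq> ?z")
    case True
    have "e \<otimes>\<^bsub>E\<^esub> (h \<otimes>\<^bsub>E\<^esub> f) = h \<otimes>\<^bsub>E\<^esub> f"
      using B_comm[OF e h] f(2) B_carrier[OF e] B_carrier[OF h] B_carrier[OF f(1)] by (metis End.m_assoc)
    then have "(h \<otimes>\<^bsub>E\<^esub> f) x ` car x \<in> \<F>"
      unfolding \<F>_def by (intro imageI) (use True B_mult[OF h f(1)] in blast)
    moreover have "(h \<otimes>\<^bsub>E\<^esub> f) x ` car x \<subseteq> N"
    proof
      fix n assume "n \<in> (h \<otimes>\<^bsub>E\<^esub> f) x ` car x"
      then obtain k where k: "k \<in> car x" "n = (h \<otimes>\<^bsub>E\<^esub> f) x k" by blast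
      then have "n = f x (h x k)" using x by (simp add: End_mult B_comm_apply[OF h f(1)])
      then show "n \<in> N" unfolding Nf using B_closed[OF h x k(1)] by blast
    qed
    ultimately have eq: "(h \<otimes>\<^bsub>E\<^esub> f) x ` car x = f x ` car x" using N_min Nf by blast
    have "h x (f x m) = f x m" if m: "m \<in> car x" for m
    proof -
      have "f x m \<in> (h \<otimes>\<^bsub>E\<^esub> f) x ` car x" unfolding eq using m by blast
      then obtain k where k: "k \<in> car x" "f x m = h x (f x k)" using x by (auto simp: End_mult)
      then show ?thesis using B_idem_apply[OF h x B_closed[OF f(1) x k(1)]] by simp
    qed
    then have "h \<in> F" using h by (simp add: F_def)
    then show ?thesis using absorb by blast
  next
    case False
    have "\<one>\<^bsub>E\<^esub> \<ominus>\<^bsub>E\<^esub> h \<in> F"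
      using False x B_complement[OF h] B_complement_fixed_iff[OF h x] B_closed[OF f(1) x]
      by (simp add: F_def End_mult)
    then have "p = (\<one>\<^bsub>E\<^esub> \<ominus>\<^bsub>E\<^esub> h) \<otimes>\<^bsub>E\<^esub> p" using absorb by simp
    also have "\<dots> = p \<ominus>\<^bsub>E\<^esub> h \<otimes>\<^bsub>E\<^esub> p"
      using B_carrier[OF h] B_carrier[OF pB] by (simp add: a_minus_def End.l_distr End.l_minus)
    finally have "h \<otimes>\<^bsub>E\<^esub> (p \<ominus>\<^bsub>E\<^esub> h \<otimes>\<^bsub>E\<^esub> p) = h \<otimes>\<^bsub>E\<^esub> p" by simp
    moreover have "h \<otimes>\<^bsub>E\<^esub> (p \<ominus>\<^bsub>E\<^esub> h \<otimes>\<^bsub>E\<^esub> p) = h \<otimes>\<^bsub>E\<^esub> p \<ominus>\<^bsub>E\<^esub> (h \<otimes>\<^bsub>E\<^esub> h) \<otimes>\<^bsub>E\<^esub> p"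
      using B_carrier[OF h] B_carrier[OF pB] by (simp add: a_minus_def End.r_distr End.r_minus End.m_assoc)
    ultimately have "h \<otimes>\<^bsub>E\<^esub> p = \<zero>\<^bsub>E\<^esub>"
      using B_idem[OF h] B_carrier[OF h] B_carrier[OF pB] by (simp add: a_minus_def End.r_neg)
    then show ?thesis by blast
  qed
  moreover have "p \<noteq> \<zero>\<^bsub>E\<^esub>" using px m1 End_zero[OF x B_closed[OF f(1) x m1(1)]] by auto
  ultimately have "atom p" using pB by (simp add: atom_def)
  then show ?thesis
    using that[of p "f x m1"] absorb[OF eF] B_closed[OF f(1) x m1(1)] px m1 by simp
qed

text \<open>With infinitely many such atoms, the common kernels at x of the first n of them would
  descend strictly: a nonzero value of the next atom is killed by all earlier ones by orthogonality,
  but is fixed by that atom.\<close>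

lemma finite_atoms_at:
  assumes x: "x \<in> C"
  shows "finite {a. atom a \<and> (\<exists>m\<in>car x. a x m \<noteq> \<zero>\<^bsub>module_at M x\<^esub>)}" (is "finite ?A")
proof (rule ccontr)
  assume "infinite ?A"
  then obtain a :: "nat \<Rightarrow> _" where a: "inj a" "range a \<subseteq> ?A"
    using infinite_countable_subset by blast
  then have atom: "atom (a i)" for i by blast
  note E = B_carrier[OF atom_B[OF atom]]
  define N where "N n = {m \<in> car x. \<forall>i<n. a i x m = \<zero>\<^bsub>module_at M x\<^esub>}" for n
  interpret X: abelian_group "module_at M x" by (rule abelian_group) fact
  have "scalar_closed_subgroup x (N n)" for n
    unfolding scalar_closed_subgroup_def N_def
    using x by (auto simp: End_of_zero[OF E] End_additive[OF E] scalar_apply End_linear[OF E] scalar_closed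
      smult_closed smult_zero)
  moreover have "N (Suc n) \<subseteq> N n" for n by (auto simp: N_def)
  ultimately obtain k where k: "\<forall>n\<ge>k. N n = N k" using dcc[OF x, of N] by blast
  obtain m where m: "m \<in> car x" "a k x m \<noteq> \<zero>\<^bsub>module_at M x\<^esub>" using a(2) by blast
  have "a i x (a k x m) = \<zero>\<^bsub>module_at M x\<^esub>" if "i < k" for i
    using atom_orthogonal_apply[OF atom atom _ x m(1), of i k] a(1) that by (auto simp: inj_eq)
  then have "a k x m \<in> N k" using End_closed[OF E x m(1)] by (simp add: N_def)
  moreover have "a k x m \<notin> N (Suc k)"
    using m B_idem_apply[OF atom_B[OF atom] x m(1)] by (auto simp: N_def)
  ultimately show False using k le_SucI[OF order_refl] by blast
qed

text \<open>The witness is the product of all \<open>1 - a\<close> with \<open>a\<close> in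
  \<open>A\<close>, the complement of the join of \<open>A\<close>. It is orthogonal to
  \<open>A\<close> at all vertices, while its fixed elements are described at x, where
  \<open>A\<close> will comprise all atoms that are nonzero there.\<close>

lemma annihilating_idempotent:
  assumes "finite A" "\<And>a. a \<in> A \<Longrightarrow> a \<in> B" and x: "x \<in> C"
  shows "\<exists>e\<in>B. (\<forall>a\<in>A. e \<otimes>\<^bsub>E\<^esub> a = \<zero>\<^bsub>E\<^esub>) \<and>
    (\<forall>m\<in>car x. (\<forall>a\<in>A. a x m = \<zero>\<^bsub>module_at M x\<^esub>) \<longrightarrow> e x m = m)"
  using assms(1,2)
proof (induction A rule: finite_induct)
  case empty
  then show ?case using B_one End_one[OF x] by auto
next
  case (insert a A)
  then obtain e where e: "e \<in> B" "\<And>b. b \<in> A \<Longrightarrow> e \<otimes>\<^bsub>E\<^esub> b = \<zero>\<^bsub>E\<^esub>"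
    "\<And>m. \<lbrakk>m \<in> car x; \<forall>a\<in>A. a x m = \<zero>\<^bsub>module_at M x\<^esub>\<rbrakk> \<Longrightarrow> e x m = m" by auto
  have a: "a \<in> B" using insert by simp
  let ?c = "\<one>\<^bsub>E\<^esub> \<ominus>\<^bsub>E\<^esub> a"
  note cl = B_carrier[OF e(1)] B_carrier[OF a] B_carrier[OF B_complement[OF a]]
  have "?c \<otimes>\<^bsub>E\<^esub> a = \<zero>\<^bsub>E\<^esub>"
    using cl by (simp add: a_minus_def End.l_distr End.l_minus B_idem[OF a] End.r_neg)
  then have "e \<otimes>\<^bsub>E\<^esub> ?c \<otimes>\<^bsub>E\<^esub> a = \<zero>\<^bsub>E\<^esub>" using cl by (simp add: End.m_assoc)
  moreover have "e \<otimes>\<^bsub>E\<^esub> ?c \<otimes>\<^bsub>E\<^esub> b = \<zero>\<^bsub>E\<^esub>" if b: "b \<in> A" for b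
  proof -
    have "b \<in> B" using insert.prems b by simp
    then have "e \<otimes>\<^bsub>E\<^esub> ?c \<otimes>\<^bsub>E\<^esub> b = ?c \<otimes>\<^bsub>E\<^esub> (e \<otimes>\<^bsub>E\<^esub> b)"
      unfolding B_comm[OF e(1) B_complement[OF a]] using cl B_carrier by (simp add: End.m_assoc)
    then show ?thesis using e(2)[OF b] cl by simp
  qed
  moreover have "(e \<otimes>\<^bsub>E\<^esub> ?c) x m = m"
    if m: "m \<in> car x" "\<forall>b\<in>insert a A. b x m = \<zero>\<^bsub>module_at M x\<^esub>" for m
  proof -
    have "?c x m = m" using B_complement_fixed_iff[OF a x m(1)] m by simp
    then show ?thesis using e(3)[OF m(1)] m x by (simp add: End_mult)
  qed
  ultimately show ?case using B_mult[OF e(1) B_complement[OF a]] by (intro bexI[of _ "e \<otimes>\<^bsub>E\<^esub> ?c"]) auto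
qed

text \<open>Let \<open>e\<close> be orthogonal to the finitely many atoms that are nonzero at x. An
  \<open>m\<close> killed by all atoms is fixed by \<open>e\<close>; if it were nonzero, some atom
  below \<open>e\<close> would not vanish at x and would thus be one of those to which
  \<open>e\<close> is orthogonal.\<close>

lemma atoms_separate:
  assumes x: "x \<in> C" and m: "m \<in> car x" "\<And>a. atom a \<Longrightarrow> a x m = \<zero>\<^bsub>module_at M x\<^esub>"
  shows "m = \<zero>\<^bsub>module_at M x\<^esub>"
proof (rule ccontr)
  assume m0: "m \<noteq> \<zero>\<^bsub>module_at M x\<^esub>"
  let ?A = "{a. atom a \<and> (\<exists>m\<in>car x. a x m \<noteq> \<zero>\<^bsub>module_at M x\<^esub>)}"
  have "\<exists>e\<in>B. (\<forall>a\<in>?A. e \<otimes>\<^bsub>E\<^esub> a = \<zero>\<^bsub>E\<^esub>) \<and>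
      (\<forall>m\<in>car x. (\<forall>a\<in>?A. a x m = \<zero>\<^bsub>module_at M x\<^esub>) \<longrightarrow> e x m = m)"
    by (rule annihilating_idempotent[OF finite_atoms_at[OF x] _ x]) (simp add: atom_B)
  then obtain e where e: "e \<in> B" "\<forall>a\<in>?A. e \<otimes>\<^bsub>E\<^esub> a = \<zero>\<^bsub>E\<^esub>"
    and em: "\<forall>m\<in>car x. (\<forall>a\<in>?A. a x m = \<zero>\<^bsub>module_at M x\<^esub>) \<longrightarrow> e x m = m"
    by blast
  have "e x m = m" using em m by blast
  then obtain a n where a: "atom a" "e \<otimes>\<^bsub>E\<^esub> a = a" "n \<in> car x" "a x n \<noteq> \<zero>\<^bsub>module_at M x\<^esub>"
    using atom_below[OF e(1) x m(1)] m0 by metis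
  then have "e \<otimes>\<^bsub>E\<^esub> a = \<zero>\<^bsub>E\<^esub>" using e(2) by blast
  then show False using a by (simp add: atom_def)
qed

text \<open>The element is the sum of the \<open>d a\<close>: each atom fixes its own summand and
  kills the others by orthogonality.\<close>

lemma atoms_assemble:
  assumes x: "x \<in> C" and "finite A" "\<And>a. a \<in> A \<Longrightarrow> atom a" "\<And>a. a \<in> A \<Longrightarrow> d a \<in> a x ` car x"
  shows "\<exists>m\<in>car x. \<forall>b. atom b \<longrightarrow> b x m = (if b \<in> A then d b else \<zero>\<^bsub>module_at M x\<^esub>)"
  using assms(2-)
proof (induction A rule: finite_induct)
  case empty
  then show ?case
    using End_of_zero[OF B_carrier[OF atom_B] x] abelian_monoid.zero_closed[OF abelian_monoid[OF x]] by auto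
next
  case (insert a A)
  then obtain m where m: "m \<in> car x"
    "\<And>b. atom b \<Longrightarrow> b x m = (if b \<in> A then d b else \<zero>\<^bsub>module_at M x\<^esub>)" by auto
  obtain k where k: "k \<in> car x" "d a = a x k" using insert.prems by blast
  interpret X: abelian_group "module_at M x" by (rule abelian_group) fact
  have a: "atom a" using insert.prems by simp
  have da: "d a \<in> car x" using k B_closed[OF atom_B[OF a] x k(1)] by simp
  have "b x (m \<oplus>\<^bsub>module_at M x\<^esub> d a) = (if b \<in> insert a A then d b else \<zero>\<^bsub>module_at M x\<^esub>)"
    if b: "atom b" for b
  proof -
    have add: "b x (m \<oplus>\<^bsub>module_at M x\<^esub> d a) = b x m \<oplus>\<^bsub>module_at M x\<^esub> b x (d a)"
      by (rule End_additive[OF B_carrier[OF atom_B[OF b]] x m(1) da])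
    show ?thesis
    proof (cases "b = a")
      case True
      then show ?thesis
        using add m(2)[OF b] insert.hyps(2) da k B_idem_apply[OF atom_B[OF a] x k(1)] by simp
    next
      case False
      have "b x m \<in> car x" using B_closed[OF atom_B[OF b] x m(1)] .
      then show ?thesis
        using False add m(2)[OF b] atom_orthogonal_apply[OF b a False x k(1)] k by simp
    qed
  qed
  then show ?case using m da by (intro bexI[of _ "m \<oplus>\<^bsub>module_at M x\<^esub> d a"]) auto
qed

text \<open>An atom is minimal only within \<open>B\<close>, whereas an idempotent \<open>q\<close>
  of its image is arbitrary. Extended to \<open>p\<close> through the atom, it commutes with every
  \<open>f\<close> in \<open>B\<close>, because \<open>f\<close> acts on the image of the atom as
  zero or as the identity. Maximality therefore puts \<open>p\<close> in \<open>B\<close>, and the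
  atom property leaves only the two trivial cases.\<close>

lemma atom_strongly_indecomposable:
  assumes a: "atom a"
  shows "strongly_indecomposable \<SS> (sub_rep \<SS> M (\<lambda>x. a x ` car x))"
proof -
  define U where "U = (\<lambda>x. a x ` car x)"
  have aB: "a \<in> B" by (rule atom_B[OF a])
  have aE: "a \<in> carrier E" using aB B_End by blast
  have U: "subrep U" unfolding U_def by (rule subrep_image[OF aE])
  interpret U: artinian_representation \<SS> "sub_rep \<SS> M U" S \<iota> by (rule artinian_sub_rep[OF U])
  have Ucar: "U.car x = U x" for x by (simp add: module_at_sub_rep)
  have aU: "a x m \<in> U x" if "m \<in> car x" for x m using that by (simp add: U_def)
  have UM: "u \<in> car x" if "x \<in> C" "u \<in> U x" for x u using U that by (auto simp: subrep_def)
  have a_idem: "a x (a x m) = a x m" if "x \<in> C" "m \<in> car x" for x m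
    by (rule B_idem_apply[OF aB that])
  have a_id: "a x u = u" if "x \<in> C" "u \<in> U x" for x u using that a_idem by (auto simp: U_def)
  have "local_ring (rep_End \<SS> (sub_rep \<SS> M U))"
  proof (rule U.local_ring_End)
    show "\<one>\<^bsub>U.E\<^esub> \<noteq> \<zero>\<^bsub>U.E\<^esub>"
    proof
      assume eq: "\<one>\<^bsub>U.E\<^esub> = \<zero>\<^bsub>U.E\<^esub>"
      have "a x m = \<zero>\<^bsub>E\<^esub> x m" if xm: "x \<in> C" "m \<in> car x" for x m
      proof -
        have "a x m \<in> U.car x" using aU xm by (simp add: Ucar)
        from U.End_one[OF xm(1) this] U.End_zero[OF xm(1) this] eq show ?thesis
          using xm by (simp add: End_zero module_at_sub_rep)
      qed
      then have "a = \<zero>\<^bsub>E\<^esub>" by (intro End_eqI aE End.zero_closed) 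
      then show False using a by (simp add: atom_def)
    qed
  next
    fix q assume q: "q \<in> carrier U.E" and qq: "q \<otimes>\<^bsub>U.E\<^esub> q = q"
    have qU: "q x u \<in> U x" if "x \<in> C" "u \<in> U x" for x u
      using U.End_closed[OF q that(1)] that by (simp add: Ucar)
    have q_idem: "q x (q x u) = q x u" if "x \<in> C" "u \<in> U x" for x u
      using U.End_mult[OF that(1), of u q q] that qq by (simp add: Ucar)
    have q_zero: "q x \<zero>\<^bsub>module_at M x\<^esub> = \<zero>\<^bsub>module_at M x\<^esub>" if "x \<in> C" for x
      using U.End_of_zero[OF q that] by (simp add: module_at_sub_rep)
    define p where "p = endo (\<lambda>x m. q x (a x m))"
    have pE: "p \<in> carrier E" unfolding p_def by (rule corner_in_End[OF aE U aU q])
    have p: "p x m = q x (a x m)" if "x \<in> C" "m \<in> car x" for x m using that by (simp add: p_def)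
    have "p \<in> B"
    proof (rule B_max[OF pE])
      show "p \<otimes>\<^bsub>E\<^esub> p = p"
        by (intro End_eqI End_mult_closed pE)
          (simp add: End_mult p aU qU UM a_id q_idem)
      fix f assume f: "f \<in> B"
      have fE: "f \<in> carrier E" using f B_End by blast
      have comm: "f x (a x m) = a x (f x m)" if "x \<in> C" "m \<in> car x" for x m
        by (rule B_comm_apply[OF f aB that])
      have "q x (a x (f x m)) = f x (q x (a x m))" if xm: "x \<in> C" "m \<in> car x" for x m
      proof -
        have qa: "q x (a x m) \<in> U x" using aU qU xm by blast
        from a f consider "f \<otimes>\<^bsub>E\<^esub> a = \<zero>\<^bsub>E\<^esub>" | "f \<otimes>\<^bsub>E\<^esub> a = a" by (auto simp: atom_def)
        then show ?thesis
        proof cases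
          case 1
          then have fa: "f x (a x n) = \<zero>\<^bsub>module_at M x\<^esub>" if "n \<in> car x" for n
            using End_mult[OF xm(1) that, of f a] End_zero[OF xm(1) that] by simp
          have "f x (q x (a x m)) = \<zero>\<^bsub>module_at M x\<^esub>"
            using fa[OF UM[OF xm(1) qa]] a_id[OF xm(1) qa] by simp
          moreover have "a x (f x m) = \<zero>\<^bsub>module_at M x\<^esub>"
            using fa[OF xm(2)] comm[OF xm] by simp
          ultimately show ?thesis using q_zero[OF xm(1)] by simp
        next
          case 2
          then have fa: "f x (a x n) = a x n" if "n \<in> car x" for n
            using End_mult[OF xm(1) that, of f a] by simp
          have "f x (q x (a x m)) = q x (a x m)"
            using fa[OF UM[OF xm(1) qa]] a_id[OF xm(1) qa] by simp
          then show ?thesis using fa[OF xm(2)] comm[OF xm] by simp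
        qed
      qed
      then show "p \<otimes>\<^bsub>E\<^esub> f = f \<otimes>\<^bsub>E\<^esub> p"
        by (intro End_eqI End_mult_closed pE fE) (simp add: End_mult p End_closed[OF fE])
    qed
    then have "p \<otimes>\<^bsub>E\<^esub> a = \<zero>\<^bsub>E\<^esub> \<or> p \<otimes>\<^bsub>E\<^esub> a = a"
      using a by (auto simp: atom_def)
    moreover have pa: "q x u = (p \<otimes>\<^bsub>E\<^esub> a) x u" if "x \<in> C" "u \<in> U.car x" for x u
      using that UM by (simp add: Ucar End_mult p a_id)
    moreover have "q = \<zero>\<^bsub>U.E\<^esub>" if "p \<otimes>\<^bsub>E\<^esub> a = \<zero>\<^bsub>E\<^esub>"
    proof (intro U.End_eqI q U.End.zero_closed)
      fix x u assume "x \<in> C" "u \<in> U.car x"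
      then show "q x u = \<zero>\<^bsub>U.E\<^esub> x u"
        using pa[of x u] that UM[of x u] by (simp add: U.End_zero End_zero Ucar) (simp add: module_at_sub_rep)
    qed
    moreover have "q = \<one>\<^bsub>U.E\<^esub>" if "p \<otimes>\<^bsub>E\<^esub> a = a"
    proof (intro U.End_eqI q U.End.one_closed)
      fix x u assume "x \<in> C" "u \<in> U.car x"
      then show "q x u = \<one>\<^bsub>U.E\<^esub> x u"
        using pa[of x u] that by (simp add: U.End_one Ucar a_id)
    qed
    ultimately show "q = \<zero>\<^bsub>U.E\<^esub> \<or> q = \<one>\<^bsub>U.E\<^esub>" by blast
  qed
  then show ?thesis by (simp add: strongly_indecomposable_def U_def)
qed

end

end

section \<open>Decomposition\<close>

lemma carrier_module_direct_sum:
  assumes "\<And>i. i \<in> I \<Longrightarrow> abelian_group (M i)"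
  shows "carrier (module_direct_sum I M)
    = {d \<in> \<Pi>\<^sub>E i\<in>I. carrier (M i). finite {i \<in> I. d i \<noteq> \<zero>\<^bsub>M i\<^esub>}}"
  using assms by (simp add: module_direct_sum_def Let_def carrier_sum_group abelian_group.a_group)

text \<open>The comparison map sends m to the family of all \<open>p U x m\<close>. Here
  \<open>fin\<close> places it in the direct sum and not just in the product, \<open>inj\<close> and
  \<open>surj\<close> make it bijective at each vertex, and a vertexwise bijective morphism has an
  inverse.\<close>

lemma (in representation) isomorphic_direct_sumI:
  assumes p: "\<And>U. U \<in> I \<Longrightarrow> p U \<in> carrier E" and sub: "\<And>U. U \<in> I \<Longrightarrow> subrep U"
    and pU: "\<And>U x m. \<lbrakk>U \<in> I; x \<in> C; m \<in> car x\<rbrakk> \<Longrightarrow> p U x m \<in> U x"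
    and fin: "\<And>x m. \<lbrakk>x \<in> C; m \<in> car x\<rbrakk> \<Longrightarrow> finite {U \<in> I. p U x m \<noteq> \<zero>\<^bsub>module_at M x\<^esub>}"
    and inj: "\<And>x m. \<lbrakk>x \<in> C; m \<in> car x; \<And>U. U \<in> I \<Longrightarrow> p U x m = \<zero>\<^bsub>module_at M x\<^esub>\<rbrakk> \<Longrightarrow> m = \<zero>\<^bsub>module_at M x\<^esub>"
    and surj: "\<And>x A d. \<lbrakk>x \<in> C; finite A; A \<subseteq> I; \<And>U. U \<in> A \<Longrightarrow> d U \<in> U x\<rbrakk> \<Longrightarrow>
      \<exists>m\<in>car x. \<forall>U\<in>I. p U x m = (if U \<in> A then d U else \<zero>\<^bsub>module_at M x\<^esub>)"
  shows "rep_isomorphic \<SS> M (rep_direct_sum \<SS> I (sub_rep \<SS> M))"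
proof -
  let ?N = "sub_rep \<SS> M" and ?D = "rep_direct_sum \<SS> I (sub_rep \<SS> M)"
  define f where "f = (\<lambda>x\<in>C. \<lambda>m\<in>car x. \<lambda>U\<in>I. p U x m)"
  have f_apply: "f x m = (\<lambda>U\<in>I. p U x m)" if "x \<in> C" "m \<in> car x" for x m
    using that by (simp add: f_def)
  have D: "module_at ?D x = module_direct_sum I (\<lambda>U. module_at (?N U) x)" for x
    by (simp add: rep_direct_sum_def)
  have carD: "carrier (module_at ?D x)
      = {d \<in> \<Pi>\<^sub>E U\<in>I. U x. finite {U \<in> I. d U \<noteq> \<zero>\<^bsub>module_at M x\<^esub>}}" if x: "x \<in> C" for x
    unfolding D using carrier_module_direct_sum[of I "\<lambda>U. module_at (?N U) x"]
      left_module.axioms(2)[OF sub_rep_left_module[OF sub x]]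
    by (simp add: module_at_sub_rep)
  have addD: "d \<oplus>\<^bsub>module_at ?D x\<^esub> e = (\<lambda>U\<in>I. d U \<oplus>\<^bsub>module_at M x\<^esub> e U)" for x d e
    by (simp add: D module_direct_sum_def Let_def module_at_sub_rep)
  have smultD: "r \<odot>\<^bsub>module_at ?D x\<^esub> d = (\<lambda>U\<in>I. r \<odot>\<^bsub>module_at M x\<^esub> d U)" for x r d
    by (simp add: D module_direct_sum_def Let_def module_at_sub_rep)
  have lin: "f x \<in> left_linear (R x) (module_at M x) (module_at ?D x)" if x: "x \<in> C" for x
    unfolding left_linear_def
  proof (intro CollectI conjI ballI funcsetI)
    fix m assume m: "m \<in> car x"
    have "{U \<in> I. (\<lambda>U\<in>I. p U x m) U \<noteq> \<zero>\<^bsub>module_at M x\<^esub>} = {U \<in> I. p U x m \<noteq> \<zero>\<^bsub>module_at M x\<^esub>}"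
      by auto
    then show "f x m \<in> carrier (module_at ?D x)"
      using fin[OF x m] pU[OF _ x m] by (simp add: carD[OF x] f_apply[OF x m])
    fix n assume n: "n \<in> car x"
    show "f x (m \<oplus>\<^bsub>module_at M x\<^esub> n) = f x m \<oplus>\<^bsub>module_at ?D x\<^esub> f x n"
      using x m n End_additive[OF p x m n] by (auto simp: f_apply addD add_closed cong: restrict_cong)
  next
    fix r m assume r: "r \<in> carrier (R x)" and m: "m \<in> car x"
    show "f x (r \<odot>\<^bsub>module_at M x\<^esub> m) = r \<odot>\<^bsub>module_at ?D x\<^esub> f x m"
      using x m r End_linear[OF p x r m] by (auto simp: f_apply smultD smult_closed cong: restrict_cong)
  qed
  have bij: "bij_betw (f x) (car x) (carrier (module_at ?D x))" if x: "x \<in> C" for x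
    unfolding bij_betw_def
  proof
    interpret X: abelian_group "module_at M x" by (rule abelian_group) fact
    show "inj_on (f x) (car x)"
    proof (rule inj_onI)
      fix m n assume mn: "m \<in> car x" "n \<in> car x" "f x m = f x n"
      let ?d = "m \<ominus>\<^bsub>module_at M x\<^esub> n"
      have d: "?d \<in> car x" using mn by simp
      have "p U x ?d = \<zero>\<^bsub>module_at M x\<^esub>" if U: "U \<in> I" for U
      proof -
        have "f x m U = f x n U" using mn(3) by simp
        then have "p U x m = p U x n" using mn(1,2) U x by (simp add: f_apply)
        moreover have "p U x ?d \<oplus>\<^bsub>module_at M x\<^esub> p U x n = p U x m"
          using End_additive[OF p[OF U] x d mn(2)] mn by (simp add: a_minus_def X.a_assoc X.l_neg)
        ultimately show ?thesis
          using End_closed[OF p[OF U] x d] End_closed[OF p[OF U] x mn(2)] by simp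
      qed
      then have "?d = \<zero>\<^bsub>module_at M x\<^esub>" by (rule inj[OF x d])
      then show "m = n" using mn by (simp add: X.minus_eq_zero_iff)
    qed
    have "d \<in> f x ` car x" if "d \<in> carrier (module_at ?D x)" for d
    proof -
      have d: "d \<in> (\<Pi>\<^sub>E U\<in>I. U x)" "finite {U \<in> I. d U \<noteq> \<zero>\<^bsub>module_at M x\<^esub>}"
        using that by (simp_all add: carD[OF x])
      let ?A = "{U \<in> I. d U \<noteq> \<zero>\<^bsub>module_at M x\<^esub>}"
      have "\<exists>m\<in>car x. \<forall>U\<in>I. p U x m = (if U \<in> ?A then d U else \<zero>\<^bsub>module_at M x\<^esub>)"
        by (rule surj[OF x d(2)]) (use d(1) in \<open>auto simp: PiE_iff\<close>)
      then obtain m where m: "m \<in> car x"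
        and pm: "\<forall>U\<in>I. p U x m = (if U \<in> ?A then d U else \<zero>\<^bsub>module_at M x\<^esub>)" ..
      have "f x m = d"
        unfolding f_apply[OF x m]
      proof
        fix U show "(\<lambda>U\<in>I. p U x m) U = d U"
          using bspec[OF pm, of U] PiE_arb[OF d(1), of U] by (cases "U \<in> I") auto
      qed
      then show ?thesis using m by blast
    qed
    moreover have "f x m \<in> carrier (module_at ?D x)" if "m \<in> car x" for m
      using lin[OF x] that by (auto simp: left_linear_def)
    ultimately show "f x ` car x = carrier (module_at ?D x)" by blast
  qed
  have hom: "structure_map ?D y x (tensor_map (R x) (arrow \<SS> y x) (module_at ?D x) (\<lambda>a. a) (f x) (cls y x q))
      = f y (structure_map M y x (cls y x q))"
    if C: "y \<in> C" "x \<in> C" and q: "Poly_Mapping.keys q \<subseteq> arr y x \<times> car x" for y x q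
  proof -
    let ?q = "frag_map (\<lambda>a. a) (f x) q"
    have bal: "balanced_pair (R x) (arrow \<SS> y x) (module_at ?D x)"
      using balanced_pair.balanced_pair_image[OF balanced_pair[OF C] lin[OF C(2)]] bij[OF C(2)]
      by (simp add: bij_betw_def)
    \<comment> \<open>Evaluation at \<open>U\<close> after \<open>f x\<close> is
      \<open>p U x\<close>, so each component of the structure map of the sum reduces to the fact
      that \<open>p U\<close> is a morphism from \<open>M\<close> to the summand
      \<open>U\<close>.\<close>
    have comp: "structure_map (?N U) y x
        (tensor_map (R x) (arrow \<SS> y x) (module_at (?N U) x) (\<lambda>a. a) (\<lambda>d. d U)
          (tensor_class (R x) (arrow \<SS> y x) (module_at ?D x) ?q))
        = p U y (structure_map M y x (cls y x q))" if U: "U \<in> I" for U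
    proof -
      have "(\<lambda>d. d U) \<in> left_linear (R x) (module_at ?D x) (module_at (?N U) x)"
        using U by (auto simp: left_linear_def carD[OF C(2)] addD smultD module_at_sub_rep)
      from tensor_map_class[OF bal this, of "\<lambda>a. a"]
      have "tensor_map (R x) (arrow \<SS> y x) (module_at (?N U) x) (\<lambda>a. a) (\<lambda>d. d U)
          (tensor_class (R x) (arrow \<SS> y x) (module_at ?D x) ?q)
          = tensor_class (R x) (arrow \<SS> y x) (module_at (?N U) x) (frag_map (\<lambda>a. a) (\<lambda>d. d U) ?q)"
        by simp
      also have "frag_map (\<lambda>a. a) (\<lambda>d. d U) ?q = frag_map (\<lambda>a. a) (p U x) q"
        unfolding frag_map_compose by (rule frag_map_cong[OF q]) (use C U in \<open>auto simp: f_apply\<close>)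
      also have "tensor_class (R x) (arrow \<SS> y x) (module_at (?N U) x) \<dots>
          = tensor_map (R x) (arrow \<SS> y x) (module_at (?N U) x) (\<lambda>a. a) (p U x) (cls y x q)"
        by (rule tensor_map_cls[OF C, symmetric])
          (use rep_hom_sub_rep[OF p[OF U] sub[OF U] pU[OF U]] C in \<open>auto simp: rep_hom_def\<close>)
      finally show ?thesis
        using rep_hom_structure_map[OF rep_hom_sub_rep[OF p[OF U] sub[OF U] pU[OF U]] C cls_closed[OF C q]]
        by simp
    qed
    have "tensor_map (R x) (arrow \<SS> y x) (module_at ?D x) (\<lambda>a. a) (f x) (cls y x q)
        = tensor_class (R x) (arrow \<SS> y x) (module_at ?D x) ?q"
      by (rule tensor_map_cls[OF C lin[OF C(2)]])
    moreover have "structure_map ?D y x t = (\<lambda>U\<in>I. structure_map (?N U) y x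
        (tensor_map (R x) (arrow \<SS> y x) (module_at (?N U) x) (\<lambda>a. a) (\<lambda>d. d U) t))" for t
      by (simp add: rep_direct_sum_def)
    ultimately show ?thesis
      using f_apply[OF C(1) structure_map_closed[OF C q]] comp by (simp cong: restrict_cong)
  qed
  have "f \<in> (\<Pi>\<^sub>E x\<in>C. left_linear (R x) (module_at M x) (module_at ?D x) \<inter> extensional (car x))"
    using lin by (intro PiE_I IntI) (simp_all add: f_def)
  then have "f \<in> rep_hom \<SS> M ?D"
    unfolding rep_hom_def using hom by (simp add: balanced_pair.carrier_tensor[OF balanced_pair])
  from rep_hom_inverse[OF representation_axioms this bij] this show ?thesis
    unfolding rep_isomorphic_def by metis
qed

text \<open>The summands are indexed by themselves, that is, by the images of the atoms. The
  projection of a summand is then recovered from its image, which requires distinct atoms to have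
  distinct images.\<close>

lemma (in artinian_representation) strongly_indecomposable_decomposition:
  shows "\<exists>I. (\<forall>U\<in>I. subrep U \<and> strongly_indecomposable \<SS> (sub_rep \<SS> M U)) \<and>
    rep_isomorphic \<SS> M (rep_direct_sum \<SS> I (sub_rep \<SS> M))"
proof -
  obtain B where "B \<subseteq> carrier E" and max: "\<forall>e\<in>B. e \<otimes>\<^bsub>E\<^esub> e = e" "\<forall>e\<in>B. \<forall>f\<in>B. e \<otimes>\<^bsub>E\<^esub> f = f \<otimes>\<^bsub>E\<^esub> e"
    "\<forall>p\<in>carrier E. p \<otimes>\<^bsub>E\<^esub> p = p \<longrightarrow> (\<forall>f\<in>B. p \<otimes>\<^bsub>E\<^esub> f = f \<otimes>\<^bsub>E\<^esub> p) \<longrightarrow> p \<in> B"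
    using End.maximal_commuting_idempotents by (elim exE conjE)
  note B = this(1) max(1)[rule_format] max(2)[rule_format] max(3)[rule_format]
  let ?at = "atom B"
  have atB: "a \<in> B" if "?at a" for a by (rule atom_B[OF B that])
  have atE: "a \<in> carrier E" if "?at a" for a using atB[OF that] B(1) by blast
  have idem: "a x (a x m) = a x m" if "?at a" "x \<in> C" "m \<in> car x" for a x m
    by (rule B_idem_apply[OF B atB[OF that(1)] that(2,3)])
  define im where "im a = (\<lambda>x. a x ` car x)" for a :: "'c \<Rightarrow> 'm \<Rightarrow> 'm"
  \<comment> \<open>If the images agreed for distinct atoms, every value of \<open>a\<close> would
    be a value of \<open>b\<close>, hence killed by \<open>a\<close>, which also fixes it; so
    \<open>a\<close> would be zero.\<close>
  have "a = b" if a: "?at a" and b: "?at b" and eq: "im a = im b" for a b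
  proof (rule ccontr)
    assume "a \<noteq> b"
    have "a x m = \<zero>\<^bsub>E\<^esub> x m" if xm: "x \<in> C" "m \<in> car x" for x m
    proof -
      have "a x m \<in> im b x" using xm eq[symmetric] by (simp add: im_def)
      then obtain n where n: "n \<in> car x" "a x m = b x n" by (auto simp: im_def)
      have "a x m = a x (b x n)" using idem[OF a xm] n by simp
      also have "\<dots> = \<zero>\<^bsub>module_at M x\<^esub>" by (rule atom_orthogonal_apply[OF B a b \<open>a \<noteq> b\<close> xm(1) n(1)])
      finally show ?thesis using xm by (simp add: End_zero)
    qed
    then have "a = \<zero>\<^bsub>E\<^esub>" by (intro End_eqI atE[OF a] End.zero_closed)
    then show False using a by (simp add: atom_def[OF B])
  qed
  then have inj: "inj_on im (Collect ?at)" by (intro inj_onI) blast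
  define I where "I = im ` Collect ?at"
  \<comment> \<open>The projection attached to a summand: the unique atom with that image.\<close>
  define p where "p = inv_into (Collect ?at) im"
  have p: "?at (p U)" "im (p U) = U" if "U \<in> I" for U
    using inv_into_into[OF that[unfolded I_def]] f_inv_into_f[OF that[unfolded I_def]]
    by (simp_all only: p_def mem_Collect_eq)
  have p_im: "p (im a) = a" "im a \<in> I" if "?at a" for a
    using inv_into_f_f[OF inj] imageI[of a "Collect ?at" im] that by (simp_all only: p_def I_def mem_Collect_eq)
  have sub: "subrep U" if "U \<in> I" for U
    using subrep_image[OF atE[OF p(1)[OF that]]] p(2)[OF that] by (simp add: im_def)
  have mem: "p U x m \<in> U x" if "U \<in> I" "m \<in> car x" for U x m
  proof -
    have "p U x m \<in> im (p U) x" using that(2) by (simp add: im_def)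
    then show ?thesis using p(2)[OF that(1)] by simp
  qed
  have fin: "finite {U \<in> I. p U x m \<noteq> \<zero>\<^bsub>module_at M x\<^esub>}" if x: "x \<in> C" and m: "m \<in> car x" for x m
  proof (rule finite_subset)
    let ?A = "{a. ?at a \<and> (\<exists>m\<in>car x. a x m \<noteq> \<zero>\<^bsub>module_at M x\<^esub>)}"
    show "finite (im ` ?A)" using finite_atoms_at[OF B x] by (rule finite_imageI)
    show "{U \<in> I. p U x m \<noteq> \<zero>\<^bsub>module_at M x\<^esub>} \<subseteq> im ` ?A"
    proof
      fix U assume "U \<in> {U \<in> I. p U x m \<noteq> \<zero>\<^bsub>module_at M x\<^esub>}"
      then have U: "U \<in> I" "p U x m \<noteq> \<zero>\<^bsub>module_at M x\<^esub>" by simp_all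
      have "\<exists>m\<in>car x. p U x m \<noteq> \<zero>\<^bsub>module_at M x\<^esub>" by (rule bexI) (rule U(2), rule m)
      then have "p U \<in> ?A" using p(1)[OF U(1)] by simp
      then have "im (p U) \<in> im ` ?A" by (rule imageI)
      then show "U \<in> im ` ?A" unfolding p(2)[OF U(1)] .
    qed
  qed
  have sep: "m = \<zero>\<^bsub>module_at M x\<^esub>"
    if x: "x \<in> C" "m \<in> car x" and zero: "\<And>U. U \<in> I \<Longrightarrow> p U x m = \<zero>\<^bsub>module_at M x\<^esub>" for x m
  proof (rule atoms_separate[OF B x])
    fix a assume "?at a"
    then show "a x m = \<zero>\<^bsub>module_at M x\<^esub>" using zero[OF p_im(2), of a] p_im(1)[of a] by simp
  qed
  have assemble: "\<exists>m\<in>car x. \<forall>U\<in>I. p U x m = (if U \<in> A then d U else \<zero>\<^bsub>module_at M x\<^esub>)"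
    if x: "x \<in> C" and A: "finite A" "A \<subseteq> I" and d: "\<And>U. U \<in> A \<Longrightarrow> d U \<in> U x"
    for x A and d :: "('c \<Rightarrow> 'm set) \<Rightarrow> 'm"
  proof -
    have "\<exists>m\<in>car x. \<forall>b. ?at b \<longrightarrow> b x m = (if b \<in> p ` A then d (im b) else \<zero>\<^bsub>module_at M x\<^esub>)"
    proof (rule atoms_assemble[OF B x])
      show "finite (p ` A)" using A(1) by (rule finite_imageI)
      fix a assume "a \<in> p ` A"
      then obtain U where U: "a = p U" "U \<in> A" by (rule imageE)
      then have UI: "U \<in> I" using A(2) by blast
      show "?at a" unfolding U(1) by (rule p(1)[OF UI])
      have "U x = a x ` car x" using fun_cong[OF p(2)[OF UI], of x] unfolding U(1) im_def by (rule sym)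
      then show "d (im a) \<in> a x ` car x" using d[OF U(2)] p(2)[OF UI] U(1) by simp
    qed
    then obtain m where m: "m \<in> car x"
      "\<forall>b. ?at b \<longrightarrow> b x m = (if b \<in> p ` A then d (im b) else \<zero>\<^bsub>module_at M x\<^esub>)" ..
    show ?thesis
    proof (intro bexI[of _ m] ballI m(1))
      fix U assume U: "U \<in> I"
      have iff: "p U \<in> p ` A \<longleftrightarrow> U \<in> A"
      proof
        assume "p U \<in> p ` A"
        then obtain V where V: "p U = p V" "V \<in> A" by (rule imageE)
        then have "V \<in> I" using A(2) by blast
        have "U = im (p V)" using p(2)[OF U] unfolding V(1) by (rule sym)
        also have "\<dots> = V" by (rule p(2)[OF \<open>V \<in> I\<close>])
        finally show "U \<in> A" using V(2) by simp
      qed (rule imageI)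
      show "p U x m = (if U \<in> A then d U else \<zero>\<^bsub>module_at M x\<^esub>)"
        using m(2)[THEN spec, THEN mp, OF p(1)[OF U]] unfolding iff p(2)[OF U] .
    qed
  qed
  have "rep_isomorphic \<SS> M (rep_direct_sum \<SS> I (sub_rep \<SS> M))"
  proof (rule isomorphic_direct_sumI[of I p])
    show "p U \<in> carrier E" if "U \<in> I" for U by (rule atE[OF p(1)[OF that]])
    show "subrep U" if "U \<in> I" for U by (rule sub[OF that])
    show "p U x m \<in> U x" if "U \<in> I" "x \<in> C" "m \<in> car x" for U x m by (rule mem[OF that(1,3)])
    show "finite {U \<in> I. p U x m \<noteq> \<zero>\<^bsub>module_at M x\<^esub>}" if "x \<in> C" "m \<in> car x" for x m
      by (rule fin[OF that])
    show "m = \<zero>\<^bsub>module_at M x\<^esub>"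
      if "x \<in> C" "m \<in> car x" "\<And>U. U \<in> I \<Longrightarrow> p U x m = \<zero>\<^bsub>module_at M x\<^esub>" for x m
      using that by (rule sep)
    show "\<exists>m\<in>car x. \<forall>U\<in>I. p U x m = (if U \<in> A then d U else \<zero>\<^bsub>module_at M x\<^esub>)"
      if "x \<in> C" "finite A" "A \<subseteq> I" "\<And>U. U \<in> A \<Longrightarrow> d U \<in> U x" for x A and d :: "('c \<Rightarrow> 'm set) \<Rightarrow> 'm"
      using that by (rule assemble)
  qed
  moreover have "strongly_indecomposable \<SS> (sub_rep \<SS> M U)" if "U \<in> I" for U
  proof -
    have "strongly_indecomposable \<SS> (sub_rep \<SS> M (im (p U)))"
      unfolding im_def by (rule atom_strongly_indecomposable[OF B p(1)[OF that]])
    then show ?thesis unfolding p(2)[OF that] .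
  qed
  ultimately show ?thesis using sub by (intro exI[of _ I]) simp
qed

theorem lemma3p5:
  fixes \<SS> :: "('c, 'r, 'a) species"
    and S :: "'s ring" and \<iota> :: "'c \<Rightarrow> 's \<Rightarrow> 'r"
    and M :: "('c, 'r, 'a, 'm) rep"
  assumes "is_species \<SS>"
    and "common_central_subring \<SS> S \<iota>"
    and "acts_centrally \<SS> S \<iota>"
    and "is_representation \<SS> M"
    and "\<And>x. x \<in> vertices \<SS> \<Longrightarrow> artinian_module S (restrict_scalars (\<iota> x) (module_at M x))"
  shows "\<exists>(I :: ('c \<Rightarrow> 'm set) set) (N :: ('c \<Rightarrow> 'm set) \<Rightarrow> ('c, 'r, 'a, 'm) rep).
           (\<forall>i\<in>I. is_representation \<SS> (N i) \<and> strongly_indecomposable \<SS> (N i)) \<and>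
           rep_isomorphic \<SS> M (rep_direct_sum \<SS> I N)"
proof -
  interpret artinian_representation \<SS> M S \<iota>
    using assms by unfold_locales
  obtain I where I: "\<forall>U\<in>I. subrep U \<and> strongly_indecomposable \<SS> (sub_rep \<SS> M U)"
    "rep_isomorphic \<SS> M (rep_direct_sum \<SS> I (sub_rep \<SS> M))"
    using strongly_indecomposable_decomposition by blast
  then have "is_representation \<SS> (sub_rep \<SS> M U)" if "U \<in> I" for U
    using representation.representation[OF representation_sub_rep] that by blast
  with I show ?thesis by (intro exI[of _ I] exI[of _ "sub_rep \<SS> M"]) simp
qed

end
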